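(* Let $R(q)=\dfrac{(q;q^5)_\infty(q^4;q^5)_\infty}{(q^2;q^5)_\infty(q^3;q^5)_\infty}$ and define integers $A(n),B(n),C(n),D(n)$ by $$\frac{1}{R^5(q)}=\sum_{n\ge0}A(n)q^n,\quad R^5(q)=\sum_{n\ge0}B(n)q^n,\quad \frac{R^5(q)}{R(q^5)}=\sum_{n\ge0}C(n)q^n,\quad \frac{R(q^5)}{R^5(q)}=\sum_{n\ge0}D(n)q^n.$$ Then for all integers $n\ge 0$: $A(9n+4)\equiv 0 \pmod 3$; $B(9n+2)\equiv 0\pmod 3$; $A(16n+13)\equiv 0\pmod 4$; $B(16n+11)\equiv 0\pmod 4$; $A(15n+r)\equiv 0\pmod{15}$ for $r\in\{4,8,13,14\}$; $B(15n+r)\equiv 0\pmod{15}$ for $r\in\{2,6,11,12\}$; $C(15n+r)\equiv 0\pmod{30}$ for $r\in\{3,13\}$; $D(15n+r)\equiv 0\pmod{30}$ for $r\in\{7,12\}$.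
   Context: For complex $a,q$ with $|q|<1$, $(a;q)_\infty:=\prod_{k=0}^{\infty}(1-aq^k)$. All series are power series in $q$ with integer coefficients. *)

theory Defs
  imports "HOL-Analysis.Analysis" "HOL-Number_Theory.Cong"
begin

definition qpoch_inf :: "complex \<Rightarrow> complex \<Rightarrow> complex" where
  "qpoch_inf a q = (\<Prod>k. 1 - a * q ^ k)"

(* Rogers-Ramanujan continued fraction without the customary factor q^(1/5). *)
definition RR :: "complex \<Rightarrow> complex" where
  "RR q = (qpoch_inf q (q ^ 5) * qpoch_inf (q ^ 4) (q ^ 5)) /
          (qpoch_inf (q ^ 2) (q ^ 5) * qpoch_inf (q ^ 3) (q ^ 5))"

(* Equality on the whole open unit disc; the identity theorem makes the
   coefficient sequence unique. *)
definition int_power_series :: "(complex \<Rightarrow> complex) \<Rightarrow> (nat \<Rightarrow> int) \<Rightarrow> bool" where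
  "int_power_series f a \<longleftrightarrow>
     (\<forall>q. norm q < 1 \<longrightarrow> (\<lambda>n. of_int (a n) * q ^ n) sums f q)"

end

theory Submission
  imports Defs "HOL-Complex_Analysis.Laurent_Convergence"
begin

text \<open>
  The Jacobi triple product makes \<open>theta (x * y) q * theta (x / y) q\<close> a \<open>2 \<times> 2\<close> minor, so that theta
  functions satisfy the three-term relation. Special values of it give the modular equations between
  \<open>R = R(q)\<close> and \<open>R(q\<^sup>2)\<close>, \<open>R(q\<^sup>3)\<close>; splitting the theta series at a fifth root of unity
  gives the one between \<open>R\<close> and \<open>R(q\<^sup>5)\<close>.

  The first two become monic equations over the ring of power series in \<open>q\<^sup>m\<close> (\<open>m = 2, 3\<close>)
  for \<open>k = q R(q) R(q\<^sup>2)\<^sup>2\<close> and \<open>x = q\<^sup>2 R(q) R(q\<^sup>3)\<^sup>3\<close>. Modulo \<open>4\<close> and \<open>3\<close>, \<open>q R\<^sup>5\<close> is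
  congruent to \<open>k\<close> and \<open>q\<^sup>2 R\<^sup>1\<^sup>0\<close> to \<open>x\<close>. Since the conjugates under \<open>q \<mapsto> \<zeta> q\<close> are roots
  too, the characteristic polynomial of \<open>k\<close>, resp. \<open>x\<close>, divides the equation. This expresses one
  section of the series through the same series in \<open>q\<^sup>m\<close>, and iterating gives the congruences along \<open>16 n + r\<close>
  and \<open>9 n + r\<close>.

  With \<open>v = q R(q\<^sup>5)\<close> the third one writes \<open>R\<^sup>5 / R(q\<^sup>5)\<close> as a polynomial in \<open>v\<close> divided by the
  series \<open>1 - 11 v\<^sup>5 - v\<^sup>1\<^sup>0\<close> in \<open>q\<^sup>5\<close>. The sections modulo \<open>5\<close> can be read off from the coefficients, which are
  visibly divisible by \<open>5\<close> or \<open>10\<close>, and modulo \<open>3\<close> what remains is a power of \<open>q\<close> times a cube.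
\<close>


section \<open>The Jacobi triple product\<close>

text \<open>The choice of \<open>k\<close> and \<open>x\<close> comes from Frobenius: squaring R^2
  == R(q^2) (mod 2) gives R^4 == R(q^2)^2 (mod 4), and R^3 == R(q^3) (mod 3) gives R^9 == R(q^3)^3
  (mod 3). The relations between the sections are nevertheless proved over the integers, because a
  factor 2 or 3 has to be cancelled before anything is reduced. The iteration closes up through the
  reciprocals g = 1 / (1 + k) and g = 1 / (1 + x): with e and a the sections of k and x in the class
  0, the relations become 1 + e == g(q^2) (mod 4) and, for s = q^3 R(q^3)^5, a == - s g(q^3) (mod
  3). What remains is a statement about g itself, and this is the real obstacle. Modulo 4 the class
  3 modulo 4 of g^2 must vanish; one factor 2 comes from the cross term of a square, the other from
  the parity of a series H for which q H^2 is congruent to a polynomial in k. Modulo 3 the class 1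
  of g must vanish; only its product with the class 2 is accessible, and the latter is invertible up
  to a power of q.\<close>

lemma qpoch_convergent_prod:
  fixes a q :: complex
  assumes "norm q < 1"
  shows "convergent_prod (\<lambda>k. 1 - a * q ^ k)"
proof -
  have "summable (\<lambda>k. norm a * norm q ^ k)"
    using assms by (intro summable_mult summable_geometric) auto
  then have "abs_convergent_prod (\<lambda>k. 1 - a * q ^ k)"
    by (subst abs_convergent_prod_conv_summable) (simp add: norm_mult norm_power)
  then show ?thesis
    by (rule abs_convergent_prod_imp_convergent_prod)
qed

lemma qpoch_LIMSEQ:
  assumes "norm q < 1"
  shows "(\<lambda>n. \<Prod>k<n. 1 - a * q ^ k) \<longlonglongrightarrow> qpoch_inf a q"
  unfolding qpoch_inf_def
  using convergent_prod_LIMSEQ[OF qpoch_convergent_prod[OF assms, of a]]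
  by (subst LIMSEQ_lessThan_iff_atMost)

lemma qpoch_nonzero:
  assumes "norm q < 1" "\<And>k. a * q ^ k \<noteq> 1"
  shows "qpoch_inf a q \<noteq> 0"
  unfolding qpoch_inf_def
proof (rule prodinf_nonzero)
  show "1 - a * q ^ k \<noteq> 0" for k
    using assms(2)[of k] by simp
qed (use assms in \<open>simp add: qpoch_convergent_prod\<close>)

lemma norm_mult_power_less_one:
  fixes a q :: complex
  assumes "norm a < 1" "norm q < 1"
  shows "a * q ^ k \<noteq> 1"
proof -
  have "norm (a * q ^ k) = norm a * norm q ^ k"
    by (simp add: norm_mult norm_power)
  also have "\<dots> \<le> norm a * 1"
    using assms by (intro mult_left_mono power_le_one) auto
  finally show ?thesis
    using assms by auto
qed

lemma qpoch_nonzero':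
  assumes "norm q < 1" "norm a < 1"
  shows "qpoch_inf a q \<noteq> 0"
  using assms norm_mult_power_less_one by (intro qpoch_nonzero) auto

lemma qpoch_zero: "norm q < 1 \<Longrightarrow> qpoch_inf 1 q = 0"
proof -
  assume q: "norm q < 1"
  have "(\<lambda>n. \<Prod>k<Suc n. 1 - 1 * q ^ k) \<longlonglongrightarrow> qpoch_inf 1 q"
    using qpoch_LIMSEQ[OF q, of 1] by (rule LIMSEQ_Suc)
  moreover have "(\<lambda>n. \<Prod>k<Suc n. 1 - 1 * q ^ k) = (\<lambda>n. 0)"
    by (subst prod.lessThan_Suc_shift) simp
  ultimately show ?thesis
    by (simp add: LIMSEQ_const_iff)
qed

lemma qpoch_rec:
  assumes "norm q < 1"
  shows "qpoch_inf a q = (1 - a) * qpoch_inf (a * q) q"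
proof (rule LIMSEQ_unique)
  show "(\<lambda>n. \<Prod>k<Suc n. 1 - a * q ^ k) \<longlonglongrightarrow> qpoch_inf a q"
    using qpoch_LIMSEQ[OF assms, of a] by (rule LIMSEQ_Suc)
  show "(\<lambda>n. \<Prod>k<Suc n. 1 - a * q ^ k) \<longlonglongrightarrow> (1 - a) * qpoch_inf (a * q) q"
    using tendsto_mult_left[OF qpoch_LIMSEQ[OF assms, of "a * q"], of "1 - a"]
    by (subst prod.lessThan_Suc_shift) (simp add: mult_ac)
qed

text \<open>Grouping the factors by the residue of the exponent modulo \<open>m\<close> is exact for
  partial products of length \<open>n * m\<close>, so the limit is taken along that
  subsequence.\<close>

lemma qpoch_multisection:
  assumes q: "norm q < 1" and m: "m > 0"
  shows "qpoch_inf a q = (\<Prod>i<m. qpoch_inf (a * q ^ i) (q ^ m))"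
proof (rule LIMSEQ_unique)
  have "strict_mono (\<lambda>n. n * m)"
    using m by (auto simp: strict_mono_def)
  from LIMSEQ_subseq_LIMSEQ[OF qpoch_LIMSEQ[OF q] this]
  show "(\<lambda>n. \<Prod>k<n * m. 1 - a * q ^ k) \<longlonglongrightarrow> qpoch_inf a q"
    by (simp add: o_def)
  have qm: "norm (q ^ m) < 1"
    using q m by (simp add: norm_power power_less_one_iff)
  have "(\<lambda>n. \<Prod>i<m. \<Prod>k<n. 1 - (a * q ^ i) * (q ^ m) ^ k) \<longlonglongrightarrow> (\<Prod>i<m. qpoch_inf (a * q ^ i) (q ^ m))"
    by (intro tendsto_prod qpoch_LIMSEQ qm)
  moreover have "(\<Prod>k<n * m. 1 - a * q ^ k) = (\<Prod>i<m. \<Prod>k<n. 1 - (a * q ^ i) * (q ^ m) ^ k)" for n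
  proof -
    have "(\<Prod>k<n. \<Prod>i<m. 1 - a * q ^ (i + k * m)) = (\<Prod>k<n * m. 1 - a * q ^ k)"
      using prod.nat_group[of "\<lambda>k. 1 - a * q ^ k" m n]
      by (simp add: prod.shift_bounds_nat_ivl prod.atLeastLessThan_shift_0[where m="_ * m"] atLeast0LessThan add.commute)
    then show ?thesis
      by (subst prod.swap) (simp add: power_add power_mult mult_ac flip: power_mult)
  qed
  ultimately show "(\<lambda>n. \<Prod>k<n * m. 1 - a * q ^ k) \<longlonglongrightarrow> (\<Prod>i<m. qpoch_inf (a * q ^ i) (q ^ m))"
    by simp
qed

text \<open>Each factor multiplies out over \<open>i\<close> separately. The factorisation of
  \<open>1 - x ^ m\<close> enters as a hypothesis; powers of a cube root or of a fifth root of unity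
  will supply it.\<close>

lemma qpoch_roots_of_unity:
  assumes q: "norm q < 1" and m: "m > 0"
    and w: "\<And>x. (\<Prod>i<m. 1 - w i * x) = 1 - x ^ m"
  shows "(\<Prod>i<m. qpoch_inf (w i * a) q) = qpoch_inf (a ^ m) (q ^ m)"
proof (rule LIMSEQ_unique)
  have qm: "norm (q ^ m) < 1"
    using q m by (simp add: norm_power power_less_one_iff)
  show "(\<lambda>n. \<Prod>k<n. 1 - a ^ m * (q ^ m) ^ k) \<longlonglongrightarrow> qpoch_inf (a ^ m) (q ^ m)"
    by (rule qpoch_LIMSEQ[OF qm])
  have "(\<lambda>n. \<Prod>i<m. \<Prod>k<n. 1 - (w i * a) * q ^ k) \<longlonglongrightarrow> (\<Prod>i<m. qpoch_inf (w i * a) q)"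
    by (intro tendsto_prod qpoch_LIMSEQ q)
  moreover have "(\<Prod>i<m. \<Prod>k<n. 1 - (w i * a) * q ^ k) = (\<Prod>k<n. 1 - a ^ m * (q ^ m) ^ k)" for n
    by (subst prod.swap) (simp add: w mult.assoc power_mult_distrib flip: power_mult, simp add: mult.commute)
  ultimately show "(\<lambda>n. \<Prod>k<n. 1 - a ^ m * (q ^ m) ^ k) \<longlonglongrightarrow> (\<Prod>i<m. qpoch_inf (w i * a) q)"
    by simp
qed

section \<open>The q-binomial theorem and the finite triple product\<close>

definition tri :: "int \<Rightarrow> int" where
  "tri n = n * (n - 1) div 2"

lemma two_tri: "2 * tri n = n * (n - 1)"
  by (simp add: tri_def)

lemma tri_add: "tri (m + n) = tri m + tri n + m * n"
proof -
  have "2 * tri (m + n) = 2 * (tri m + tri n + m * n)"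
    by (simp only: two_tri distrib_left) (simp add: algebra_simps)
  then show ?thesis by simp
qed

lemma tri_minus: "tri (- n) = tri n + n"
proof -
  have "2 * tri (- n) = 2 * (tri n + n)"
    by (simp only: two_tri distrib_left) (simp add: algebra_simps)
  then show ?thesis by simp
qed

lemma tri_simps [simp]: "tri 0 = 0" "tri 1 = 0"
  by (simp_all add: tri_def)

lemma tri_of_nat: "tri (int j) = int (j * (j - 1) div 2)"
  by (cases j) (auto simp: tri_def zdiv_int algebra_simps)

definition qfac :: "complex \<Rightarrow> nat \<Rightarrow> complex" where
  "qfac q n = (\<Prod>k<n. 1 - q * q ^ k)"

lemma qfac_nonzero: "norm q < 1 \<Longrightarrow> qfac q n \<noteq> 0"
  using norm_mult_power_less_one[of q q] by (auto simp: qfac_def)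

text \<open>Induction on \<open>n\<close>: multiplying by the new factor
  \<open>1 - x * q ^ n\<close> acts on the Gaussian binomial coefficients by the q-Pascal rule
  \<open>cS\<close>.\<close>

lemma q_binomial_theorem:
  fixes q x :: complex
  assumes q: "norm q < 1"
  shows "(\<Prod>k<n. 1 - x * q ^ k) =
    (\<Sum>j\<le>n. (- x) ^ j * q ^ (j * (j - 1) div 2) * (qfac q n / (qfac q j * qfac q (n - j))))"
proof (induction n)
  case 0
  then show ?case by (simp add: qfac_def)
next
  case (Suc n)
  \<comment> \<open>Gaussian binomial coefficients, continued by zero beyond the top index so that
    the Pascal rule also covers \<open>j = n\<close>.\<close>
  define c where "c = (\<lambda>n j. if j \<le> n then qfac q n / (qfac q j * qfac q (n - j)) else 0)"
  define t where "t = (\<lambda>j. (- x) ^ j * q ^ (j * (j - 1) div 2))"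
  have nz: "qfac q k \<noteq> 0" for k
    using q by (rule qfac_nonzero)
  have fS: "qfac q (Suc k) = qfac q k * (1 - q ^ Suc k)" for k
    by (simp add: qfac_def)
  have f0: "qfac q 0 = 1"
    by (simp add: qfac_def)
  have q1: "q ^ Suc k \<noteq> 1" for k
    using norm_mult_power_less_one[OF q q, of k] by simp
  have c0: "c k 0 = 1" for k
    using nz by (simp add: c_def qfac_def)
  have tS: "t (Suc j) = - x * q ^ j * t j" for j
  proof -
    have "Suc j * (Suc j - 1) div 2 = j + j * (j - 1) div 2"
      by (cases j) auto
    then show ?thesis by (simp add: t_def power_add)
  qed
  have cS: "c (Suc n) (Suc j) = c n (Suc j) + q ^ (n - j) * c n j" if "j \<le> n" for j
  proof (cases "j = n")
    case True
    then show ?thesis using nz by (simp add: c_def f0)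
  next
    case False
    with that obtain d where d: "n = Suc (j + d)"
      by (metis less_imp_Suc_add nat_less_le)
    have "c (Suc n) (Suc j) = qfac q n * (1 - q ^ Suc n) / (qfac q (Suc j) * (qfac q d * (1 - q ^ Suc d)))"
      using d by (simp add: c_def fS)
    also have "1 - q ^ Suc n = (1 - q ^ Suc d) + q ^ Suc d * (1 - q ^ Suc j)"
      using d by (simp add: algebra_simps power_add)
    also have "qfac q n * \<dots> / (qfac q (Suc j) * (qfac q d * (1 - q ^ Suc d))) =
       qfac q n / (qfac q (Suc j) * qfac q d) + q ^ Suc d * (qfac q n / (qfac q j * (qfac q d * (1 - q ^ Suc d))))"
      using nz[of j] nz[of d] q1[of d] q1[of j] unfolding fS[of j] by (simp add: divide_simps) algebra
    also have "\<dots> = c n (Suc j) + q ^ (n - j) * c n j"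
      using d by (simp add: c_def fS)
    finally show ?thesis .
  qed
  have IH: "(\<Prod>k<n. 1 - x * q ^ k) = (\<Sum>j\<le>n. t j * c n j)"
    using Suc.IH by (simp add: t_def c_def)
  have "(\<Prod>k<Suc n. 1 - x * q ^ k) = (\<Sum>j\<le>n. t j * c n j) * (1 - x * q ^ n)"
    using IH by simp
  also have "\<dots> = (\<Sum>j\<le>Suc n. t j * c n j) + (\<Sum>j\<le>n. - x * q ^ n * t j * c n j)"
  proof -
    have "c n (Suc n) = 0" by (simp add: c_def)
    moreover have "(\<Sum>j\<le>n. - x * q ^ n * t j * c n j) = - x * q ^ n * (\<Sum>j\<le>n. t j * c n j)"
      by (simp only: sum_distrib_left mult.assoc)
    ultimately show ?thesis by (simp add: left_diff_distrib right_diff_distrib mult_ac)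
  qed
  also have "(\<Sum>j\<le>n. - x * q ^ n * t j * c n j) = (\<Sum>j\<le>n. t (Suc j) * (q ^ (n - j) * c n j))"
  proof (intro sum.cong refl)
    fix j assume "j \<in> {..n}"
    then have "q ^ n = q ^ j * q ^ (n - j)" by (simp flip: power_add)
    then show "- x * q ^ n * t j * c n j = t (Suc j) * (q ^ (n - j) * c n j)"
      by (simp add: tS)
  qed
  also have "(\<Sum>j\<le>Suc n. t j * c n j) = t 0 * c n 0 + (\<Sum>j\<le>n. t (Suc j) * c n (Suc j))"
    by (rule sum.atMost_Suc_shift)
  also have "t 0 * c n 0 + (\<Sum>j\<le>n. t (Suc j) * c n (Suc j)) + (\<Sum>j\<le>n. t (Suc j) * (q ^ (n - j) * c n j))
     = t 0 * c (Suc n) 0 + (\<Sum>j\<le>n. t (Suc j) * c (Suc n) (Suc j))"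
    by (simp add: c0 cS distrib_left sum.distrib)
  also have "\<dots> = (\<Sum>j\<le>Suc n. t j * c (Suc n) j)"
    by (rule sum.atMost_Suc_shift[symmetric])
  finally show ?case by (simp add: t_def c_def)
qed

definition theta_term :: "complex \<Rightarrow> complex \<Rightarrow> int \<Rightarrow> complex" where
  "theta_term z q n = q powi tri n * (- z) powi n"

text \<open>This is the q-binomial theorem of length \<open>2 * n\<close> at
  \<open>x = z / q ^ n\<close>. The upper half of the product is the one in \<open>z\<close>; the
  lower half, read backwards, is the one in \<open>q / z\<close> up to the monomial
  \<open>C\<close>. Centring the summation index at \<open>n\<close> then cancels \<open>C\<close>
  on both sides.\<close>

lemma finite_jacobi_triple_product:
  fixes q z :: complex
  assumes q: "norm q < 1" "q \<noteq> 0" and z: "z \<noteq> 0"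
  shows "(\<Prod>k<n. 1 - z * q ^ k) * (\<Prod>k<n. 1 - (q / z) * q ^ k) =
    (\<Sum>m\<in>{- int n..int n}. theta_term z q m * (qfac q (2 * n) / (qfac q (nat (int n + m)) * qfac q (nat (int n - m)))))"
proof -
  define x where "x = z / q ^ n"
  define C where "C = (- z) powi (int n) * q powi (tri (int n) - int n * int n)"
  have C: "(\<Prod>k<n. - z / q ^ Suc k) = C"
  proof -
    have "(\<Prod>k<n. - z / q ^ Suc k) = (- z) powi (int n) * q powi (- tri (- int n))" for n
    proof (induction n)
      case 0
      then show ?case by simp
    next
      case (Suc n)
      have *: "tri (- int (Suc n)) = tri (- int n) + int (Suc n)"
      proof -
        have "- int (Suc n) = - int n + - 1" "tri (- 1) = 1"
          by (simp_all add: tri_def)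
        then show ?thesis
          using tri_add[of "- int n" "- 1"] by (simp only:)
      qed
      have "(\<Prod>k<Suc n. - z / q ^ Suc k) = (- z) powi (int n) * q powi (- tri (- int n)) * (- z / q ^ Suc n)"
        using Suc by simp
      moreover have "(- z) powi (1 + int n) = - ((- z) ^ n * z)"
        using z by (simp add: power_int_add)
      moreover have "q powi (- (tri (- int n) + int (Suc n))) = q powi (- tri (- int n)) / q ^ Suc n"
        using power_int_diff[of q "- tri (- int n)" "int (Suc n)"] q
        by (metis minus_add_distrib power_int_of_nat uminus_add_conv_diff diff_minus_eq_add minus_diff_eq add.commute)
      ultimately show ?case
        unfolding * by simp
    qed
    moreover have "- tri (- int n) = tri (int n) - int n * int n"
      using tri_minus[of "int n"] two_tri[of "int n"] by (simp add: algebra_simps)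
    ultimately show ?thesis by (simp add: C_def)
  qed
  have Cnz: "C \<noteq> 0" using q z by (simp add: C_def)
  have "(\<Prod>k<2 * n. 1 - x * q ^ k) = (\<Prod>k<n. 1 - x * q ^ k) * (\<Prod>k\<in>{n..<2*n}. 1 - x * q ^ k)"
    by (subst prod.union_disjoint[symmetric]) (auto intro!: prod.cong)
  also have "(\<Prod>k\<in>{n..<2*n}. 1 - x * q ^ k) = (\<Prod>k<n. 1 - z * q ^ k)"
    using q by (intro prod.reindex_bij_witness[of _ "\<lambda>k. k + n" "\<lambda>k. k - n"])
      (auto simp: x_def power_diff field_simps)
  also have "(\<Prod>k<n. 1 - x * q ^ k) = (\<Prod>k<n. 1 - x * q ^ (n - Suc k))"
    by (rule prod.nat_diff_reindex[symmetric])
  also have "\<dots> = (\<Prod>k<n. (- z / q ^ Suc k) * (1 - (q / z) * q ^ k))"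
  proof (intro prod.cong refl)
    fix k assume "k \<in> {..<n}"
    then have "q ^ n = q ^ (n - Suc k) * q ^ Suc k"
      by (metis lessThan_iff Suc_leI le_add_diff_inverse2 power_add)
    then show "1 - x * q ^ (n - Suc k) = (- z / q ^ Suc k) * (1 - (q / z) * q ^ k)"
      using q z by (simp add: x_def field_simps)
  qed
  also have "\<dots> = C * (\<Prod>k<n. 1 - (q / z) * q ^ k)"
    by (simp only: prod.distrib C)
  finally have 1: "(\<Prod>k<2 * n. 1 - x * q ^ k) = C * ((\<Prod>k<n. 1 - z * q ^ k) * (\<Prod>k<n. 1 - (q / z) * q ^ k))"
    by simp
  have "(\<Prod>k<2 * n. 1 - x * q ^ k) = (\<Sum>j\<le>2*n. (- x) ^ j * q ^ (j * (j - 1) div 2) * (qfac q (2*n) / (qfac q j * qfac q (2*n - j))))"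
    by (rule q_binomial_theorem[OF q(1)])
  also have "\<dots> = (\<Sum>m\<in>{- int n..int n}. C * (theta_term z q m * (qfac q (2 * n) / (qfac q (nat (int n + m)) * qfac q (nat (int n - m))))))"
  proof (intro sum.reindex_bij_witness[of _ "\<lambda>m. nat (int n + m)" "\<lambda>j. int j - int n"])
    fix j assume j: "j \<in> {..2 * n}"
    define m where "m = int j - int n"
    have jm: "int j = int n + m" by (simp add: m_def)
    have e: "int (j * (j - 1) div 2) = tri m + tri (int n) + m * int n"
      unfolding tri_of_nat[symmetric] jm using tri_add[of "int n" m] by simp
    have x_eq: "- x = - z / q ^ n"
      by (simp add: x_def)
    have "q powi (- (int n * int j)) = inverse ((q ^ n) ^ j)"
      by (metis of_nat_mult power_int_minus power_int_of_nat power_mult)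
    then have "(- x) ^ j = (- z) powi int j * q powi (- (int n * int j))"
      unfolding x_eq power_divide by (simp add: divide_inverse)
    then have "(- x) ^ j * q ^ (j * (j - 1) div 2) =
        (- z) powi int j * (q powi (- (int n * int j)) * q powi (int (j * (j - 1) div 2)))"
      by (simp only: power_int_of_nat mult.assoc)
    also have "q powi (- (int n * int j)) * q powi (int (j * (j - 1) div 2)) =
        q powi (- (int n * int j) + int (j * (j - 1) div 2))"
      by (rule power_int_add[symmetric]) (use q in simp)
    also have "- (int n * int j) + int (j * (j - 1) div 2) = tri (int n) - int n * int n + tri m"
      unfolding e unfolding jm by (simp add: algebra_simps)
    also have "(- z) powi int j * q powi (tri (int n) - int n * int n + tri m) = C * theta_term z q m"
      using q z by (simp add: jm C_def theta_term_def power_int_add)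
    finally have "(- x) ^ j * q ^ (j * (j - 1) div 2) = C * theta_term z q m" .
    then show "C * (theta_term z q (int j - int n) * (qfac q (2 * n) /
            (qfac q (nat (int n + (int j - int n))) * qfac q (nat (int n - (int j - int n)))))) =
         (- x) ^ j * q ^ (j * (j - 1) div 2) * (qfac q (2 * n) / (qfac q j * qfac q (2 * n - j)))"
    proof -
      have "nat (int n + (int j - int n)) = j" "nat (int n - (int j - int n)) = 2 * n - j"
        using j by auto
      then show ?thesis
        using \<open>(- x) ^ j * q ^ (j * (j - 1) div 2) = C * theta_term z q m\<close>
        by (simp only: m_def mult.assoc)
    qed
  qed auto
  finally show ?thesis
    unfolding 1 sum_distrib_left[symmetric] by (rule mult_left_cancel[OF Cnz, THEN iffD1])
qed

section \<open>Absolute convergence of the theta series and the limit of the finite identity\<close>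

lemma theta_term_Suc:
  assumes "q \<noteq> 0" "z \<noteq> 0"
  shows "theta_term z q (n + 1) = - z * q powi n * theta_term z q n"
  using assms by (simp add: theta_term_def tri_add power_int_add)

text \<open>Reflection of the index exchanges \<open>z\<close> and \<open>q / z\<close>, which
  reduces the negative half of the series to the positive one.\<close>

lemma theta_term_minus:
  assumes "q \<noteq> 0" "z \<noteq> 0"
  shows "theta_term z q (- n) = theta_term (q / z) q n"
proof -
  have "(- z) powi (- n) * q powi n = (- (q / z)) powi n"
    using assms by (simp add: power_int_minus power_int_divide_distrib divide_inverse
        power_int_mult_distrib power_int_minus_left flip: power_int_inverse)
  then show ?thesis
    using assms by (simp add: theta_term_def tri_minus power_int_add mult_ac)
qed

lemma theta_term_abs_summable_nat:
  assumes q: "norm q < 1" "q \<noteq> 0" and z: "z \<noteq> 0"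
  shows "summable (\<lambda>k. norm (theta_term z q (int k)))"
proof -
  have "(\<lambda>k. norm z * norm q ^ k) \<longlonglongrightarrow> norm z * 0"
    using q by (intro tendsto_mult_left LIMSEQ_power_zero) auto
  then have "eventually (\<lambda>k. norm z * norm q ^ k < 1 / 2) sequentially"
    by (rule order_tendstoD) simp
  then obtain N where N: "\<And>k. k \<ge> N \<Longrightarrow> norm z * norm q ^ k < 1 / 2"
    by (auto simp: eventually_at_top_linorder)
  show ?thesis
  proof (rule summable_ratio_test[of "1 / 2" N])
    fix k assume "k \<ge> N"
    have "norm (theta_term z q (int (Suc k))) = norm z * norm q ^ k * norm (theta_term z q (int k))"
      using theta_term_Suc[OF q(2) z, of "int k"] by (simp add: norm_mult norm_power add.commute)
    also have "\<dots> \<le> 1 / 2 * norm (theta_term z q (int k))"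
      using N[OF \<open>k \<ge> N\<close>] by (intro mult_right_mono) auto
    finally show "norm (norm (theta_term z q (int (Suc k)))) \<le> 1 / 2 * norm (norm (theta_term z q (int k)))"
      by simp
  qed simp
qed

lemma theta_term_abs_summable:
  assumes q: "norm q < 1" "q \<noteq> 0" and z: "z \<noteq> 0"
  shows "(\<lambda>n. norm (theta_term z q n)) summable_on UNIV"
proof -
  let ?f = "\<lambda>n. norm (theta_term z q n)"
  have pos: "?f summable_on range int"
    by (subst summable_on_reindex)
      (use theta_term_abs_summable_nat[OF assms] in \<open>auto simp: o_def intro!: norm_summable_imp_summable_on\<close>)
  have neg: "?f summable_on range (\<lambda>k. - int k)"
    by (subst summable_on_reindex)
      (use theta_term_abs_summable_nat[OF q, of "q / z"] q z
       in \<open>auto simp: o_def inj_def theta_term_minus intro!: norm_summable_imp_summable_on\<close>)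
  have "?f summable_on (range int \<union> (range (\<lambda>k. - int k) - range int))"
    using pos summable_on_subset_banach[OF neg, of "range (\<lambda>k. - int k) - range int"]
    by (intro summable_on_Un_disjoint) auto
  also have "range int \<union> (range (\<lambda>k. - int k) - range int) = UNIV"
    by (auto simp: image_iff) (metis int_cases2)
  finally show ?thesis .
qed

text \<open>Tannery's theorem applied to the finite identity: the quotients \<open>c n m\<close>
  tend to \<open>1 / P\<close> for fixed \<open>m\<close>, and they are bounded uniformly because
  both \<open>qfac q n\<close> and its inverse converge.\<close>

theorem jacobi_triple_product:
  assumes q: "norm q < 1" "q \<noteq> 0" and z: "z \<noteq> 0"
  shows "(theta_term z q has_sum qpoch_inf z q * qpoch_inf (q / z) q * qpoch_inf q q) UNIV"
proof -
  define t where "t = theta_term z q"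
  define P where "P = qpoch_inf q q"
  define c where "c = (\<lambda>n m. qfac q (2 * n) / (qfac q (nat (int n + m)) * qfac q (nat (int n - m))))"
  \<comment> \<open>The integers are enumerated by \<open>int_decode\<close>, since Tannery's
    theorem speaks of series over the naturals; the terms outside \<open>- n..n\<close> are filled
    up with zeros.\<close>
  define a where "a = (\<lambda>k n. if \<bar>int_decode k\<bar> \<le> int n then t (int_decode k) * c n (int_decode k) else 0)"
  have Pnz: "P \<noteq> 0"
    using q by (simp add: P_def qpoch_nonzero')
  have lim: "qfac q \<longlonglongrightarrow> P"
    using qpoch_LIMSEQ[OF q(1), of q] by (simp add: qfac_def[abs_def] P_def)
  have lim_c: "(\<lambda>n. c n m) \<longlonglongrightarrow> P / (P * P)" for m
  proof -
    have 1: "filterlim (\<lambda>n. nat (int n + m)) sequentially sequentially" for m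
      unfolding filterlim_at_top
    proof
      fix Z :: nat
      show "\<forall>\<^sub>F n in sequentially. Z \<le> nat (int n + m)"
        using eventually_ge_at_top[of "Z + nat (- m)"] by eventually_elim auto
    qed
    have 2: "filterlim (\<lambda>n::nat. 2 * n) sequentially sequentially"
      by (intro filterlim_subseq) (auto simp: strict_mono_def)
    show ?thesis
      unfolding c_def
      using filterlim_compose[OF lim 1[of m]] filterlim_compose[OF lim 1[of "- m"]] filterlim_compose[OF lim 2] Pnz
      by (intro tendsto_intros) auto
  qed
  obtain K where K: "\<And>n. norm (qfac q n) \<le> K"
    using convergent_imp_Bseq[OF convergentI[OF lim]] by (auto simp: Bseq_def)
  have "(\<lambda>n. inverse (qfac q n)) \<longlonglongrightarrow> inverse P"
    using lim Pnz by (intro tendsto_inverse)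
  from convergent_imp_Bseq[OF convergentI[OF this]]
  obtain L where L: "\<And>n. norm (inverse (qfac q n)) \<le> L"
    by (auto simp: Bseq_def)
  have K0: "K \<ge> 0" and L0: "L \<ge> 0"
    using norm_ge_zero[of "qfac q 0"] K[of 0] norm_ge_zero[of "inverse (qfac q 0)"] L[of 0] by linarith+
  have c_le: "norm (c n m) \<le> K * (L * L)" for n m
    unfolding c_def divide_inverse inverse_mult_distrib norm_mult
    using K L K0 L0 by (intro mult_mono) auto
  have summ: "(\<lambda>k. norm (t (int_decode k))) summable_on UNIV"
    using theta_term_abs_summable[OF assms] summable_on_reindex_bij_betw[OF bij_int_decode, of "\<lambda>n. norm (t n)"]
    by (simp add: t_def)
  then have M: "summable (\<lambda>k. norm (t (int_decode k)) * (K * (L * L)))"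
    by (intro summable_mult2 summable_on_imp_summable)
  have "(\<lambda>n. suminf (\<lambda>k. a k n)) \<longlonglongrightarrow> suminf (\<lambda>k. t (int_decode k) * (P / (P * P)))"
  proof (rule tannerys_theorem[THEN conjunct2, THEN conjunct2, OF _ _ M])
    fix k
    have "eventually (\<lambda>n. \<bar>int_decode k\<bar> \<le> int n) sequentially"
      using eventually_ge_at_top[of "nat \<bar>int_decode k\<bar>"] by eventually_elim auto
    then have ev: "eventually (\<lambda>n. t (int_decode k) * c n (int_decode k) = a k n) sequentially"
      by eventually_elim (simp add: a_def)
    show "(\<lambda>n. a k n) \<longlonglongrightarrow> t (int_decode k) * (P / (P * P))"
      by (rule Lim_transform_eventually[OF tendsto_mult_left[OF lim_c] ev])
  next
    have "norm (a k n) \<le> norm (t (int_decode k)) * (K * (L * L))" for k n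
      using c_le[of n "int_decode k"] K0 L0 by (auto simp: a_def norm_mult intro!: mult_left_mono)
    then show "\<forall>\<^sub>F (k, n) in sequentially \<times>\<^sub>F sequentially. norm (a k n) \<le> norm (t (int_decode k)) * (K * (L * L))"
      by (intro always_eventually) auto
  qed simp
  moreover have "suminf (\<lambda>k. a k n) = (\<Prod>k<n. 1 - z * q ^ k) * (\<Prod>k<n. 1 - (q / z) * q ^ k)" for n
  proof -
    have "suminf (\<lambda>k. a k n) = (\<Sum>k\<in>int_encode ` {- int n..int n}. a k n)"
    proof (rule suminf_finite)
      fix k assume "k \<notin> int_encode ` {- int n..int n}"
      then have "int_decode k \<notin> {- int n..int n}"
        by (metis int_decode_inverse rev_image_eqI)
      then show "a k n = 0" by (auto simp: a_def)
    qed simp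
    also have "\<dots> = (\<Sum>m\<in>{- int n..int n}. t m * c n m)"
      by (subst sum.reindex) (auto simp: inj_int_encode a_def intro!: sum.cong)
    also have "\<dots> = (\<Prod>k<n. 1 - z * q ^ k) * (\<Prod>k<n. 1 - (q / z) * q ^ k)"
      unfolding t_def c_def by (rule finite_jacobi_triple_product[OF assms, symmetric])
    finally show ?thesis .
  qed
  ultimately have "(\<lambda>n. (\<Prod>k<n. 1 - z * q ^ k) * (\<Prod>k<n. 1 - (q / z) * q ^ k)) \<longlonglongrightarrow> suminf (\<lambda>k. t (int_decode k) * (P / (P * P)))"
    by simp
  moreover have "(\<lambda>n. (\<Prod>k<n. 1 - z * q ^ k) * (\<Prod>k<n. 1 - (q / z) * q ^ k)) \<longlonglongrightarrow> qpoch_inf z q * qpoch_inf (q / z) q"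
    by (intro tendsto_mult qpoch_LIMSEQ q)
  ultimately have "suminf (\<lambda>k. t (int_decode k) * (P / (P * P))) = qpoch_inf z q * qpoch_inf (q / z) q"
    by (rule LIMSEQ_unique)
  moreover have "(\<lambda>k. t (int_decode k)) summable_on UNIV"
    using summ by (rule abs_summable_summable)
  then have s: "((\<lambda>k. t (int_decode k)) has_sum infsum (\<lambda>k. t (int_decode k)) UNIV) UNIV"
    by simp
  then have "(\<lambda>k. t (int_decode k) * (P / (P * P))) sums (infsum (\<lambda>k. t (int_decode k)) UNIV * (P / (P * P)))"
    by (intro sums_mult2 has_sum_imp_sums)
  ultimately have "infsum (\<lambda>k. t (int_decode k)) UNIV = qpoch_inf z q * qpoch_inf (q / z) q * P"
    using Pnz by (simp add: sums_iff field_simps)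
  with s show ?thesis
    using has_sum_reindex_bij_betw[OF bij_int_decode, of t] by (simp add: t_def P_def)
qed

definition theta :: "complex \<Rightarrow> complex \<Rightarrow> complex" where
  "theta z q = qpoch_inf z q * qpoch_inf (q / z) q * qpoch_inf q q"

lemma theta_has_sum:
  assumes "norm q < 1" "q \<noteq> 0" "z \<noteq> 0"
  shows "(theta_term z q has_sum theta z q) UNIV"
  using jacobi_triple_product[OF assms] by (simp add: theta_def)

lemma theta_inverse:
  assumes "norm q < 1" "q \<noteq> 0" "z \<noteq> 0"
  shows "theta (1 / z) q = - theta z q / z"
proof -
  have "qpoch_inf (q / z) q * (1 - 1 / z) = qpoch_inf (1 / z) q"
    using qpoch_rec[of q "1 / z"] assms by simp
  moreover have "qpoch_inf (q * z) q * (1 - z) = qpoch_inf z q"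
    using qpoch_rec[of q z] assms by (simp add: mult_ac)
  ultimately show ?thesis
    using assms by (simp add: theta_def field_simps) algebra
qed

lemma theta_q_div: "theta (q / z) q = theta z q" if "z \<noteq> 0" "q \<noteq> 0"
  using that by (simp add: theta_def)

text \<open>In the double series put m = i + j, n = i - j if m + n is even, and m = i + j + 1, n = i
  - j if it is odd. The quadratic form in the exponent of \<open>q\<close> then separates, and
  either half is a product of two theta series to the base \<open>q\<^sup>2\<close>.\<close>

lemma theta_mult_split:
  assumes q: "norm q < 1" "q \<noteq> 0" and x: "x \<noteq> 0" and y: "y \<noteq> 0"
  shows "theta (x * y) q * theta (x / y) q =
    x * (x * theta (- (q\<^sup>2 * x\<^sup>2)) (q\<^sup>2) * theta (- (q * y\<^sup>2)) (q\<^sup>2)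
       - theta (- (q * x\<^sup>2)) (q\<^sup>2) * (y * theta (- (q\<^sup>2 * y\<^sup>2)) (q\<^sup>2)))"
proof -
  define f where "f = (\<lambda>(m, n). theta_term (x * y) q m * theta_term (x / y) q n)"
  \<comment> \<open>The shift to \<open>i - 1\<close> makes the exponent of \<open>q\<close> equal
    to \<open>i * i - i + j * j\<close>, which is \<open>tri (i + j) + tri (i - j)\<close>; its
    price is the factor \<open>x\<^sup>2\<close> in \<open>f_even\<close>.\<close>
  define g0 where "g0 = (\<lambda>(i, j). theta_term (- (q\<^sup>2 * x\<^sup>2)) (q\<^sup>2) (i - 1) * theta_term (- (q * y\<^sup>2)) (q\<^sup>2) j)"
  define g1 where "g1 = (\<lambda>(i, j). theta_term (- (q * x\<^sup>2)) (q\<^sup>2) i * theta_term (- (q\<^sup>2 * y\<^sup>2)) (q\<^sup>2) j)"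
  have q2: "norm (q\<^sup>2) < 1" "q\<^sup>2 \<noteq> 0"
    using q by (auto simp: norm_power power_less_one_iff)
  have prod_sum: "((\<lambda>(m, n). u m * v n) has_sum U * V) UNIV"
    if "(u has_sum U) UNIV" "(v has_sum V) UNIV" "(\<lambda>n. norm (u n)) summable_on UNIV" "(\<lambda>n. norm (v n)) summable_on UNIV"
    for u v :: "int \<Rightarrow> complex" and U V
  proof -
    have "(\<lambda>p. norm (u (fst p) * v (snd p))) summable_on UNIV \<times> UNIV"
    proof (rule summable_on_SigmaI)
      show "((\<lambda>n. norm (u (fst (m, n)) * v (snd (m, n)))) has_sum norm (u m) * infsum (\<lambda>n. norm (v n)) UNIV) UNIV" for m
        using has_sum_cmult_right[OF has_sum_infsum[OF that(4)], of "norm (u m)"] by (simp add: norm_mult)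
      show "(\<lambda>m. norm (u m) * infsum (\<lambda>n. norm (v n)) UNIV) summable_on UNIV"
        by (intro summable_on_cmult_left that)
    qed auto
    then have "(\<lambda>p. u (fst p) * v (snd p)) summable_on UNIV \<times> UNIV"
      by (rule abs_summable_summable)
    then have "((\<lambda>p. u (fst p) * v (snd p)) has_sum U * V) (UNIV \<times> UNIV)"
      by (intro has_sum_SigmaI[where g = "\<lambda>m. u m * V"])
        (use that in \<open>auto intro: has_sum_cmult_left has_sum_cmult_right\<close>)
    then show ?thesis by (simp add: case_prod_unfold)
  qed
  have f: "(f has_sum theta (x * y) q * theta (x / y) q) UNIV"
    unfolding f_def using q x y
    by (intro prod_sum theta_has_sum theta_term_abs_summable) auto
  have "((\<lambda>i. theta_term (- (q\<^sup>2 * x\<^sup>2)) (q\<^sup>2) (i - 1)) has_sum theta (- (q\<^sup>2 * x\<^sup>2)) (q\<^sup>2)) UNIV"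
    using theta_has_sum[OF q2, of "- (q\<^sup>2 * x\<^sup>2)"] q x
    by (subst has_sum_reindex_bij_witness[of _ "\<lambda>i. i + 1" "\<lambda>i. i - 1" UNIV "theta_term (- (q\<^sup>2 * x\<^sup>2)) (q\<^sup>2)"]) auto
  moreover have "(\<lambda>i. norm (theta_term (- (q\<^sup>2 * x\<^sup>2)) (q\<^sup>2) (i - 1))) summable_on UNIV"
    using theta_term_abs_summable[OF q2, of "- (q\<^sup>2 * x\<^sup>2)"] q x
    by (subst summable_on_reindex_bij_witness[of _ "\<lambda>i. i + 1" "\<lambda>i. i - 1" UNIV "\<lambda>i. norm (theta_term (- (q\<^sup>2 * x\<^sup>2)) (q\<^sup>2) i)"]) auto
  ultimately have g0: "(g0 has_sum theta (- (q\<^sup>2 * x\<^sup>2)) (q\<^sup>2) * theta (- (q * y\<^sup>2)) (q\<^sup>2)) UNIV"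
    unfolding g0_def using q2 q x y
    by (intro prod_sum theta_has_sum theta_term_abs_summable) auto
  have g1: "(g1 has_sum theta (- (q * x\<^sup>2)) (q\<^sup>2) * theta (- (q\<^sup>2 * y\<^sup>2)) (q\<^sup>2)) UNIV"
    unfolding g1_def using q2 q x y
    by (intro prod_sum theta_has_sum theta_term_abs_summable) auto
  have sq: "theta_term (- (q ^ a * w\<^sup>2)) (q\<^sup>2) n = q powi (n * (n - 1) + int a * n) * w powi (2 * n)"
    if "w \<noteq> 0" for a w n
  proof -
    have "(q\<^sup>2) powi tri n = q powi (n * (n - 1))"
      by (metis power_int_mult power_int_numeral two_tri of_nat_numeral power_int_of_nat)
    moreover have "(q ^ a) powi n = q powi (int a * n)"
      by (simp add: power_int_mult)
    moreover have "(w\<^sup>2) powi n = w powi (2 * n)"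
      by (metis power_int_mult power_int_numeral)
    ultimately show ?thesis
      using that q by (simp add: theta_term_def power_int_mult_distrib power_int_add)
  qed
  have lin: "theta_term w q n = q powi tri n * (- 1) powi n * w powi n" for w n
    unfolding theta_term_def by (metis minus_mult_left mult_1 power_int_mult_distrib mult.assoc)
  have f_eq: "f (m, n) = q powi (tri m + tri n) * (- 1) powi (m + n) * x powi (m + n) * y powi (m - n)" for m n
    using q x y by (simp add: f_def lin power_int_add power_int_diff power_int_mult_distrib power_int_divide_distrib)
  have f_even: "f (i + j, i - j) = x\<^sup>2 * g0 (i, j)" for i j
  proof -
    have e1: "tri (i + j) + tri (i - j) = i * i - i + j * j"
      using tri_add[of i j] tri_add[of i "- j"] tri_minus[of j] two_tri[of i] two_tri[of j]
      by (simp add: algebra_simps)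
    have "g0 (i, j) = q powi ((i - 1) * (i - 1 - 1) + 2 * (i - 1) + (j * (j - 1) + j)) * x powi (2 * (i - 1)) * y powi (2 * j)"
      using sq[OF x, of 2 "i - 1"] sq[OF y, of 1 j] q by (simp add: g0_def power_int_add)
    also have "x powi (2 * (i - 1)) = x powi (2 * i) / x\<^sup>2"
      using x by (simp add: right_diff_distrib power_int_diff)
    also have "(i - 1) * (i - 1 - 1) + 2 * (i - 1) + (j * (j - 1) + j) = i * i - i + j * j"
      by (simp add: algebra_simps)
    finally have g: "x\<^sup>2 * g0 (i, j) = q powi (i * i - i + j * j) * x powi (2 * i) * y powi (2 * j)"
      using x by simp
    have "f (i + j, i - j) = q powi (i * i - i + j * j) * (- 1) powi (2 * i) * x powi (2 * i) * y powi (2 * j)"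
      by (simp only: f_eq e1) (simp add: algebra_simps)
    then show ?thesis by (simp add: g power_int_mult)
  qed
  have f_odd: "f (i + j + 1, i - j) = - (x * y) * g1 (i, j)" for i j
  proof -
    have e1: "tri (i + j + 1) + tri (i - j) = i * i + j * j + j"
      using tri_add[of "i + j" 1] tri_add[of i j] tri_add[of i "- j"] tri_minus[of j] two_tri[of i] two_tri[of j]
      by (simp add: algebra_simps)
    have "g1 (i, j) = q powi (i * (i - 1) + i + (j * (j - 1) + 2 * j)) * x powi (2 * i) * y powi (2 * j)"
      using sq[OF x, of 1 i] sq[OF y, of 2 j] q by (simp add: g1_def power_int_add)
    also have "i * (i - 1) + i + (j * (j - 1) + 2 * j) = i * i + j * j + j"
      by (simp add: algebra_simps)
    finally have g: "g1 (i, j) = q powi (i * i + j * j + j) * x powi (2 * i) * y powi (2 * j)" .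
    have "f (i + j + 1, i - j) = q powi (i * i + j * j + j) * (- 1) powi (2 * i + 1) * x powi (2 * i + 1) * y powi (2 * j + 1)"
      by (simp only: f_eq e1) (simp add: algebra_simps)
    then show ?thesis using x y by (simp add: g power_int_add power_int_mult)
  qed
  define E :: "(int \<times> int) set" where "E = {(m, n). even (m + n)}"
  have "((\<lambda>p. x\<^sup>2 * g0 p) has_sum x\<^sup>2 * (theta (- (q\<^sup>2 * x\<^sup>2)) (q\<^sup>2) * theta (- (q * y\<^sup>2)) (q\<^sup>2))) UNIV"
    by (rule has_sum_cmult_right[OF g0])
  also have "?this \<longleftrightarrow> (f has_sum x\<^sup>2 * (theta (- (q\<^sup>2 * x\<^sup>2)) (q\<^sup>2) * theta (- (q * y\<^sup>2)) (q\<^sup>2))) E"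
    by (rule has_sum_reindex_bij_witness[of _ "\<lambda>(m, n). ((m + n) div 2, (m - n) div 2)" "\<lambda>(i, j). (i + j, i - j)"])
      (auto simp: E_def f_even, presburger+)
  finally have even: "(f has_sum x\<^sup>2 * (theta (- (q\<^sup>2 * x\<^sup>2)) (q\<^sup>2) * theta (- (q * y\<^sup>2)) (q\<^sup>2))) E" .
  have "((\<lambda>p. - (x * y) * g1 p) has_sum - (x * y) * (theta (- (q * x\<^sup>2)) (q\<^sup>2) * theta (- (q\<^sup>2 * y\<^sup>2)) (q\<^sup>2))) UNIV"
    by (rule has_sum_cmult_right[OF g1])
  also have "?this \<longleftrightarrow> (f has_sum - (x * y) * (theta (- (q * x\<^sup>2)) (q\<^sup>2) * theta (- (q\<^sup>2 * y\<^sup>2)) (q\<^sup>2))) (- E)"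
    by (rule has_sum_reindex_bij_witness[of _ "\<lambda>(m, n). ((m + n - 1) div 2, (m - n - 1) div 2)" "\<lambda>(i, j). (i + j + 1, i - j)"])
      (auto simp: E_def f_odd, presburger+)
  finally have odd: "(f has_sum - (x * y) * (theta (- (q * x\<^sup>2)) (q\<^sup>2) * theta (- (q\<^sup>2 * y\<^sup>2)) (q\<^sup>2))) (- E)" .
  from has_sum_Un_disjoint[OF even odd] have
    "(f has_sum x\<^sup>2 * (theta (- (q\<^sup>2 * x\<^sup>2)) (q\<^sup>2) * theta (- (q * y\<^sup>2)) (q\<^sup>2))
       + - (x * y) * (theta (- (q * x\<^sup>2)) (q\<^sup>2) * theta (- (q\<^sup>2 * y\<^sup>2)) (q\<^sup>2))) UNIV"
    by simp
  from has_sum_unique[OF f this] show ?thesis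
    by (simp add: power2_eq_square algebra_simps)
qed

text \<open>The Pluecker relation between the minors of the four vectors (\<open>G0\<close>,
  \<open>G1\<close>) at \<open>a\<close>, \<open>b\<close>, \<open>c\<close>, \<open>d\<close>. Each
  product of thetas carries its first argument as a prefactor, \<open>a * c\<close> on the left and
  \<open>b * a\<close> on the right, whence \<open>c / b\<close>.\<close>

theorem theta_three_term:
  assumes q: "norm q < 1" "q \<noteq> 0" and nz: "a \<noteq> 0" "b \<noteq> 0" "c \<noteq> 0" "d \<noteq> 0"
  shows "theta (a * b) q * theta (a / b) q * (theta (c * d) q * theta (c / d) q)
       - theta (a * d) q * theta (a / d) q * (theta (c * b) q * theta (c / b) q)
       = c / b * (theta (b * d) q * theta (b / d) q * (theta (a * c) q * theta (a / c) q))"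
proof -
  define G0 where "G0 = (\<lambda>x. theta (- (q * x\<^sup>2)) (q\<^sup>2))"
  define G1 where "G1 = (\<lambda>x. x * theta (- (q\<^sup>2 * x\<^sup>2)) (q\<^sup>2))"
  have split: "theta (x * y) q * theta (x / y) q = x * (G1 x * G0 y - G0 x * G1 y)"
    if "x \<noteq> 0" "y \<noteq> 0" for x y
    using theta_mult_split[OF q that] by (simp add: G0_def G1_def)
  have "a * (G1 a * G0 b - G0 a * G1 b) * (c * (G1 c * G0 d - G0 c * G1 d))
      - a * (G1 a * G0 d - G0 a * G1 d) * (c * (G1 c * G0 b - G0 c * G1 b))
      = c * ((G1 b * G0 d - G0 b * G1 d) * (a * (G1 a * G0 c - G0 a * G1 c)))"
    by algebra
  also have "\<dots> = c / b * (b * (G1 b * G0 d - G0 b * G1 d) * (a * (G1 a * G0 c - G0 a * G1 c)))"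
    using nz by simp
  finally show ?thesis
    unfolding split[OF nz(1,2)] split[OF nz(3,4)] split[OF nz(1,4)] split[OF nz(3,2)] split[OF nz(2,4)] split[OF nz(1,3)] .
qed

section \<open>Modular equations for the continued fraction\<close>

lemma prod_lessThan_3: "prod f {..<3::nat} = f 0 * f 1 * f 2"
  by (simp add: eval_nat_numeral)

lemma prod_lessThan_5: "prod f {..<5::nat} = f 0 * f 1 * f 2 * f 3 * f 4"
  by (simp add: eval_nat_numeral)

lemma qpoch_power_multisection:
  assumes "norm q < 1" "m > 0" "n > 0"
  shows "qpoch_inf (q ^ a) (q ^ n) = (\<Prod>i<m. qpoch_inf (q ^ (a + n * i)) (q ^ (n * m)))"
proof -
  have "norm (q ^ n) < 1"
    using assms by (simp add: norm_power power_less_one_iff)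
  from qpoch_multisection[OF this assms(2), of "q ^ a"] show ?thesis
    by (simp add: power_add power_mult)
qed

lemma theta_power:
  assumes "q \<noteq> 0" "a \<le> b"
  shows "theta (q ^ a) (q ^ b) = qpoch_inf (q ^ a) (q ^ b) * qpoch_inf (q ^ (b - a)) (q ^ b) * qpoch_inf (q ^ b) (q ^ b)"
  using assms by (simp add: theta_def power_diff)

lemma qpoch_power_nonzero:
  assumes "norm q < 1" "0 < a" "0 < b"
  shows "qpoch_inf (q ^ a) (q ^ b) \<noteq> 0"
  using assms by (intro qpoch_nonzero') (simp_all add: norm_power power_less_one_iff)

lemma theta_power_nonzero:
  assumes "norm q < 1" "q \<noteq> 0" "0 < a" "a < b"
  shows "theta (q ^ a) (q ^ b) \<noteq> 0"
  using assms by (simp add: theta_power qpoch_power_nonzero)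

lemma theta_power_reflect:
  assumes "q \<noteq> 0" "a \<le> b"
  shows "theta (q ^ (b - a)) (q ^ b) = theta (q ^ a) (q ^ b)"
  using assms theta_q_div[of "q ^ a" "q ^ b"] by (simp add: power_diff)

text \<open>The ordering of the exponents keeps all differences within the natural numbers.\<close>

lemma theta_three_term_power:
  assumes q: "norm q < 1" "q \<noteq> 0" and n: "n > 0" and le: "d \<le> b" "b \<le> c" "c \<le> a"
  defines "t \<equiv> (\<lambda>a. theta (q ^ a) (q ^ n))"
  shows "t (a + b) * t (a - b) * (t (c + d) * t (c - d)) - t (a + d) * t (a - d) * (t (c + b) * t (c - b))
    = q ^ (c - b) * (t (b + d) * t (b - d) * (t (a + c) * t (a - c)))"
proof -
  have "norm (q ^ n) < 1" "q ^ n \<noteq> 0"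
    using q n by (auto simp: norm_power power_less_one_iff)
  from theta_three_term[OF this, of "q ^ a" "q ^ b" "q ^ c" "q ^ d"] show ?thesis
    using q le by (simp add: t_def power_diff power_add)
qed

lemma RR_eq_theta_quotient:
  assumes "norm q < 1" "q \<noteq> 0"
  shows "RR q = theta q (q ^ 5) / theta (q ^ 2) (q ^ 5)"
  using assms theta_power[of q 1 5] theta_power[of q 2 5] qpoch_power_nonzero[of q 5 5]
  by (simp add: RR_def)

lemma RR_0 [simp]: "RR 0 = 1"
  by (simp add: RR_def qpoch_inf_def)

text \<open>For u = q^(1/5) R(q) and v = q^(2/5) R(q^2) this is Ramanujan's (v - u^2) / (v + u^2) =
  u v^2. Both continued fractions are quotients of theta functions to the base q^10. The value
  \<open>t 5\<close> occurs in neither, but linearly in two instances of the three-term relation,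
  and is eliminated between them.\<close>

theorem RR_degree_2:
  assumes q: "norm q < 1" "q \<noteq> 0"
  shows "RR (q\<^sup>2) - RR q ^ 2 = q * RR q * RR (q\<^sup>2) ^ 2 * (RR (q\<^sup>2) + RR q ^ 2)"
proof -
  define t where "t = (\<lambda>a. theta (q ^ a) (q ^ 10))"
  have q2: "norm (q\<^sup>2) < 1" "q\<^sup>2 \<noteq> 0"
    using q by (auto simp: norm_power power_less_one_iff)
  have nz: "t 1 \<noteq> 0" "t 2 \<noteq> 0" "t 3 \<noteq> 0" "t 4 \<noteq> 0" "t 5 \<noteq> 0"
    using q theta_power_nonzero[of q 1 10] by (simp_all add: t_def theta_power_nonzero)
  have refl: "t 6 = t 4" "t 7 = t 3"
    using q theta_power_reflect[of q 4 10] theta_power_reflect[of q 3 10] by (simp_all add: t_def)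
  have S: "RR (q\<^sup>2) = t 2 / t 4"
    using RR_eq_theta_quotient[OF q2] by (simp add: t_def flip: power_mult)
  have R: "RR q = t 1 * t 4 / (t 2 * t 3)"
  proof -
    have "qpoch_inf (q ^ a) (q ^ 5) = qpoch_inf (q ^ a) (q ^ 10) * qpoch_inf (q ^ (a + 5)) (q ^ 10)" for a
      using qpoch_power_multisection[of q 2 5 a] q by (simp add: eval_nat_numeral)
    from this[of 1] this[of 2] this[of 3] this[of 4] show ?thesis
      using q qpoch_power_nonzero[of q 10 10] theta_power[of q 1 10]
      by (simp add: RR_def t_def theta_power mult_ac)
  qed
  have "t 6 * t 2 * (t 3 * t 3) - t 4 * t 4 * (t 5 * t 1) = q * (t 2 * t 2 * (t 7 * t 1))"
    using theta_three_term_power[OF q, of 10 0 2 3 4] by (simp add: t_def)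
  then have 1: "t 4 ^ 2 * t 1 * t 5 = t 2 * t 3 * (t 3 * t 4 - q * t 1 * t 2)"
    unfolding refl by algebra
  have "t 5 * t 3 * (t 2 * t 2) - t 4 * t 4 * (t 3 * t 1) = q * (t 1 * t 1 * (t 6 * t 2))"
    using theta_three_term_power[OF q, of 10 0 1 2 4] by (simp add: t_def)
  then have 2: "t 3 * t 2 ^ 2 * t 5 = t 1 * t 4 * (t 3 * t 4 + q * t 1 * t 2)"
    unfolding refl by algebra
  have "t 5 * (t 2 ^ 3 * t 3 ^ 2 * (t 3 * t 4 - q * t 1 * t 2) - t 1 ^ 2 * t 4 ^ 3 * (t 3 * t 4 + q * t 1 * t 2)) = 0"
    using 1 2 by algebra
  then have "t 2 ^ 3 * t 3 ^ 2 * (t 3 * t 4 - q * t 1 * t 2) = t 1 ^ 2 * t 4 ^ 3 * (t 3 * t 4 + q * t 1 * t 2)"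
    using nz by simp
  then show ?thesis
    unfolding R S using nz by (simp add: divide_simps) algebra
qed

text \<open>For \<open>n > 2\<close> the first root of unity has positive imaginary part and so
  differs from 1. The orders used are the primes 3 and 5, where this means primitive.\<close>

lemma primitive_root_of_unity_exists:
  assumes "n > 2"
  obtains z :: complex where "z ^ n = 1" "(\<Sum>i<n. z ^ i) = 0"
proof
  define z where "z = cis (2 * pi / real n)"
  show z: "z ^ n = 1"
    using assms by (simp add: z_def Complex.DeMoivre)
  have "sin (2 * pi / real n) > 0"
    using assms by (intro sin_gt_zero) (auto simp: field_simps)
  then have "z \<noteq> 1"
    by (auto simp: z_def complex_eq_iff)
  then show "(\<Sum>i<n. z ^ i) = 0"
    using z by (simp add: geometric_sum)
qed

text \<open>Each factor on the left comes from its own three-term relation: the second one from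
  exponents 6, 5, 3, 0 to the base q^15, the difference of cubes from a relation to the base q^5
  that has a cube root of unity among its arguments. The products of thetas cancel when the two are
  multiplied.\<close>

theorem RR_degree_3:
  assumes q: "norm q < 1" "q \<noteq> 0"
  shows "(RR (q ^ 3) - RR q ^ 3) * (1 + q\<^sup>2 * RR q * RR (q ^ 3) ^ 3) = 3 * q * RR q ^ 2 * RR (q ^ 3) ^ 2"
proof -
  define t where "t = (\<lambda>a. theta (q ^ a) (q ^ 15))"
  define s where "s = (\<lambda>z. theta z (q ^ 5))"
  define c5 where "c5 = qpoch_inf (q ^ 5) (q ^ 5)"
  define c15 where "c15 = qpoch_inf (q ^ 15) (q ^ 15)"
  obtain w :: complex where w: "w ^ 3 = 1" "(\<Sum>i<3. w ^ i) = 0"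
    using primitive_root_of_unity_exists[of 3] by auto
  have w2: "w\<^sup>2 = - 1 - w"
    using w(2) by (simp add: eval_nat_numeral algebra_simps add_eq_0_iff)
  have w0: "w \<noteq> 0"
    using w(1) by auto
  have w_inv: "1 / w = w\<^sup>2"
    using w(1) w0 by (simp add: field_simps eval_nat_numeral)
  have q5: "norm (q ^ 5) < 1" "q ^ 5 \<noteq> 0"
    and q3: "norm (q ^ 3) < 1" "q ^ 3 \<noteq> 0"
    using q by (auto simp: norm_power power_less_one_iff)
  have nz: "t 1 \<noteq> 0" "t 2 \<noteq> 0" "t 3 \<noteq> 0" "t 4 \<noteq> 0" "t 5 \<noteq> 0" "t 6 \<noteq> 0" "t 7 \<noteq> 0"
    using q theta_power_nonzero[of q 1 15] by (simp_all add: t_def theta_power_nonzero)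
  have cnz: "c5 \<noteq> 0" "c15 \<noteq> 0"
    using q by (simp_all add: c5_def c15_def qpoch_power_nonzero)
  have snz: "s q \<noteq> 0" "s (q\<^sup>2) \<noteq> 0"
    using q theta_power_nonzero[of q 1 5] by (simp_all add: s_def theta_power_nonzero)
  have refl: "t 8 = t 7" "t 9 = t 6" "t 11 = t 4"
    using q theta_power_reflect[of q 7 15] theta_power_reflect[of q 6 15] theta_power_reflect[of q 4 15]
    by (simp_all add: t_def)
  have split: "qpoch_inf (q ^ a) (q ^ 5) =
      qpoch_inf (q ^ a) (q ^ 15) * qpoch_inf (q ^ (a + 5)) (q ^ 15) * qpoch_inf (q ^ (a + 10)) (q ^ 15)" for a
    using qpoch_power_multisection[of q 3 5 a] q by (simp add: eval_nat_numeral)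
  have T: "RR (q ^ 3) = t 3 / t 6"
    using RR_eq_theta_quotient[OF q3] by (simp add: t_def flip: power_mult)
  have R: "RR q = s q / s (q\<^sup>2)"
    using RR_eq_theta_quotient[OF q] by (simp add: s_def)
  have cube_c15: "c15 ^ 3 = c15 * c15 * c15"
    by (rule power3_eq_cube)
  have s1: "s q = t 1 * t 4 * t 6 * c5 / c15 ^ 3"
    unfolding cube_c15 using split[of 1] split[of 4] cnz q theta_power[of q 1 5] theta_power[of q 1 15]
    by (simp add: s_def t_def theta_power c5_def c15_def mult_ac)
  have s2: "s (q\<^sup>2) = t 2 * t 3 * t 7 * c5 / c15 ^ 3"
    unfolding cube_c15 using split[of 2] split[of 3] cnz q theta_power[of q 2 5]
    by (simp add: s_def t_def theta_power c5_def c15_def mult_ac)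
  have t5: "t 5 = c5"
    using split[of 5] q by (simp add: t_def theta_power c5_def)
  have "t 9 * t 3 * (t 5 * t 5) - t 6 * t 6 * (t 8 * t 2) = q ^ 2 * (t 3 * t 3 * (t 11 * t 1))"
    using theta_three_term_power[OF q, of 15 0 3 5 6] by (simp add: t_def)
  then have "t 2 * t 7 * t 6 ^ 2 + q\<^sup>2 * t 1 * t 4 * t 3 ^ 2 = t 3 * t 6 * c5 ^ 2"
    unfolding refl t5 by algebra
  then have A: "(1 + q\<^sup>2 * RR q * RR (q ^ 3) ^ 3) * (t 2 * t 6 * t 7) = t 3 * c5 ^ 2"
    unfolding R T s1 s2 using nz cnz by (simp add: field_simps eval_nat_numeral)
  have roots: "(\<Prod>i<3. 1 - w ^ i * x) = 1 - x ^ 3" for x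
  proof -
    have "(\<Prod>i<3. 1 - w ^ i * x) = (1 - x) * (1 - w * x) * (1 - w\<^sup>2 * x)"
      by (simp add: eval_nat_numeral)
    then show ?thesis using w2 by algebra
  qed
  have cube: "qpoch_inf x (q ^ 5) * qpoch_inf (w * x) (q ^ 5) * qpoch_inf (w\<^sup>2 * x) (q ^ 5) = qpoch_inf (x ^ 3) (q ^ 15)" for x
    using qpoch_roots_of_unity[OF q5(1) _ roots, of x] by (simp add: prod_lessThan_3 flip: power_mult)
  \<comment> \<open>Multiplying over the cube roots of unity passes from the base
    \<open>q ^ 5\<close> to the base \<open>q ^ 15\<close>.\<close>
  have s_cube: "s x * s (x * w) * s (x / w) * c15 = c5 ^ 3 * theta (x ^ 3) (q ^ 15)" if x: "x \<noteq> 0" for x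
  proof -
    have e: "x / w = w\<^sup>2 * x" "q ^ 5 / (x * w) = w\<^sup>2 * (q ^ 5 / x)" "q ^ 5 / (x / w) = w * (q ^ 5 / x)"
      using w_inv w0 x by (simp_all add: field_simps)
    have "s x * s (x * w) * s (x / w) = c5 ^ 3 *
        ((qpoch_inf x (q ^ 5) * qpoch_inf (w * x) (q ^ 5) * qpoch_inf (w\<^sup>2 * x) (q ^ 5)) *
         (qpoch_inf (q ^ 5 / x) (q ^ 5) * qpoch_inf (w * (q ^ 5 / x)) (q ^ 5) * qpoch_inf (w\<^sup>2 * (q ^ 5 / x)) (q ^ 5)))"
      unfolding s_def theta_def c5_def[symmetric] unfolding e(2,3) unfolding e(1) by (simp add: mult_ac power3_eq_cube)
    then show ?thesis
      unfolding cube by (simp add: theta_def c15_def power_divide mult_ac flip: power_mult)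
  qed
  \<comment> \<open>Once \<open>1 - w\<close> is split off, the remaining products at
    \<open>q ^ 5\<close>, \<open>w * q ^ 5\<close>, \<open>w\<^sup>2 * q ^ 5\<close> are a full set
    of conjugates and collapse to \<open>c15\<close>.\<close>
  have sw: "s w = (1 - w) * c15"
  proof -
    have "qpoch_inf w (q ^ 5) = (1 - w) * qpoch_inf (w * q ^ 5) (q ^ 5)"
      by (rule qpoch_rec[OF q5(1)])
    moreover have "q ^ 5 / w = w\<^sup>2 * q ^ 5"
      unfolding w_inv[symmetric] by simp
    ultimately have "s w = (1 - w) * (c5 * qpoch_inf (w * q ^ 5) (q ^ 5) * qpoch_inf (w\<^sup>2 * q ^ 5) (q ^ 5))"
      by (simp add: s_def theta_def c5_def mult_ac)
    also have "c5 * qpoch_inf (w * q ^ 5) (q ^ 5) * qpoch_inf (w\<^sup>2 * q ^ 5) (q ^ 5) = c15"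
      using cube[of "q ^ 5"] by (simp add: c5_def c15_def flip: power_mult)
    finally show ?thesis .
  qed
  \<comment> \<open>The arguments \<open>q\<close>, \<open>w\<close>, \<open>q\<^sup>2\<close>,
    \<open>1\<close> are chosen so that multiplication by \<open>s q * s (q\<^sup>2)\<close>
    completes both terms on the left to products over all cube roots of unity. The coefficient 3 of
    the modular equation arises from the right side as \<open>- (1 - w)\<^sup>2 / w\<close>.\<close>
  have "s (q * w) * s (q / w) * (s (q\<^sup>2) * s (q\<^sup>2)) - s q * s q * (s (q\<^sup>2 * w) * s (q\<^sup>2 / w))
      = q\<^sup>2 / w * (s w * s w * (s (q ^ 3) * s (1 / q)))"
  proof -
    have "q * q\<^sup>2 = q ^ 3" "q / q\<^sup>2 = 1 / q"
      by (simp_all add: power2_eq_square power3_eq_cube)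
    then show ?thesis
      using theta_three_term[OF q5, of q w "q\<^sup>2" 1] q w0 by (simp add: s_def)
  qed
  also have "s (1 / q) = - s q / q"
    unfolding s_def using theta_inverse[OF q5 q(2)] .
  also have "s (q ^ 3) = s (q\<^sup>2)"
    using theta_power_reflect[of q 2 5] q by (simp add: s_def)
  also have "q\<^sup>2 / w * (s w * s w * (s (q\<^sup>2) * (- s q / q))) = - ((1 - w)\<^sup>2 * (1 / w)) * q * c15 ^ 2 * (s (q\<^sup>2) * s q)"
    unfolding sw using q w0 by (simp add: field_simps power2_eq_square)
  also have "- ((1 - w)\<^sup>2 * (1 / w)) = 3"
    unfolding w_inv using w(1) w2 by algebra
  finally have "s (q * w) * s (q / w) * (s (q\<^sup>2) * s (q\<^sup>2)) - s q * s q * (s (q\<^sup>2 * w) * s (q\<^sup>2 / w))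
      = 3 * q * c15 ^ 2 * (s (q\<^sup>2) * s q)" .
  moreover have "s q * s (q * w) * s (q / w) * c15 = c5 ^ 3 * t 3"
    using s_cube[OF q(2)] by (simp add: t_def)
  moreover have "s (q\<^sup>2) * s (q\<^sup>2 * w) * s (q\<^sup>2 / w) * c15 = c5 ^ 3 * t 6"
    using s_cube[of "q\<^sup>2"] q by (simp add: t_def flip: power_mult)
  ultimately have "c5 ^ 3 * (t 3 * s (q\<^sup>2) ^ 3 - t 6 * s q ^ 3) = 3 * q * c15 ^ 3 * (s (q\<^sup>2) * s q)\<^sup>2"
    by algebra
  then have B: "c5 ^ 3 * (RR (q ^ 3) - RR q ^ 3) * t 6 = 3 * q * RR q ^ 2 * c15 ^ 3 * s (q\<^sup>2)"
    unfolding R T using nz snz by (simp add: field_simps eval_nat_numeral)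
  have "c15 ^ 3 * s (q\<^sup>2) = t 2 * t 3 * t 7 * c5"
    unfolding s2 using cnz by simp
  with B have "c5 * ((RR (q ^ 3) - RR q ^ 3) * (c5 ^ 2 * t 6)) = c5 * (3 * q * RR q ^ 2 * (t 2 * t 3 * t 7))"
    by algebra
  then have "(RR (q ^ 3) - RR q ^ 3) * (c5 ^ 2 * t 6) = 3 * q * RR q ^ 2 * (t 2 * t 3 * t 7)"
    using cnz by simp
  then have D: "RR (q ^ 3) - RR q ^ 3 = 3 * q * RR q ^ 2 * (t 2 * t 3 * t 7) / (c5 ^ 2 * t 6)"
    using cnz nz by (simp add: nonzero_eq_divide_eq)
  have E: "1 + q\<^sup>2 * RR q * RR (q ^ 3) ^ 3 = t 3 * c5 ^ 2 / (t 2 * t 6 * t 7)"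
    using A nz by (simp add: nonzero_eq_divide_eq)
  show ?thesis
    unfolding D E unfolding T using nz cnz by (simp add: power2_eq_square)
qed

text \<open>The terms with n = 5 m + r sum to a theta function to the base q^25. By reflection the
  classes 0 and 1 share \<open>theta (q ^ 10) (q ^ 25)\<close> and the classes 2 and 4 share
  \<open>theta (q ^ 5) (q ^ 25)\<close>; the class 3 drops out because
  \<open>theta (q ^ 25) (q ^ 25)\<close> has a vanishing factor.\<close>

lemma theta_quintisection:
  assumes q: "norm q < 1" "q \<noteq> 0" and z: "z ^ 5 = 1"
  shows "theta z q = (1 - z) * theta (q ^ 10) (q ^ 25) + (z\<^sup>2 - z ^ 4) * (q * theta (q ^ 5) (q ^ 25))"
proof -
  have z0: "z \<noteq> 0"
    using z by auto
  have q25: "norm (q ^ 25) < 1" "q ^ 25 \<noteq> 0" and q5: "q ^ 5 \<noteq> 0"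
    using q by (auto simp: norm_power power_less_one_iff)
  define S where "S = (\<lambda>r. q powi tri (int r) * (- z) ^ r * theta (q ^ (10 + 5 * r)) (q ^ 25))"
  define A where "A = (\<lambda>r. range (\<lambda>m::int. 5 * m + int r))"
  have tm: "theta_term z q (5 * m + int r) = q powi tri (int r) * (- z) ^ r * theta_term (q ^ (10 + 5 * r)) (q ^ 25) m" for m r
  proof -
    have "2 * tri (5 * m) = 2 * (25 * tri m + 10 * m)"
      using two_tri[of "5 * m"] two_tri[of m] by (simp add: algebra_simps)
    then have e: "tri (5 * m + int r) = tri (int r) + (25 * tri m + int (10 + 5 * r) * m)"
      by (simp add: tri_add algebra_simps)
    have "(- z) powi (5 * m + int r) = ((- z) ^ 5) powi m * (- z) ^ r"
      using z0 by (simp add: power_int_add power_int_mult)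
    also have "(- z) ^ 5 = - 1"
      using z by simp
    finally have 1: "(- z) powi (5 * m + int r) = (- 1) powi m * (- z) ^ r" .
    have 2: "q powi tri (5 * m + int r) = q powi tri (int r) * ((q ^ 25) powi tri m * (q ^ (10 + 5 * r)) powi m)"
    proof -
      have "(q ^ k) powi n = q powi (int k * n)" for k n
        by (simp add: power_int_mult)
      from this[of 25 "tri m"] this[of "10 + 5 * r" m] show ?thesis
        unfolding e using q by (simp add: power_int_add del: of_nat_add of_nat_mult)
    qed
    have "- (q ^ (10 + 5 * r)) = (- 1) * q ^ (10 + 5 * r)"
      by simp
    then have 3: "theta_term (q ^ (10 + 5 * r)) (q ^ 25) m = (q ^ 25) powi tri m * ((- 1) powi m * (q ^ (10 + 5 * r)) powi m)"
      unfolding theta_term_def by (simp only: power_int_mult_distrib)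
    show ?thesis
      unfolding theta_term_def[of z q] 1 2 3 by (simp only: mult_ac)
  qed
  have "(theta_term z q has_sum S r) (A r)" for r
  proof -
    have "((\<lambda>m. theta_term z q (5 * m + int r)) has_sum S r) UNIV"
      unfolding tm S_def by (intro has_sum_cmult_right theta_has_sum q25) (use q in simp)
    then show ?thesis
      unfolding A_def by (subst has_sum_reindex) (auto simp: inj_def o_def)
  qed
  note S = this
  have A_iff: "n \<in> A r \<longleftrightarrow> n mod 5 = int r" if "r < 5" for n r
  proof
    assume "n mod 5 = int r"
    then have "n = 5 * (n div 5) + int r"
      using mult_div_mod_eq[of 5 n] by simp
    then show "n \<in> A r" unfolding A_def by (rule range_eqI)
  qed (use that in \<open>auto simp: A_def\<close>)
  have "(theta_term z q has_sum S 0 + S 1 + S 2 + S 3 + S 4) (A 0 \<union> A 1 \<union> A 2 \<union> A 3 \<union> A 4)"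
    by (intro has_sum_Un_disjoint S) (auto simp: A_iff)
  also have "A 0 \<union> A 1 \<union> A 2 \<union> A 3 \<union> A 4 = UNIV"
  proof -
    have "n mod 5 = 0 \<or> n mod 5 = 1 \<or> n mod 5 = 2 \<or> n mod 5 = 3 \<or> n mod 5 = 4" for n :: int
      by presburger
    then show ?thesis by (auto simp: A_iff)
  qed
  finally have "theta z q = S 0 + S 1 + S 2 + S 3 + S 4"
    using has_sum_unique[OF theta_has_sum[OF q z0]] by simp
  moreover have "theta (q ^ 15) (q ^ 25) = theta (q ^ 10) (q ^ 25)" "theta (q ^ 20) (q ^ 25) = theta (q ^ 5) (q ^ 25)"
    using q theta_power_reflect[of q 10 25] theta_power_reflect[of q 5 25] by simp_all
  moreover have "theta (q ^ 25) (q ^ 25) = 0"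
    using q q25 by (simp add: theta_def qpoch_zero)
  moreover have "theta (q ^ 30) (q ^ 25) = - theta (q ^ 5) (q ^ 25) / q ^ 5"
  proof -
    have "q ^ 25 / q ^ 30 = 1 / q ^ 5"
      using q by (simp add: divide_simps flip: power_add)
    then show ?thesis
      using theta_q_div[of "q ^ 30" "q ^ 25"] theta_inverse[OF q25 q5] q by simp
  qed
  moreover have "tri 2 = 1" "tri 4 = 6"
    by (simp_all add: tri_def)
  moreover have "q ^ 6 = q * q ^ 5"
    by (simp flip: power_Suc)
  ultimately show ?thesis
    using q by (simp add: S_def algebra_simps)
qed

lemma fifth_root_of_unity_product:
  fixes z :: complex
  assumes "1 + z + z ^ 2 + z ^ 3 + z ^ 4 = 0"
  shows "(\<Prod>i<5. 1 - z ^ i * x) = 1 - x ^ 5"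
  unfolding prod_lessThan_5 using assms by (simp del: power_Suc) algebra

lemma fifth_root_of_unity_exists:
  obtains z :: complex where "z ^ 5 = 1" "1 + z + z ^ 2 + z ^ 3 + z ^ 4 = 0"
proof -
  obtain z :: complex where z: "z ^ 5 = 1" "(\<Sum>i<5. z ^ i) = 0"
    using primitive_root_of_unity_exists[of 5] by auto
  have "(\<Sum>i<5. z ^ i) = 1 + z + z ^ 2 + z ^ 3 + z ^ 4"
    by (simp add: eval_nat_numeral)
  with z that show ?thesis by simp
qed

text \<open>Ramanujan's identity 1 / R(q^5) - q - q^2 R(q^5) = (q;q) / (q^25;q^25), with infinite
  products on the right. The quintisection is evaluated at a primitive fifth root of unity
  \<open>z\<close> and at \<open>z\<^sup>2\<close>; the two left sides multiply to
  \<open>c1 * c5\<close> because together they contain all conjugates of the Euler product.\<close>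

theorem RR_quintisection:
  assumes q: "norm q < 1" "q \<noteq> 0"
  shows "(1 - q * RR (q ^ 5) - (q * RR (q ^ 5))\<^sup>2) * qpoch_inf (q ^ 25) (q ^ 25) = RR (q ^ 5) * qpoch_inf q q"
proof -
  obtain z :: complex where z: "z ^ 5 = 1" "1 + z + z ^ 2 + z ^ 3 + z ^ 4 = 0"
    by (rule fifth_root_of_unity_exists)
  have z0: "z \<noteq> 0" and z1: "1 - z \<noteq> 0"
    using z by auto
  have z2: "1 - z\<^sup>2 \<noteq> 0"
  proof
    assume "1 - z\<^sup>2 = 0"
    then have "1 - z = 0" using z(1) by algebra
    with z1 show False by simp
  qed
  have q5: "norm (q ^ 5) < 1" "q ^ 5 \<noteq> 0"
    using q by (auto simp: norm_power power_less_one_iff)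
  define A where "A = theta (q ^ 10) (q ^ 25)"
  define B where "B = q * theta (q ^ 5) (q ^ 25)"
  define c1 where "c1 = qpoch_inf q q"
  define c5 where "c5 = qpoch_inf (q ^ 5) (q ^ 5)"
  define c25 where "c25 = qpoch_inf (q ^ 25) (q ^ 25)"
  define P where "P = (\<lambda>k. qpoch_inf (z ^ k * q) q)"
  have nz: "A \<noteq> 0" "B \<noteq> 0" "c5 \<noteq> 0"
    using q by (simp_all add: A_def B_def c5_def theta_power_nonzero qpoch_power_nonzero)
  have v: "q * RR (q ^ 5) = B / A"
    using RR_eq_theta_quotient[OF q5] by (simp add: A_def B_def flip: power_mult)
  have AB: "A * B = q * c5 * c25"
    using qpoch_power_multisection[of q 5 5 5] q
    by (simp add: prod_lessThan_5 A_def B_def c5_def c25_def theta_power mult_ac)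
  have "theta z q = (1 - z) * (P 1 * P 4 * c1)"
  proof -
    have "q / z = z ^ 4 * q"
      by (rule nonzero_divide_eq_eq[OF z0, THEN iffD2]) (use z(1) in algebra)
    then show ?thesis
      using qpoch_rec[OF q(1), of z] by (simp add: theta_def P_def c1_def)
  qed
  with theta_quintisection[OF q z(1)] have "(1 - z) * (P 1 * P 4 * c1) = (1 - z) * (A + (z\<^sup>2 + z ^ 3) * B)"
    unfolding A_def[symmetric] B_def[symmetric] by algebra
  then have 1: "P 1 * P 4 * c1 = A + (z\<^sup>2 + z ^ 3) * B"
    using z1 by simp
  have "theta (z\<^sup>2) q = (1 - z\<^sup>2) * (P 2 * P 3 * c1)"
  proof -
    have "z\<^sup>2 \<noteq> 0"
      using z0 by simp
    then have "q / z\<^sup>2 = z ^ 3 * q"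
      by (rule nonzero_divide_eq_eq[THEN iffD2]) (use z(1) in algebra)
    then show ?thesis
      using qpoch_rec[OF q(1), of "z\<^sup>2"] by (simp add: theta_def P_def c1_def)
  qed
  moreover have "(z\<^sup>2) ^ 5 = 1"
    using z(1) by algebra
  ultimately have "(1 - z\<^sup>2) * (P 2 * P 3 * c1) = (1 - z\<^sup>2) * (A + (z ^ 4 + z) * B)"
    using theta_quintisection[OF q, of "z\<^sup>2"] z(1) unfolding A_def[symmetric] B_def[symmetric] by algebra
  then have 2: "P 2 * P 3 * c1 = A + (z ^ 4 + z) * B"
    using z2 by simp
  have 3: "c1 * P 1 * P 2 * P 3 * P 4 = c5"
    using qpoch_roots_of_unity[OF q(1) _ fifth_root_of_unity_product[OF z(2)], of q]
    by (simp add: prod_lessThan_5 P_def c1_def c5_def)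
  have "c1 * c5 = (A + (z\<^sup>2 + z ^ 3) * B) * (A + (z ^ 4 + z) * B)"
    unfolding 1[symmetric] 2[symmetric] 3[symmetric] by algebra
  \<comment> \<open>The periods \<open>z\<^sup>2 + z ^ 3\<close> and \<open>z ^ 4 + z\<close> have
    sum and product \<open>- 1\<close>.\<close>
  also have "\<dots> = A\<^sup>2 - A * B - B\<^sup>2"
    using z by algebra
  finally have c: "A\<^sup>2 - A * B - B\<^sup>2 = c1 * c5" ..
  have "q * A\<^sup>2 * ((1 - B / A - (B / A)\<^sup>2) * c25) = q * c25 * (A\<^sup>2 - A * B - B\<^sup>2)"
    using nz by (simp add: field_simps power2_eq_square)
  also have "\<dots> = (A * B) * c1"
    unfolding c unfolding AB by (simp only: mult_ac)
  also have "\<dots> = A\<^sup>2 * (q * RR (q ^ 5)) * c1"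
    unfolding v using nz by (simp add: power2_eq_square)
  finally have "q * A\<^sup>2 * ((1 - B / A - (B / A)\<^sup>2) * c25) = q * A\<^sup>2 * (RR (q ^ 5) * c1)"
    by (simp only: mult_ac)
  then show ?thesis
    using nz q unfolding v c25_def[symmetric] c1_def[symmetric] by simp
qed

text \<open>The norm of the quintisection: it is multiplied over the five fifth roots
  \<open>z ^ i * q\<close> of \<open>w\<close>, which leave \<open>RR w\<close> and the product
  \<open>C\<close> unchanged.\<close>

theorem RR_fifth_power_eta_quotient:
  assumes w: "norm w < 1" "w \<noteq> 0"
  shows "(1 - 11 * w * RR w ^ 5 - w\<^sup>2 * RR w ^ 10) * qpoch_inf (w ^ 5) (w ^ 5) ^ 6 = RR w ^ 5 * qpoch_inf w w ^ 6"
proof -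
  obtain z :: complex where z: "z ^ 5 = 1" "1 + z + z ^ 2 + z ^ 3 + z ^ 4 = 0"
    by (rule fifth_root_of_unity_exists)
  define q where "q = exp (Ln w / 5)"
  have q_pow: "q ^ 5 = w"
    using w by (simp add: q_def flip: exp_of_nat_mult)
  have q: "norm q < 1" "q \<noteq> 0"
  proof -
    show "norm q < 1"
    proof (rule ccontr)
      assume "\<not> norm q < 1"
      then have "1 \<le> norm (q ^ 5)" by (simp add: norm_power)
      with w q_pow show False by simp
    qed
  qed (simp add: q_def)
  define R where "R = RR w"
  define C where "C = qpoch_inf (w ^ 5) (w ^ 5)"
  define c where "c = qpoch_inf w w"
  define Q where "Q = (\<lambda>k. qpoch_inf (w ^ k) (w ^ 5))"
  have z_norm: "norm z = 1"
    using z(1) by (metis norm_one norm_power power_eq_1_iff norm_ge_zero power_eq_imp_eq_base one_neq_zero zero_less_numeral power_one zero_le_one)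
  have zq: "norm (z ^ i * q) < 1" "z ^ i * q \<noteq> 0" "(z ^ i * q) ^ 5 = w" for i
    using q z z_norm q_pow by (auto simp: norm_mult norm_power power_mult_distrib) (metis mult.commute power_mult power_one)
  have "qpoch_inf (z ^ i * q) (z ^ i * q) = (\<Prod>j<5. qpoch_inf ((z ^ Suc j) ^ i * q ^ Suc j) w)" for i
    using qpoch_multisection[OF zq(1)[of i], of 5 "z ^ i * q"] unfolding zq(3)
    by (simp add: power_mult_distrib power_add mult_ac flip: power_mult)
  then have "(\<Prod>i<5. qpoch_inf (z ^ i * q) (z ^ i * q)) = (\<Prod>i<5. \<Prod>j<5. qpoch_inf ((z ^ Suc j) ^ i * q ^ Suc j) w)"
    by simp
  \<comment> \<open>Each Euler product has been split modulo 5. With the order exchanged, the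
    exponents prime to 5 run through full sets of conjugates and give \<open>Q k\<close>, while the
    exponent 5 is fixed by the conjugation and gives \<open>c ^ 5\<close>.\<close>
  also have "\<dots> = (\<Prod>j<5. \<Prod>i<5. qpoch_inf ((z ^ Suc j) ^ i * q ^ Suc j) w)"
    by (rule prod.swap)
  also have "\<dots> = Q 1 * Q 2 * Q 3 * Q 4 * c ^ 5"
  proof -
    have Q: "(\<Prod>i<5. qpoch_inf ((z ^ k) ^ i * q ^ k) w) = Q k" if "1 + z ^ k + (z ^ k) ^ 2 + (z ^ k) ^ 3 + (z ^ k) ^ 4 = 0" for k
      using qpoch_roots_of_unity[OF w(1) _ fifth_root_of_unity_product[OF that], of "q ^ k"]
      by (simp add: Q_def q_pow[symmetric] mult.commute flip: power_mult)
    have "1 + z ^ 1 + (z ^ 1) ^ 2 + (z ^ 1) ^ 3 + (z ^ 1) ^ 4 = 0"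
      "1 + z ^ 2 + (z ^ 2) ^ 2 + (z ^ 2) ^ 3 + (z ^ 2) ^ 4 = 0"
      "1 + z ^ 3 + (z ^ 3) ^ 2 + (z ^ 3) ^ 3 + (z ^ 3) ^ 4 = 0"
      "1 + z ^ 4 + (z ^ 4) ^ 2 + (z ^ 4) ^ 3 + (z ^ 4) ^ 4 = 0"
      using z by algebra+
    note H = this[THEN Q]
    define H where "H = (\<lambda>k. \<Prod>i<5. qpoch_inf ((z ^ k) ^ i * q ^ k) w)"
    have "(\<Prod>j<5. H (Suc j)) = H 1 * H 2 * H 3 * H 4 * H 5"
      by (simp add: eval_nat_numeral)
    moreover have "H 5 = c ^ 5"
      using z q_pow by (simp add: H_def c_def)
    moreover have "H 1 = Q 1" "H 2 = Q 2" "H 3 = Q 3" "H 4 = Q 4"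
      unfolding H_def by (rule H)+
    ultimately show ?thesis
      by (simp add: H_def)
  qed
  finally have "C * (\<Prod>i<5. qpoch_inf (z ^ i * q) (z ^ i * q)) = (Q 1 * Q 2 * Q 3 * Q 4 * C) * c ^ 5"
    by simp
  also have "Q 1 * Q 2 * Q 3 * Q 4 * C = c"
    using qpoch_multisection[OF w(1), of 5 w]
    by (simp add: prod_lessThan_5 Q_def C_def c_def flip: power_Suc numeral_2_eq_2)
  finally have prod: "C * (\<Prod>i<5. qpoch_inf (z ^ i * q) (z ^ i * q)) = c ^ 6"
    by (simp flip: power_Suc)
  define v where "v = q * R"
  have "(1 - z ^ i * v - (z ^ i * v)\<^sup>2) * C = R * qpoch_inf (z ^ i * q) (z ^ i * q)" for i
  proof -
    have "(z ^ i * q) ^ 25 = w ^ 5"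
      unfolding zq(3)[of i, symmetric] by (simp flip: power_mult)
    then show ?thesis
      using RR_quintisection[OF zq(1,2), of i] unfolding zq(3) by (simp add: R_def C_def v_def mult_ac)
  qed
  then have "(\<Prod>i<5. (1 - z ^ i * v - (z ^ i * v)\<^sup>2) * C) = (\<Prod>i<5. R * qpoch_inf (z ^ i * q) (z ^ i * q))"
    by simp
  then have "(\<Prod>i<5. 1 - z ^ i * v - (z ^ i * v)\<^sup>2) * C ^ 5 = R ^ 5 * (\<Prod>i<5. qpoch_inf (z ^ i * q) (z ^ i * q))"
    by (simp add: prod.distrib)
  then have "(\<Prod>i<5. 1 - z ^ i * v - (z ^ i * v)\<^sup>2) * C ^ 6 = R ^ 5 * (C * (\<Prod>i<5. qpoch_inf (z ^ i * q) (z ^ i * q)))"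
    by algebra
  also have "(\<Prod>i<5. 1 - z ^ i * v - (z ^ i * v)\<^sup>2) = 1 - 11 * v ^ 5 - v ^ 10"
  proof -
    \<comment> \<open>The golden ratio, whose inverse and conjugate factor
      \<open>1 - x - x\<^sup>2\<close>. The coefficient 11 is \<open>a ^ 5 + (1 - a) ^ 5\<close>,
      and the last sign comes from \<open>a * (1 - a) = - 1\<close>.\<close>
    define a :: complex where "a = of_real ((1 + sqrt 5) / 2)"
    have "((1 + sqrt 5) / 2)\<^sup>2 = (1 + sqrt 5) / 2 + 1"
      by (simp add: power2_eq_square field_simps)
    then have a: "a\<^sup>2 = a + 1"
      unfolding a_def by (metis of_real_1 of_real_add of_real_power)
    have "1 - x - x\<^sup>2 = (1 - a * x) * (1 - (1 - a) * x)" for x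
      using a by algebra
    then have "(\<Prod>i<5. 1 - z ^ i * v - (z ^ i * v)\<^sup>2) = (\<Prod>i<5. (1 - z ^ i * (a * v)) * (1 - z ^ i * ((1 - a) * v)))"
      by (simp add: mult_ac)
    also have "\<dots> = (1 - (a * v) ^ 5) * (1 - ((1 - a) * v) ^ 5)"
      unfolding prod.distrib fifth_root_of_unity_product[OF z(2)] ..
    also have "\<dots> = 1 - 11 * v ^ 5 - v ^ 10"
      using a by algebra
    finally show ?thesis .
  qed
  finally have "(1 - 11 * v ^ 5 - v ^ 10) * C ^ 6 = R ^ 5 * c ^ 6"
    unfolding prod .
  moreover have v5: "v ^ 5 = w * R ^ 5"
    by (simp add: v_def power_mult_distrib q_pow)
  moreover have "v ^ 10 = w\<^sup>2 * R ^ 10"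
    using v5 by algebra
  ultimately show ?thesis
    by (simp add: R_def C_def c_def mult.assoc)
qed

section \<open>Sections of integer power series\<close>

definition dil :: "nat \<Rightarrow> int fps \<Rightarrow> int fps" where
  "dil m f = f oo fps_X ^ m"

lemma dil_nth: "m > 0 \<Longrightarrow> fps_nth (dil m f) n = (if m dvd n then fps_nth f (n div m) else 0)"
  by (simp add: dil_def fps_nth_compose_X_power)

lemma dil_nth_mult [simp]: "m > 0 \<Longrightarrow> fps_nth (dil m f) (m * n) = fps_nth f n"
  by (simp add: dil_nth)

lemma dil_nth_0 [simp]: "fps_nth (dil m f) 0 = fps_nth f 0"
  by (simp add: dil_def)

lemma dil_simps [simp]:
  assumes "m > 0"
  shows "dil m (f + g) = dil m f + dil m g" "dil m (f - g) = dil m f - dil m g" "dil m (- f) = - dil m f"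
    "dil m (f * g) = dil m f * dil m g" "dil m (f ^ k) = dil m f ^ k"
    "dil m 1 = 1" "dil m (numeral j) = numeral j" "dil m fps_X = fps_X ^ m"
  using assms
  by (simp_all add: dil_def fps_compose_add_distrib fps_compose_sub_distrib fps_compose_uminus
      fps_compose_mult_distrib fps_compose_power)

lemma dil_dil: "m > 0 \<Longrightarrow> n > 0 \<Longrightarrow> dil m (dil n f) = dil (m * n) f"
proof (rule fps_ext)
  fix i assume m: "m > 0" and n: "n > 0"
  show "fps_nth (dil m (dil n f)) i = fps_nth (dil (m * n) f) i"
  proof (cases "m dvd i")
    case True
    then obtain j where "i = m * j" by auto
    then show ?thesis using m n by (simp add: dil_nth)
  next
    case False
    then have "\<not> m * n dvd i" by (meson dvd_mult_left)
    with False m n show ?thesis by (simp add: dil_nth)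
  qed
qed

lemma numeral_dvd_fps_iff: "(numeral k :: int fps) dvd f \<longleftrightarrow> (\<forall>n. numeral k dvd fps_nth f n)"
proof
  assume "\<forall>n. numeral k dvd fps_nth f n"
  then have "f = numeral k * Abs_fps (\<lambda>n. fps_nth f n div numeral k)"
    by (simp add: fps_eq_iff)
  then show "numeral k dvd f" by (rule dvdI)
qed (auto simp: fps_eq_iff elim!: dvdE)

lemma dvd_dil_iff [simp]: "m > 0 \<Longrightarrow> (numeral k :: int fps) dvd dil m f \<longleftrightarrow> numeral k dvd f"
  unfolding numeral_dvd_fps_iff by (metis dil_nth dil_nth_mult dvd_0_right)

lemma dvd_unit_mult_cancel:
  fixes u v :: "int fps"
  assumes "d dvd u * f" "u * v = 1"
  shows "d dvd f"
proof -
  have "f = v * (u * f)"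
    using assms(2) by (metis mult.assoc mult.commute mult_1)
  with assms(1) show ?thesis by (metis dvd_mult)
qed

lemma dvd_X_power_mult_cancel:
  assumes "(numeral k :: int fps) dvd fps_X ^ m * f"
  shows "numeral k dvd f"
  unfolding numeral_dvd_fps_iff
proof
  fix n
  have "numeral k dvd fps_nth (fps_X ^ m * f) (n + m)"
    using assms unfolding numeral_dvd_fps_iff by blast
  then show "numeral k dvd fps_nth f n"
    by (simp add: fps_X_power_mult_nth)
qed

text \<open>With f = a + X g, additivity reduces \<open>f ^ p\<close> to \<open>a ^ p\<close> plus
  \<open>X ^ p\<close> times \<open>g ^ p\<close>, so that the coefficient at \<open>n\<close> of
  the claim for \<open>f\<close> is the one at \<open>n - p\<close> of the claim for
  \<open>g\<close>; the constant term is Fermat's theorem. The modulus and the exponent are tied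
  together by the hypotheses alone.\<close>

lemma frobenius_fps:
  fixes f :: "int fps"
  assumes p: "p > 0"
    and additive: "\<And>x y :: int fps. numeral k dvd (x + y) ^ p - x ^ p - y ^ p"
    and fermat: "\<And>a :: int. numeral k dvd a ^ p - a"
  shows "numeral k dvd f ^ p - dil p f"
  unfolding numeral_dvd_fps_iff
proof
  fix n
  show "numeral k dvd fps_nth (f ^ p - dil p f) n"
  proof (induction n arbitrary: f rule: less_induct)
    case (less n)
    define a where "a = fps_nth f 0"
    define g where "g = fps_shift 1 f"
    have f: "f = fps_const a + fps_X * g"
      by (auto simp: fps_eq_iff a_def g_def)
    have "numeral k dvd f ^ p - fps_const a ^ p - (fps_X * g) ^ p"
      unfolding f by (rule additive)
    then have 1: "numeral k dvd fps_nth (f ^ p - fps_const a ^ p - (fps_X * g) ^ p) n"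
      unfolding numeral_dvd_fps_iff by blast
    have pow: "fps_const a ^ p = fps_const (a ^ p)" "(fps_X * g) ^ p = fps_X ^ p * g ^ p"
      by (simp_all add: power_mult_distrib fps_const_power)
    have "numeral k dvd fps_nth (fps_const (a ^ p) + fps_X ^ p * g ^ p - dil p f) n"
    proof (cases "n = 0")
      case True
      then show ?thesis
        using fermat[of a] p by (simp add: a_def fps_X_power_mult_nth)
    next
      case n0: False
      show ?thesis
      proof (cases "n < p")
        case True
        then have "\<not> p dvd n"
          using n0 by (auto dest: dvd_imp_le)
        then show ?thesis
          using n0 p True by (simp add: dil_nth fps_X_power_mult_nth)
      next
        case False
        have "fps_nth (dil p f) n = fps_nth (dil p g) (n - p)"
        proof (cases "p dvd n")
          case True
          then obtain j where j: "n = p * j" by auto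
          with n0 obtain i where i: "j = Suc i"
            by (cases j) auto
          have "n - p = p * i"
            by (simp add: j i)
          then show ?thesis
            using p by (simp add: j i g_def del: mult_Suc_right)
        next
          case np: False
          then have "\<not> p dvd n - p"
            using dvd_diffD[of p n p] False by auto
          with np p show ?thesis by (simp add: dil_nth)
        qed
        then show ?thesis
          using less[of "n - p" g] n0 p False by (simp add: fps_X_power_mult_nth)
      qed
    qed
    then have "numeral k dvd fps_nth (f ^ p - fps_const a ^ p - (fps_X * g) ^ p) n
        + fps_nth (fps_const (a ^ p) + fps_X ^ p * g ^ p - dil p f) n"
      using 1 by (rule dvd_add[rotated])
    then show ?case by (simp add: pow)
  qed
qed

lemma frobenius_2: "2 dvd f ^ 2 - dil 2 f"
proof (rule frobenius_fps)
  show "2 dvd (x + y) ^ 2 - x ^ 2 - y ^ 2" for x y :: "int fps"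
    by (rule dvdI[of _ _ "x * y"]) algebra
  show "2 dvd a ^ 2 - a" for a :: int
    by simp
qed simp

lemma frobenius_3: "3 dvd f ^ 3 - dil 3 f"
proof (rule frobenius_fps)
  show "3 dvd (x + y) ^ 3 - x ^ 3 - y ^ 3" for x y :: "int fps"
    by (rule dvdI[of _ _ "x\<^sup>2 * y + x * y\<^sup>2"]) algebra
  show "3 dvd a ^ 3 - a" for a :: int
  proof -
    define b where "b = a div 3"
    have "a = 3 * b \<or> a = 3 * b + 1 \<or> a = 3 * b + 2"
      unfolding b_def by presburger
    then consider "a = 3 * b" | "a = 3 * b + 1" | "a = 3 * b + 2"
      by blast
    then show ?thesis
    proof cases
      case 1
      then show ?thesis by (intro dvdI[of _ _ "9 * b ^ 3 - b"]) algebra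
    next
      case 2
      then show ?thesis by (intro dvdI[of _ _ "9 * b ^ 3 + 9 * b\<^sup>2 + 2 * b"]) algebra
    next
      case 3
      then show ?thesis by (intro dvdI[of _ _ "9 * b ^ 3 + 18 * b\<^sup>2 + 11 * b + 2"]) algebra
    qed
  qed
qed simp

section \<open>Sections by residue classes of the exponent\<close>

definition res :: "nat \<Rightarrow> nat \<Rightarrow> int fps \<Rightarrow> bool" where
  "res m r f \<longleftrightarrow> (\<forall>n. n mod m \<noteq> r \<longrightarrow> fps_nth f n = 0)"

text \<open>The exponents are kept in place instead of being renumbered. The sections therefore add
  up to the series and are linear over the series in q^m, see \<open>sect_mult_res\<close>.\<close>

definition sect :: "nat \<Rightarrow> nat \<Rightarrow> int fps \<Rightarrow> int fps" where
  "sect m r f = Abs_fps (\<lambda>n. if n mod m = r then fps_nth f n else 0)"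

lemma sect_nth [simp]: "fps_nth (sect m r f) n = (if n mod m = r then fps_nth f n else 0)"
  by (simp add: sect_def)

lemma res_sect [simp]: "res m r (sect m r f)"
  by (simp add: res_def)

lemma sect_add [simp]: "sect m r (f + g) = sect m r f + sect m r g"
  by (simp add: fps_eq_iff)

lemma sect_diff [simp]: "sect m r (f - g) = sect m r f - sect m r g"
  by (simp add: fps_eq_iff)

lemma sect_0 [simp]: "sect m r 0 = 0"
  by (simp add: fps_eq_iff)

lemma sect_res: "res m r f \<Longrightarrow> sect m r f = f"
  by (auto simp: fps_eq_iff res_def)

lemma sect_res_other: "res m r f \<Longrightarrow> r \<noteq> r' \<Longrightarrow> sect m r' f = 0"
  by (auto simp: fps_eq_iff res_def)

lemma dvd_sect: "(numeral k :: int fps) dvd f \<Longrightarrow> numeral k dvd sect m r f"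
  by (simp add: numeral_dvd_fps_iff)

lemma sect_sect: "sect m r (sect m r' f) = (if r = r' then sect m r f else 0)"
  by (auto simp: fps_eq_iff)

lemma sect_2_decomp: "f = sect 2 0 f + sect 2 1 f"
  by (auto simp: fps_eq_iff)

lemma sect_3_decomp: "f = sect 3 0 f + sect 3 1 f + sect 3 2 f"
proof -
  have "n mod 3 = 0 \<or> n mod 3 = 1 \<or> n mod 3 = 2" for n :: nat
    by presburger
  then show ?thesis by (auto simp: fps_eq_iff)
qed

lemma res_mult:
  assumes "res m a f" "res m b g" "(a + b) mod m = c"
  shows "res m c (f * g)"
  unfolding res_def
proof (intro allI impI)
  fix n assume n: "n mod m \<noteq> c"
  have "fps_nth f i * fps_nth g (n - i) = 0" if "i \<le> n" for i
  proof (rule ccontr)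
    assume "\<not> ?thesis"
    then have "i mod m = a" "(n - i) mod m = b"
      using assms(1,2) by (auto simp: res_def)
    then have "n mod m = (a + b) mod m"
      using that by (metis le_add_diff_inverse mod_add_eq)
    with n assms(3) show False by simp
  qed
  then show "fps_nth (f * g) n = 0"
    unfolding fps_mult_nth by (intro sum.neutral ballI) auto
qed

lemma res_power:
  assumes "res m a f" "m > 1"
  shows "res m ((k * a) mod m) (f ^ k)"
proof (induction k)
  case 0
  then show ?case using assms(2) by (auto simp: res_def)
next
  case (Suc k)
  have "res m ((Suc k * a) mod m) (f * f ^ k)"
    by (rule res_mult[OF assms(1) Suc]) (simp add: mod_add_right_eq)
  then show ?case by simp
qed

lemma res_add: "res m r f \<Longrightarrow> res m r g \<Longrightarrow> res m r (f + g)"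
  and res_diff: "res m r f \<Longrightarrow> res m r g \<Longrightarrow> res m r (f - g)"
  by (simp_all add: res_def)

lemma res_numeral: "res m 0 (numeral k)" "res m 0 1"
  by (auto simp: res_def fps_numeral_nth)

lemma res0_intros:
  "res m 0 f \<Longrightarrow> res m 0 g \<Longrightarrow> res m 0 (f + g)" "res m 0 f \<Longrightarrow> res m 0 g \<Longrightarrow> res m 0 (f - g)"
  "res m 0 f \<Longrightarrow> res m 0 g \<Longrightarrow> res m 0 (f * g)" "res m 0 f \<Longrightarrow> res m 0 (- f)"
  "res m 0 (numeral k)" "res m 0 1"
  by (simp_all add: res_add res_diff res_numeral res_mult[where a = 0 and b = 0]) (simp add: res_def)

lemma res0_power: "res m 0 f \<Longrightarrow> res m 0 (f ^ k)"
  by (induction k) (simp_all add: res0_intros)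

lemma res_dil: "m dvd n \<Longrightarrow> n > 0 \<Longrightarrow> res m 0 (dil n f)"
  by (metis dil_nth dvd_imp_mod_0 dvd_trans res_def)

lemma sect_mult_res:
  assumes "res m 0 f"
  shows "sect m r (f * g) = f * sect m r g"
proof (rule fps_ext)
  fix n
  have z: "fps_nth f i * fps_nth g (n - i) = 0 \<or> n mod m = (n - i) mod m" if "i \<le> n" for i
  proof (cases "i mod m = 0")
    case True
    then obtain j where "i = m * j" by auto
    then have "n = (n - i) + m * j" using that by simp
    then have "n mod m = (n - i) mod m"
      by (metis mod_mult_self2)
    then show ?thesis by simp
  next
    case False
    then show ?thesis using assms by (auto simp: res_def)
  qed
  have "fps_nth f i * (if (n - i) mod m = r then fps_nth g (n - i) else 0) =
      (if n mod m = r then fps_nth f i * fps_nth g (n - i) else 0)" if "i \<le> n" for i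
    using z[OF that] by auto
  then have "(\<Sum>i=0..n. fps_nth f i * (if (n - i) mod m = r then fps_nth g (n - i) else 0)) =
      (\<Sum>i=0..n. if n mod m = r then fps_nth f i * fps_nth g (n - i) else 0)"
    by (intro sum.cong refl) simp
  then show "fps_nth (sect m r (f * g)) n = fps_nth (f * sect m r g) n"
    by (simp add: fps_mult_nth)
qed

lemma sect_2_mult:
  "sect 2 0 (f * g) = sect 2 0 f * sect 2 0 g + sect 2 1 f * sect 2 1 g"
  "sect 2 1 (f * g) = sect 2 0 f * sect 2 1 g + sect 2 1 f * sect 2 0 g"
proof -
  define f0 f1 g0 g1 where defs: "f0 = sect 2 0 f" "f1 = sect 2 1 f" "g0 = sect 2 0 g" "g1 = sect 2 1 g"
  have res: "res 2 0 f0" "res 2 1 f1" "res 2 0 g0" "res 2 1 g1"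
    by (simp_all add: defs)
  define h0 where "h0 = f0 * g0 + f1 * g1"
  define h1 where "h1 = f0 * g1 + f1 * g0"
  have 0: "res 2 0 h0"
    unfolding h0_def by (intro res_add res_mult[OF res(1,3)] res_mult[OF res(2,4)]) simp_all
  have 1: "res 2 1 h1"
    unfolding h1_def by (intro res_add res_mult[OF res(1,4)] res_mult[OF res(2,3)]) simp_all
  have "f * g = (f0 + f1) * (g0 + g1)"
    unfolding defs by (simp only: sect_2_decomp[symmetric])
  also have "\<dots> = h0 + h1"
    unfolding h0_def h1_def by (simp add: algebra_simps)
  finally have fg: "f * g = h0 + h1" .
  have "sect 2 0 (f * g) = h0" "sect 2 1 (f * g) = h1"
    unfolding fg using sect_res[OF 0] sect_res[OF 1] sect_res_other[OF 0] sect_res_other[OF 1] by simp_all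
  then show "sect 2 0 (f * g) = sect 2 0 f * sect 2 0 g + sect 2 1 f * sect 2 1 g"
    "sect 2 1 (f * g) = sect 2 0 f * sect 2 1 g + sect 2 1 f * sect 2 0 g"
    by (simp_all add: h0_def h1_def defs)
qed

lemma sect_3_mult:
  "sect 3 0 (f * g) = sect 3 0 f * sect 3 0 g + sect 3 1 f * sect 3 2 g + sect 3 2 f * sect 3 1 g"
  "sect 3 1 (f * g) = sect 3 0 f * sect 3 1 g + sect 3 1 f * sect 3 0 g + sect 3 2 f * sect 3 2 g"
  "sect 3 2 (f * g) = sect 3 0 f * sect 3 2 g + sect 3 1 f * sect 3 1 g + sect 3 2 f * sect 3 0 g"
proof -
  define f0 f1 f2 g0 g1 g2 where defs: "f0 = sect 3 0 f" "f1 = sect 3 1 f" "f2 = sect 3 2 f"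
    "g0 = sect 3 0 g" "g1 = sect 3 1 g" "g2 = sect 3 2 g"
  have res: "res 3 0 f0" "res 3 1 f1" "res 3 2 f2" "res 3 0 g0" "res 3 1 g1" "res 3 2 g2"
    by (simp_all add: defs)
  define h0 where "h0 = f0 * g0 + f1 * g2 + f2 * g1"
  define h1 where "h1 = f0 * g1 + f1 * g0 + f2 * g2"
  define h2 where "h2 = f0 * g2 + f1 * g1 + f2 * g0"
  have 0: "res 3 0 h0"
    unfolding h0_def by (intro res_add res_mult[OF res(1,4)] res_mult[OF res(2,6)] res_mult[OF res(3,5)]) simp_all
  have 1: "res 3 1 h1"
    unfolding h1_def by (intro res_add res_mult[OF res(1,5)] res_mult[OF res(2,4)] res_mult[OF res(3,6)]) simp_all
  have 2: "res 3 2 h2"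
    unfolding h2_def by (intro res_add res_mult[OF res(1,6)] res_mult[OF res(2,5)] res_mult[OF res(3,4)]) simp_all
  have "f * g = (f0 + f1 + f2) * (g0 + g1 + g2)"
    unfolding defs by (simp only: sect_3_decomp[symmetric])
  also have "\<dots> = h0 + h1 + h2"
    unfolding h0_def h1_def h2_def by (simp add: algebra_simps)
  finally have fg: "f * g = h0 + h1 + h2" .
  have "sect 3 0 (f * g) = h0" "sect 3 1 (f * g) = h1" "sect 3 2 (f * g) = h2"
    unfolding fg using sect_res[OF 0] sect_res[OF 1] sect_res[OF 2]
      sect_res_other[OF 0] sect_res_other[OF 1] sect_res_other[OF 2] by simp_all
  then show "sect 3 0 (f * g) = sect 3 0 f * sect 3 0 g + sect 3 1 f * sect 3 2 g + sect 3 2 f * sect 3 1 g"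
    "sect 3 1 (f * g) = sect 3 0 f * sect 3 1 g + sect 3 1 f * sect 3 0 g + sect 3 2 f * sect 3 2 g"
    "sect 3 2 (f * g) = sect 3 0 f * sect 3 2 g + sect 3 1 f * sect 3 1 g + sect 3 2 f * sect 3 0 g"
    by (simp_all add: h0_def h1_def h2_def defs)
qed

lemma sect_1:
  "m > 1 \<Longrightarrow> sect m 0 1 = 1" "m > 1 \<Longrightarrow> r > 0 \<Longrightarrow> sect m r 1 = 0"
  by (auto simp: fps_eq_iff)

lemma sect_X:
  "m > 1 \<Longrightarrow> sect m (Suc 0) fps_X = fps_X" "m > 1 \<Longrightarrow> r \<noteq> Suc 0 \<Longrightarrow> sect m r fps_X = 0"
  by (auto simp: fps_eq_iff fps_X_nth)

lemma sect_4_3_sect: "sect 4 3 (sect 2 1 f) = sect 4 3 f"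
proof -
  have "n mod 4 = 3 \<Longrightarrow> n mod 2 = 1" for n :: nat
    by presburger
  then show ?thesis by (auto simp: fps_eq_iff)
qed

text \<open>All exponents of \<open>fps_X * dil 2 f\<close> are 1 modulo 4 when \<open>f\<close> is
  even.\<close>

lemma sect_4_3_X_dil:
  assumes "res 2 0 f"
  shows "sect 4 3 (fps_X * dil 2 f) = 0"
proof (rule fps_ext)
  fix n :: nat
  show "fps_nth (sect 4 3 (fps_X * dil 2 f)) n = fps_nth 0 n"
  proof (cases "n mod 4 = 3")
    case True
    define j where "j = n div 4"
    have n: "n = Suc (2 * (2 * j + 1))"
      using True unfolding j_def by presburger
    have "fps_nth f (2 * j + 1) = 0"
      using assms unfolding res_def by simp
    then have "fps_nth (dil 2 f) (2 * (2 * j + 1)) = 0"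
      by (simp only: dil_nth_mult zero_less_numeral)
    then have "fps_nth (fps_X * dil 2 f) n = 0"
      unfolding n by (simp only: fps_X_mult_nth) simp
    then show ?thesis by simp
  qed simp
qed

lemma sect_numeral_mult: "sect m r (numeral k * f) = numeral k * sect m r f"
  by (rule sect_mult_res[OF res_numeral(1)])

lemma fps_nonzeroI: "fps_nth f 0 = (1 :: int) \<Longrightarrow> f \<noteq> 0"
  by auto

lemma res_X_power_dil: "m > 0 \<Longrightarrow> res m (j mod m) (fps_X ^ j * dil m f)"
  by (auto simp: res_def fps_X_power_mult_nth dil_nth mod_eq_dvd_iff_nat)

lemma int_fps_inverse:
  fixes F :: "int fps"
  assumes "fps_nth F 0 = 1"
  obtains G where "F * G = 1" "fps_nth G 0 = 1"
proof -
  have FG: "F * fps_right_inverse F 1 = 1"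
    using assms by (intro fps_right_inverse) simp
  then have "fps_nth (F * fps_right_inverse F 1) 0 = 1"
    by simp
  with assms FG that show ?thesis by simp
qed

section \<open>Expansions with integer coefficients\<close>

definition complex_fps :: "int fps \<Rightarrow> complex fps" where
  "complex_fps f = Abs_fps (\<lambda>n. of_int (fps_nth f n))"

lemma complex_fps_nth [simp]: "fps_nth (complex_fps f) n = of_int (fps_nth f n)"
  by (simp add: complex_fps_def)

lemma complex_fps_inject [simp]: "complex_fps f = complex_fps g \<longleftrightarrow> f = g"
  by (simp add: fps_eq_iff)

lemma complex_fps_add: "complex_fps (f + g) = complex_fps f + complex_fps g"
  by (simp add: fps_eq_iff)

lemma complex_fps_diff: "complex_fps (f - g) = complex_fps f - complex_fps g"
  by (simp add: fps_eq_iff)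

lemma complex_fps_mult: "complex_fps (f * g) = complex_fps f * complex_fps g"
  by (simp add: fps_eq_iff fps_mult_nth)

lemma complex_fps_1 [simp]: "complex_fps 1 = 1"
  by (simp add: fps_eq_iff)

lemma complex_fps_numeral [simp]: "complex_fps (numeral k) = numeral k"
  by (simp add: fps_eq_iff fps_numeral_nth)

lemma complex_fps_X [simp]: "complex_fps fps_X = fps_X"
  by (simp add: fps_eq_iff)

lemma complex_fps_power: "complex_fps (f ^ k) = complex_fps f ^ k"
  by (induction k) (simp_all add: complex_fps_mult)

text \<open>Only the germ at 0 matters here, so that an identity in the unit disc becomes, by
  uniqueness of the expansion, an identity between integer series.\<close>

definition int_expansion :: "(complex \<Rightarrow> complex) \<Rightarrow> int fps \<Rightarrow> bool" where
  "int_expansion f F \<longleftrightarrow> f has_fps_expansion complex_fps F"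

lemma int_expansion_cong:
  assumes "int_expansion f F" "\<And>q. norm q < 1 \<Longrightarrow> f q = g q"
  shows "int_expansion g F"
proof -
  have "eventually (\<lambda>q::complex. q \<in> ball 0 1) (nhds 0)"
    by (intro eventually_nhds_in_open) auto
  then have "eventually (\<lambda>q. f q = g q) (nhds 0)"
    by eventually_elim (use assms(2) in auto)
  then show ?thesis
    using assms(1) has_fps_expansion_cong[OF _ refl, of f g] by (simp add: int_expansion_def)
qed

lemma int_expansion_unique:
  assumes "int_expansion f F" "int_expansion g G" "\<And>q. norm q < 1 \<Longrightarrow> f q = g q"
  shows "F = G"
proof -
  have "int_expansion g F"
    using assms(1,3) by (rule int_expansion_cong)
  then have "complex_fps F = complex_fps G"
    using assms(2) fps_expansion_unique_complex unfolding int_expansion_def by blast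
  then show ?thesis by simp
qed

lemma int_expansion_intros:
  assumes "int_expansion f F" "int_expansion g G"
  shows "int_expansion (\<lambda>q. f q + g q) (F + G)" "int_expansion (\<lambda>q. f q - g q) (F - G)"
    "int_expansion (\<lambda>q. f q * g q) (F * G)"
  using assms unfolding int_expansion_def complex_fps_add complex_fps_diff complex_fps_mult
  by (auto intro: has_fps_expansion_add has_fps_expansion_diff has_fps_expansion_mult)

lemma int_expansion_power: "int_expansion f F \<Longrightarrow> int_expansion (\<lambda>q. f q ^ k) (F ^ k)"
  unfolding int_expansion_def complex_fps_power by (rule has_fps_expansion_power)

lemma int_expansion_const:
  "int_expansion (\<lambda>q. 1) 1" "int_expansion (\<lambda>q. numeral k) (numeral k)" "int_expansion (\<lambda>q. q) fps_X"
  unfolding int_expansion_def by (auto intro: has_fps_expansion_fps_X)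

lemma int_expansion_dilate:
  assumes "int_expansion f F" "m > 0"
  shows "int_expansion (\<lambda>q. f (q ^ m)) (dil m F)"
proof -
  have "(f \<circ> (\<lambda>q. q ^ m)) has_fps_expansion (complex_fps F oo fps_X ^ m)"
    using assms unfolding int_expansion_def
    by (intro has_fps_expansion_compose has_fps_expansion_fps_X_power) auto
  moreover have "complex_fps F oo fps_X ^ m = complex_fps (F oo fps_X ^ m)"
    using assms(2) by (auto simp: fps_eq_iff fps_nth_compose_X_power)
  ultimately show ?thesis by (simp add: int_expansion_def o_def dil_def)
qed

lemma int_expansion_int_power_series:
  assumes "int_power_series f a"
  shows "int_expansion f (Abs_fps a)"
  unfolding int_expansion_def
proof (rule has_fps_expansionI)
  have "eventually (\<lambda>q::complex. q \<in> ball 0 1) (nhds 0)"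
    by (intro eventually_nhds_in_open) auto
  then show "\<forall>\<^sub>F u in nhds 0. (\<lambda>n. fps_nth (complex_fps (Abs_fps a)) n * u ^ n) sums f u"
    by eventually_elim (use assms in \<open>auto simp: int_power_series_def\<close>)
qed

lemma lacunary_sums:
  fixes c :: "nat \<Rightarrow> int" and e :: "nat \<Rightarrow> nat" and q s :: complex
  assumes "strict_mono e"
  shows "(\<lambda>k. of_int (if k \<in> range e then c (the_inv e k) else 0) * q ^ k) sums s
    \<longleftrightarrow> (\<lambda>n. of_int (c n) * q ^ e n) sums s"
  using sums_mono_reindex[OF assms, of "\<lambda>k. of_int (if k \<in> range e then c (the_inv e k) else 0) * q ^ k" s]
    assms by (simp add: the_inv_f_f strict_mono_imp_inj_on)

text \<open>The indices n >= 0 and n <= -1 give strictly increasing exponents \<open>e\<close> and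
  \<open>e'\<close> separately; exponents of different halves may coincide, so the two coefficient
  sequences are added. Since 0 < a < b, the exponent 0 occurs for the index 0 only.\<close>

lemma theta_power_series:
  assumes ab: "0 < a" "a < b"
  obtains F :: "int fps" where "fps_nth F 0 = 1"
    "\<And>q. norm q < 1 \<Longrightarrow> q \<noteq> 0 \<Longrightarrow> (\<lambda>n. of_int (fps_nth F n) * q ^ n) sums theta (q ^ a) (q ^ b)"
proof
  define e where "e = (\<lambda>n::nat. b * (n * (n - 1) div 2) + a * n)"
  define e' where "e' = (\<lambda>n::nat. b * (n * (n + 1) div 2) + (b - a) * (n + 1))"
  define c where "c = (\<lambda>k. if k \<in> range e then (- 1) ^ the_inv e k else (0::int))"
  define c' where "c' = (\<lambda>k. if k \<in> range e' then - ((- 1) ^ the_inv e' k) else (0::int))"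
  have mono: "strict_mono e"
    unfolding strict_mono_Suc_iff
  proof
    fix n
    have "Suc n * (Suc n - 1) div 2 = n * (n - 1) div 2 + n"
      by (cases n) auto
    then show "e n < e (Suc n)"
      using ab by (simp add: e_def distrib_left)
  qed
  have mono': "strict_mono e'"
    unfolding strict_mono_Suc_iff
  proof
    fix n
    have "Suc n * (Suc n + 1) div 2 = n * (n + 1) div 2 + Suc n"
      by simp
    then show "e' n < e' (Suc n)"
      using ab by (simp add: e'_def distrib_left)
  qed
  let ?F = "Abs_fps (\<lambda>k. c k + c' k)"
  have "e 0 = 0" by (simp add: e_def)
  then have "c 0 = 1"
    using mono by (metis c_def power_0 rangeI strict_mono_imp_inj_on the_inv_f_f)
  moreover have "c' 0 = 0"
    using ab by (auto simp: c'_def e'_def)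
  ultimately show "fps_nth ?F 0 = 1" by simp
  fix q :: complex assume q: "norm q < 1" "q \<noteq> 0"
  have qb: "norm (q ^ b) < 1" "q ^ b \<noteq> 0" "q ^ a \<noteq> 0"
    using q ab by (auto simp: norm_power power_less_one_iff)
  define f where "f = theta_term (q ^ a) (q ^ b)"
  have f: "(f has_sum theta (q ^ a) (q ^ b)) UNIV"
    unfolding f_def by (rule theta_has_sum[OF qb])
  have f_pos: "f (int n) = of_int ((- 1) ^ n) * q ^ e n" for n
  proof -
    have "(- (q ^ a)) ^ n = (- 1) ^ n * (q ^ a) ^ n"
      by (metis mult_minus1 power_mult_distrib)
    then show ?thesis
      by (simp add: f_def theta_term_def tri_of_nat e_def power_add flip: power_mult)
  qed
  have f_neg: "f (- 1 - int n) = of_int (- ((- 1) ^ n)) * q ^ e' n" for n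
  proof -
    have "q ^ b / q ^ a = q ^ (b - a)"
      using q ab by (simp add: power_diff)
    then have "f (- 1 - int n) = theta_term (q ^ (b - a)) (q ^ b) (int (Suc n))"
      using theta_term_minus[OF qb(2,3), of "int (Suc n)"] by (simp add: f_def add.commute)
    moreover have "(- (q ^ (b - a))) ^ Suc n = - ((- 1) ^ n) * (q ^ (b - a)) ^ Suc n"
      by (metis mult_minus1 power_mult_distrib power_Suc mult_minus_left mult_1)
    ultimately show ?thesis
      by (simp add: theta_term_def tri_of_nat e'_def power_add mult_ac flip: power_mult power_Suc del: of_nat_Suc)
  qed
  obtain s where s: "(f has_sum s) (range int)"
    using summable_on_subset_banach[OF has_sum_imp_summable[OF f]] by (metis subset_UNIV summable_on_def)
  obtain s' where s': "(f has_sum s') (range (\<lambda>n. - 1 - int n))"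
    using summable_on_subset_banach[OF has_sum_imp_summable[OF f]] by (metis subset_UNIV summable_on_def)
  have "(f has_sum (s + s')) (range int \<union> range (\<lambda>n. - 1 - int n))"
    by (rule has_sum_Un_disjoint[OF s s']) auto
  also have "range int \<union> range (\<lambda>n. - 1 - int n) = UNIV"
  proof -
    have "n = int (nat n) \<or> n = - 1 - int (nat (- 1 - n))" for n
      by simp
    then show ?thesis by blast
  qed
  finally have ss: "theta (q ^ a) (q ^ b) = s + s'"
    using has_sum_unique[OF f] by blast
  have "((\<lambda>n. f (int n)) has_sum s) UNIV"
    using s by (subst (asm) has_sum_reindex) (auto simp: o_def)
  then have 1: "(\<lambda>k. of_int (c k) * q ^ k) sums s"
    unfolding f_pos c_def lacunary_sums[OF mono] by (rule has_sum_imp_sums)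
  have "((\<lambda>n. f (- 1 - int n)) has_sum s') UNIV"
    using s' by (subst (asm) has_sum_reindex) (auto simp: o_def inj_def)
  then have 2: "(\<lambda>k. of_int (c' k) * q ^ k) sums s'"
    unfolding f_neg c'_def lacunary_sums[OF mono', of "\<lambda>n. - ((- 1) ^ n)"] by (rule has_sum_imp_sums)
  show "(\<lambda>n. of_int (fps_nth ?F n) * q ^ n) sums theta (q ^ a) (q ^ b)"
    using sums_add[OF 1 2] unfolding ss by (simp add: algebra_simps)
qed

lemma theta_int_expansion:
  assumes "0 < a" "a < b"
  obtains F where "fps_nth F 0 = 1" "int_expansion (\<lambda>q. if q = 0 then 1 else theta (q ^ a) (q ^ b)) F"
proof -
  obtain F :: "int fps" where F: "fps_nth F 0 = 1"
    "\<And>q. norm q < 1 \<Longrightarrow> q \<noteq> 0 \<Longrightarrow> (\<lambda>n. of_int (fps_nth F n) * q ^ n) sums theta (q ^ a) (q ^ b)"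
    using theta_power_series[OF assms] by blast
  have "eventually (\<lambda>q::complex. q \<in> ball 0 1) (nhds 0)"
    by (intro eventually_nhds_in_open) auto
  then have "\<forall>\<^sub>F q in nhds 0. (\<lambda>n. fps_nth (complex_fps F) n * q ^ n) sums (if q = 0 then 1 else theta (q ^ a) (q ^ b))"
  proof eventually_elim
    case (elim q)
    show ?case
    proof (cases "q = 0")
      case True
      then show ?thesis
        using powser_sums_zero[of "fps_nth (complex_fps F)"] F(1) by simp
    qed (use elim F(2)[of q] in auto)
  qed
  then have "int_expansion (\<lambda>q. if q = 0 then 1 else theta (q ^ a) (q ^ b)) F"
    unfolding int_expansion_def by (rule has_fps_expansionI)
  with F(1) that show ?thesis by blast
qed

lemma RR_int_expansion:
  obtains R where "fps_nth R 0 = 1" "int_expansion RR R"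
proof -
  obtain F where F: "fps_nth F 0 = 1" "int_expansion (\<lambda>q. if q = 0 then 1 else theta (q ^ 1) (q ^ 5)) F"
    by (rule theta_int_expansion[of 1 5]) auto
  obtain G where G: "fps_nth G 0 = 1" "int_expansion (\<lambda>q. if q = 0 then 1 else theta (q ^ 2) (q ^ 5)) G"
    by (rule theta_int_expansion[of 2 5]) auto
  obtain H where H: "G * H = 1" "fps_nth H 0 = 1"
    using int_fps_inverse[OF G(1)] by blast
  have "complex_fps G * complex_fps H = 1"
    using H(1) by (metis complex_fps_1 complex_fps_mult)
  then have "complex_fps F / complex_fps G = complex_fps (F * H)"
    using G(1) by (metis complex_fps_mult fps_divide_unit fps_inverse_unique complex_fps_nth of_int_1 one_neq_zero mult.commute)
  then have "int_expansion (\<lambda>q. (if q = 0 then 1 else theta (q ^ 1) (q ^ 5)) / (if q = 0 then 1 else theta (q ^ 2) (q ^ 5))) (F * H)"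
    using has_fps_expansion_divide'[of _ "complex_fps F" _ "complex_fps G"] F G
    by (simp add: int_expansion_def)
  then have "int_expansion RR (F * H)"
    by (rule int_expansion_cong) (auto simp: RR_eq_theta_quotient)
  moreover have "fps_nth (F * H) 0 = 1"
    using F(1) H(2) by simp
  ultimately show ?thesis using that by blast
qed

text \<open>Splitting the Euler product modulo 3 shows that it is \<open>theta q (q ^ 3)\<close>, so
  its expansion is the pentagonal number series.\<close>

lemma euler_function_int_expansion:
  obtains F where "fps_nth F 0 = 1" "int_expansion (\<lambda>q. qpoch_inf q q) F"
proof -
  obtain F where F: "fps_nth F 0 = 1" "int_expansion (\<lambda>q. if q = 0 then 1 else theta (q ^ 1) (q ^ 3)) F"
    by (rule theta_int_expansion[of 1 3]) auto
  have "(if q = 0 then 1 else theta (q ^ 1) (q ^ 3)) = qpoch_inf q q" if "norm q < 1" for q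
  proof (cases "q = 0")
    case False
    then show ?thesis
      using qpoch_power_multisection[of q 3 1 1] theta_power[of q 1 3] that
      by (simp add: prod_lessThan_3 power2_eq_square power3_eq_cube numeral_2_eq_2 mult.assoc)
  qed (simp add: qpoch_inf_def)
  then have "int_expansion (\<lambda>q. qpoch_inf q q) F"
    using F(2) by (rule int_expansion_cong[rotated]) 
  with F(1) that show ?thesis by blast
qed

section \<open>Congruences\<close>

text \<open>
  Dividing the cubic by \<open>y\<^sup>2 - 2 e y + (e\<^sup>2 - d\<^sup>2)\<close>, which vanishes at \<open>y = k\<close>, leaves
  \<open>r1 k + r0 = 0\<close> with even \<open>r1\<close> and \<open>r0\<close>; its odd part is \<open>r1 d\<close>, so \<open>r1 = r0 = 0\<close>.
\<close>

lemma even_part_relations: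
  fixes k s :: "int fps"
  defines "e \<equiv> sect 2 0 k" and "d \<equiv> sect 2 1 k"
  assumes k: "k ^ 3 + k\<^sup>2 + s * k - s = 0" and s: "res 2 0 s" and o0: "d \<noteq> 0"
  shows "e\<^sup>2 - d\<^sup>2 = s + 2 * e + 4 * e\<^sup>2" "e * (1 + 2 * e)\<^sup>2 + s * (1 + e) = 0"
proof -
  define n where "n = e\<^sup>2 - d\<^sup>2"
  define r1 where "r1 = s - n + 2 * e * (1 + 2 * e)"
  define r0 where "r0 = - s - n * (1 + 2 * e)"
  have ked: "k = e + d"
    unfolding e_def d_def by (rule sect_2_decomp)
  have re: "res 2 0 e" and ro: "res 2 1 d"
    by (simp_all add: e_def d_def)
  have dd: "res 2 0 (d * d)"
    by (rule res_mult[OF ro ro]) simp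
  have rn: "res 2 0 n"
    unfolding n_def power2_eq_square by (intro res0_intros re dd)
  have r1: "res 2 0 r1" and r0: "res 2 0 r0"
    unfolding r1_def r0_def by (intro res0_intros re s rn)+
  have r1o: "res 2 1 (r1 * d)"
    by (rule res_mult[OF r1 ro]) simp
  have r1e: "res 2 0 (r1 * e + r0)"
    by (intro res0_intros r1 r0 re)
  have eq: "r1 * d + (r1 * e + r0) = 0"
    using k unfolding ked r1_def r0_def n_def by algebra
  then have "sect 2 1 (r1 * d + (r1 * e + r0)) = 0"
    by simp
  then have "r1 * d = 0"
    using sect_res[OF r1o] sect_res_other[OF r1e, of 1] by simp
  then have r1_0: "r1 = 0"
    using o0 by simp
  then show n: "e\<^sup>2 - d\<^sup>2 = s + 2 * e + 4 * e\<^sup>2"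
    unfolding r1_def n_def by algebra
  have "r0 = 0"
    using eq r1_0 by simp
  then have "2 * (e * (1 + 2 * e)\<^sup>2 + s * (1 + e)) = 0"
    using n unfolding r0_def n_def by algebra
  then show "e * (1 + 2 * e)\<^sup>2 + s * (1 + e) = 0"
    by (simp only: mult_eq_0_iff) simp
qed

text \<open>
  The same argument with \<open>y\<^sup>3 - 3 a y\<^sup>2 + 3 m y - d\<close>, the norm of \<open>y - x\<close> over the series
  in \<open>q\<^sup>3\<close>.
\<close>

lemma cubic_part_relations:
  fixes x s :: "int fps"
  defines "a \<equiv> sect 3 0 x" and "b \<equiv> sect 3 1 x" and "c \<equiv> sect 3 2 x"
  assumes x: "x ^ 4 + x ^ 3 + 3 * s * x\<^sup>2 - s\<^sup>2 * x - s\<^sup>2 = 0" and s: "res 3 0 s"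
    and c3: "c ^ 3 \<noteq> b ^ 3" and c0: "c \<noteq> 0"
  shows "a\<^sup>2 - b * c = s + a + 3 * a\<^sup>2"
    "a ^ 3 + b ^ 3 + c ^ 3 - 3 * a * b * c = s\<^sup>2 + 3 * (a\<^sup>2 - b * c) * (1 + 3 * a)"
    "a * s\<^sup>2 + (a\<^sup>2 - b * c) * (1 + 3 * a)\<^sup>2 = 0"
proof -
  define m where "m = a\<^sup>2 - b * c"
  define d where "d = a ^ 3 + b ^ 3 + c ^ 3 - 3 * a * b * c"
  define r2 where "r2 = 3 * s - 3 * m + 3 * a * (1 + 3 * a)"
  define r1 where "r1 = d - s\<^sup>2 - 3 * m * (1 + 3 * a)"
  define r0 where "r0 = d * (1 + 3 * a) - s\<^sup>2"
  have xabc: "x = a + b + c"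
    unfolding a_def b_def c_def by (rule sect_3_decomp)
  have ra: "res 3 0 a" and rb: "res 3 1 b" and rc: "res 3 2 c"
    by (simp_all add: a_def b_def c_def)
  have rbc: "res 3 0 (b * c)"
    by (rule res_mult[OF rb rc]) simp
  have rb3: "res 3 0 (b ^ 3)" and rc3: "res 3 0 (c ^ 3)"
    using res_power[OF rb, of 3] res_power[OF rc, of 3] by simp_all
  have rm: "res 3 0 m"
    unfolding m_def by (intro res0_intros res0_power ra rbc)
  have rabc: "res 3 0 (3 * a * b * c)"
    unfolding mult.assoc by (intro res0_intros ra rbc)
  have rd: "res 3 0 d"
    unfolding d_def by (intro res0_intros res0_power ra rb3 rc3 rabc)
  have r2: "res 3 0 r2" and r1: "res 3 0 r1" and r0: "res 3 0 r0"
    unfolding r2_def r1_def r0_def by (intro res0_intros res0_power ra rm rd s)+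
  define y0 where "y0 = r2 * (a\<^sup>2 + 2 * (b * c)) + r1 * a + r0"
  define y1 where "y1 = r2 * (c * c) + r2 * (2 * a) * b + r1 * b"
  define y2 where "y2 = r2 * (b * b) + r2 * (2 * a) * c + r1 * c"
  have "res 3 0 y0"
    unfolding y0_def by (intro res0_intros res0_power r2 r1 r0 ra rbc)
  have rcc: "res 3 1 (c * c)" and rbb: "res 3 2 (b * b)"
    by (rule res_mult[OF rc rc], simp, rule res_mult[OF rb rb], simp)
  have r2a: "res 3 0 (r2 * (2 * a))"
    by (intro res0_intros r2 ra)
  have ry1: "res 3 1 y1"
    unfolding y1_def
    by (intro res_add res_mult[OF r2 rcc] res_mult[OF r2a rb] res_mult[OF r1 rb]) simp_all
  have ry2: "res 3 2 y2"
    unfolding y2_def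
    by (intro res_add res_mult[OF r2 rbb] res_mult[OF r2a rc] res_mult[OF r1 rc]) simp_all
  have sum: "y0 + y1 + y2 = 0"
    using x unfolding xabc y0_def y1_def y2_def r2_def r1_def r0_def m_def d_def by algebra
  then have "sect 3 0 (y0 + y1 + y2) = 0" "sect 3 1 (y0 + y1 + y2) = 0" "sect 3 2 (y0 + y1 + y2) = 0"
    by simp_all
  then have y: "y0 = 0" "y1 = 0" "y2 = 0"
    using sect_res[OF \<open>res 3 0 y0\<close>] sect_res_other[OF \<open>res 3 0 y0\<close>] sect_res[OF ry1] sect_res_other[OF ry1]
      sect_res[OF ry2] sect_res_other[OF ry2] by simp_all
  have "r2 * (c ^ 3 - b ^ 3) = c * y1 - b * y2"
    unfolding y1_def y2_def by algebra
  then have r2_0: "r2 = 0"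
    using y c3 by simp
  then have "r1 * c = 0"
    using y unfolding y2_def by simp
  then have r1_0: "r1 = 0"
    using c0 by simp
  then have r0_0: "r0 = 0"
    using y r2_0 unfolding y0_def by simp
  have "3 * (m - (s + a + 3 * a\<^sup>2)) = 0"
    using r2_0 unfolding r2_def by algebra
  then have "m - (s + a + 3 * a\<^sup>2) = 0"
    by (metis mult_eq_0_iff zero_neq_numeral)
  then show "a\<^sup>2 - b * c = s + a + 3 * a\<^sup>2"
    unfolding m_def by (simp only: right_minus_eq)
  show "a ^ 3 + b ^ 3 + c ^ 3 - 3 * a * b * c = s\<^sup>2 + 3 * (a\<^sup>2 - b * c) * (1 + 3 * a)"
    using r1_0 unfolding r1_def d_def m_def by algebra
  have "3 * (a * s\<^sup>2 + m * (1 + 3 * a)\<^sup>2) = 0"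
    using r1_0 r0_0 unfolding r1_def r0_def by algebra
  then show "a * s\<^sup>2 + (a\<^sup>2 - b * c) * (1 + 3 * a)\<^sup>2 = 0"
    unfolding m_def by (metis mult_eq_0_iff zero_neq_numeral)
qed

text \<open>The formal content of the modular equations: \<open>R\<close> stands for the expansion
  of \<open>RR\<close> and \<open>F\<close> for that of the Euler product. Everything inside is
  algebra with integer power series.\<close>

locale RR_series =
  fixes R F :: "int fps"
  assumes R0: "fps_nth R 0 = 1" and F0: "fps_nth F 0 = 1"
    and degree_2: "dil 2 R - R ^ 2 = fps_X * R * dil 2 R ^ 2 * (dil 2 R + R ^ 2)"
    and degree_3: "(dil 3 R - R ^ 3) * (1 + fps_X\<^sup>2 * R * dil 3 R ^ 3) = 3 * fps_X * R ^ 2 * dil 3 R ^ 2"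
    and quintisection: "(1 - fps_X * dil 5 R - (fps_X * dil 5 R)\<^sup>2) * dil 25 F = dil 5 R * F"
    and eta_quotient: "(1 - 11 * fps_X * R ^ 5 - fps_X\<^sup>2 * R ^ 10) * dil 5 F ^ 6 = R ^ 5 * F ^ 6"
begin

text \<open>Here \<open>g\<close> is the reciprocal of 1 + k for k =
  \<open>fps_X * R * dil 2 R ^ 2\<close>, and \<open>K\<close> is congruent modulo 4 to the
  reciprocal of \<open>R ^ 5\<close>. Modulo 4 the even part of k leads to \<open>g\<close>, and the
  even part of \<open>g\<close> leads to its square, where the class 3 modulo 4 vanishes.\<close>

lemma mod_4_sections:
  obtains g e K where
    "4 dvd fps_X * R ^ 5 - (fps_X * R * dil 2 R ^ 2)"
    "e = sect 2 0 (fps_X * R * dil 2 R ^ 2)"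
    "R * dil 2 R ^ 2 * K = 1"
    "4 dvd e - (dil 2 g - 1)"
    "4 dvd sect 2 0 g - dil 2 (g\<^sup>2)"
    "4 dvd sect 4 3 (g\<^sup>2)"
    "2 dvd sect 4 3 g"
    "4 dvd sect 2 1 K - fps_X * (1 - e - 2 * e\<^sup>2)"
proof -
  define S where "S = dil 2 R"
  define k where "k = fps_X * R * S ^ 2"
  define s where "s = fps_X\<^sup>2 * S ^ 5"
  define e where "e = sect 2 0 k"
  define d where "d = sect 2 1 k"
  obtain t where t: "R\<^sup>2 = S + 2 * t"
    using frobenius_2[of R] unfolding S_def by (auto elim!: dvdE simp: algebra_simps)
  have s1k: "4 dvd fps_X * R ^ 5 - k"
    by (rule dvdI[of _ _ "fps_X * R * (t * S + t\<^sup>2)"]) (use t in \<open>unfold k_def, algebra\<close>)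
  \<comment> \<open>Ramanujan's parametrisation s = k^2 (1 + k) / (1 - k): \<open>degree_2\<close>
    reads \<open>S * (1 - k) = R\<^sup>2 * (1 + k)\<close>, and multiplication by
    \<open>fps_X\<^sup>2 * S ^ 4\<close> turns \<open>R\<^sup>2\<close> into
    \<open>k\<^sup>2\<close>.\<close>
  have cubic: "k ^ 3 + k\<^sup>2 + s * k - s = 0"
    using degree_2 unfolding k_def s_def S_def[symmetric] by algebra
  have s_dil: "s = dil 2 (fps_X * R ^ 5)"
    by (simp add: s_def S_def)
  have rs: "res 2 0 s"
    unfolding s_dil by (rule res_dil) auto
  have S0: "fps_nth S 0 = 1"
    by (simp add: S_def R0)
  have k1: "fps_nth k 1 = 1"
    using R0 S0 by (simp add: k_def mult.assoc power2_eq_square)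
  have k0: "fps_nth k 0 = 0"
    by (simp add: k_def)
  have d0: "d \<noteq> 0"
    by (metis d_def fps_zero_nth k1 mod_less one_less_numeral_iff semiring_norm(76) sect_nth zero_neq_one)
  have ked: "k = e + d"
    unfolding e_def d_def by (rule sect_2_decomp)
  have n: "e\<^sup>2 - d\<^sup>2 = s + 2 * e + 4 * e\<^sup>2" and es: "e * (1 + 2 * e)\<^sup>2 + s * (1 + e) = 0"
    using even_part_relations[OF cubic rs] d0 unfolding e_def d_def by blast+
  have re: "res 2 0 e" and rd: "res 2 1 d"
    by (simp_all add: e_def d_def)
  have "fps_nth (1 + k) 0 = 1"
    by (simp add: k0)
  then obtain g where g: "(1 + k) * g = 1" and g0: "fps_nth g 0 = 1"
    using int_fps_inverse by blast
  define D where "D = 1 + dil 2 k"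
  define G where "G = dil 2 g"
  have DG: "D * G = 1"
    using g unfolding D_def G_def by (metis dil_simps(1,4,6) zero_less_numeral)
  have "4 dvd dil 2 (fps_X * R ^ 5 - k)"
    using s1k by (simp del: dil_simps)
  then have sk: "4 dvd s - dil 2 k"
    unfolding s_dil by simp
  then obtain q1 where q1: "s = D - 1 + 4 * q1"
    unfolding D_def by (auto elim!: dvdE simp: algebra_simps)
  \<comment> \<open>Modulo 4 the relation \<open>es\<close> is \<open>(1 + e) * (1 + s) = 1\<close>,
    and \<open>1 + s\<close> is congruent to \<open>D\<close>, the inverse of
    \<open>G\<close>.\<close>
  have eG: "4 dvd e - (G - 1)"
    by (rule dvdI[of _ _ "- G * (e\<^sup>2 + e ^ 3 + q1 * (1 + e))"]) (use es q1 DG in algebra)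
  define ge where "ge = sect 2 0 g"
  define gd where "gd = sect 2 1 g"
  have ged: "g = ge + gd"
    unfolding ge_def gd_def by (rule sect_2_decomp)
  have rge: "res 2 0 ge" and rgd: "res 2 1 gd"
    by (simp_all add: ge_def gd_def)
  have "sect 2 0 ((1 + k) * g) = 1" "sect 2 1 ((1 + k) * g) = 0"
    unfolding g by (simp_all add: sect_1)
  then have parts: "(1 + e) * gd + d * ge = 0" "(1 + e) * ge + d * gd = 1"
    unfolding sect_2_mult by (simp_all add: sect_1 e_def d_def ge_def gd_def)
  obtain q2 where q2: "e = G - 1 + 4 * q2"
    using eG by (auto elim!: dvdE simp: algebra_simps)
  \<comment> \<open>The norm \<open>(1 + e)\<^sup>2 - d\<^sup>2\<close> equals
    \<open>1 + s + 4 * e + 4 * e\<^sup>2\<close> by \<open>n\<close>, hence is \<open>D\<close>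
    modulo 4. So \<open>ge\<close> is \<open>(1 + e) / D\<close> and \<open>gd\<close> is
    \<open>- d / D\<close> modulo 4.\<close>
  have geG: "4 dvd ge - G\<^sup>2"
    by (rule dvdI[of _ _ "G * (q2 - ge * (q1 + e + e\<^sup>2))"]) (use parts n q1 q2 DG in algebra)
  have gdG: "4 dvd gd + d * G"
    by (rule dvdI[of _ _ "- G * gd * (q1 + e + e\<^sup>2)"]) (use parts n q1 DG in algebra)
  define h where "h = Abs_fps (\<lambda>i. fps_nth d (2 * i + 1))"
  have dh: "d = fps_X * dil 2 h"
  proof (rule fps_ext)
    fix i
    show "fps_nth d i = fps_nth (fps_X * dil 2 h) i"
    proof (cases "odd i")
      case True
      then obtain j where "i = 2 * j + 1" by (elim oddE)
      then show ?thesis by (simp add: h_def)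
    next
      case False
      then have "fps_nth d i = 0" by (simp add: d_def)
      moreover have "i = 0 \<or> \<not> even (i - 1)" using False by (cases i) auto
      ultimately show ?thesis by (auto simp: dil_nth)
    qed
  qed
  \<comment> \<open>Normalised so that \<open>fps_X * H\<^sup>2\<close> becomes a polynomial in
    \<open>k\<close> modulo 4. The even part of \<open>fps_X * H\<^sup>2\<close> is twice
    \<open>fps_X\<close> times the product of the two parts of \<open>H\<close>, which will decide
    the parity of the odd part.\<close>
  define H where "H = (1 + k) * h"
  have dil_H: "dil 2 H = D * dil 2 h"
    by (simp add: H_def D_def)
  define q3 where "q3 = - (e\<^sup>2 + e ^ 3)"
  have q3: "(1 + s) * e = - s + 4 * q3"
    using es unfolding q3_def by algebra
  \<comment> \<open>Modulo 4, \<open>n\<close> gives d^2 = e^2 - s - 2 e and \<open>q3\<close> gives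
    (1 + s) e = - s, hence (1 + s)^2 d^2 = s^2 - s (1 + s)^2 + 2 s (1 + s) = s + s^2 - s^3. The
    witness collects the multiples of 4 dropped on the way.\<close>
  have "4 dvd fps_X\<^sup>2 * dil 2 H ^ 2 - (s + s\<^sup>2 - s ^ 3)"
    by (rule dvdI[of _ _ "(- 2 * q1 * (1 + s) + 4 * q1\<^sup>2) * d\<^sup>2 - (1 + s)\<^sup>2 * e\<^sup>2
         + (- 2 * s * q3 + 4 * q3\<^sup>2 - 2 * (1 + s) * q3)"])
      (use dh dil_H q1 q3 n in algebra)
  moreover define s1 where "s1 = fps_X * R ^ 5"
  have "fps_X\<^sup>2 * dil 2 H ^ 2 - (s + s\<^sup>2 - s ^ 3) = dil 2 (fps_X * H\<^sup>2 - (s1 + s1\<^sup>2 - s1 ^ 3))"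
    unfolding s_dil s1_def[symmetric] by simp
  ultimately have H1: "4 dvd fps_X * H\<^sup>2 - (s1 + s1\<^sup>2 - s1 ^ 3)"
    by (simp del: dil_simps)
  obtain q4 where q4: "s1 = k + 4 * q4"
    using s1k unfolding s1_def by (auto elim!: dvdE simp: algebra_simps)
  have "4 dvd (s1 + s1\<^sup>2 - s1 ^ 3) - (k + k\<^sup>2 - k ^ 3)"
    by (rule dvdI[of _ _ "q4 * (1 + (s1 + k) - (s1\<^sup>2 + s1 * k + k\<^sup>2))"]) (use q4 in algebra)
  from dvd_add[OF H1 this] have "4 dvd fps_X * H\<^sup>2 - (k + k\<^sup>2 - k ^ 3)"
    by (simp add: algebra_simps)
  then have H2: "4 dvd sect 2 0 (fps_X * H\<^sup>2) - sect 2 0 (k + k\<^sup>2 - k ^ 3)"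
    using dvd_sect[of _ "fps_X * H\<^sup>2 - (k + k\<^sup>2 - k ^ 3)" 2 0] by simp
  define He where "He = sect 2 0 H"
  define Hd where "Hd = sect 2 1 H"
  have "sect 2 0 (k + k\<^sup>2 - k ^ 3) = e + e\<^sup>2 + d\<^sup>2 - e ^ 3 - 3 * e * d\<^sup>2"
    unfolding power2_eq_square power3_eq_cube sect_add sect_diff sect_2_mult e_def[symmetric] d_def[symmetric]
    by algebra
  also have "\<dots> = 4 * (- q3 + 2 * e\<^sup>2 - e ^ 3 + e * s - e\<^sup>2 * (1 - 3 * e))"
    using n q3 by algebra
  finally have "4 dvd sect 2 0 (k + k\<^sup>2 - k ^ 3)"
    by (rule dvdI)
  moreover have "sect 2 0 (fps_X * H\<^sup>2) = 2 * (fps_X * (He * Hd))"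
    unfolding power2_eq_square sect_2_mult He_def[symmetric] Hd_def[symmetric]
    by (simp add: sect_X algebra_simps)
  ultimately have "4 dvd 2 * (fps_X * (He * Hd))"
    using H2 by (metis dvd_add diff_add_cancel)
  then have "(2 :: int fps) * 2 dvd 2 * (fps_X * (He * Hd))"
    by simp
  then have "2 dvd fps_X ^ 1 * (He * Hd)"
    unfolding dvd_mult_cancel_left by simp
  then have "2 dvd He * Hd"
    by (rule dvd_X_power_mult_cancel)
  moreover have "fps_nth He 0 = 1"
    by (simp add: He_def H_def k0 h_def d_def k1[simplified])
  then obtain Hi where "He * Hi = 1"
    using int_fps_inverse by blast
  ultimately have "2 dvd Hd"
    by (rule dvd_unit_mult_cancel)
  then obtain q5 where q5: "H = He + 2 * q5"
    using sect_2_decomp[of H] unfolding He_def Hd_def by (auto elim!: dvdE)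
  obtain q6 where q6: "g\<^sup>2 = dil 2 g + 2 * q6"
    using frobenius_2[of g] by (auto elim!: dvdE simp: algebra_simps)
  \<comment> \<open>Since \<open>h * g = H * g\<^sup>2\<close>, the series \<open>h * g\<close> is
    even modulo 2: \<open>H\<close> is congruent to its even part and \<open>g\<^sup>2\<close> to
    \<open>dil 2 g\<close>.\<close>
  have hg: "h * g = He * dil 2 g + 2 * (q5 * g\<^sup>2 + He * q6)"
    using g q5 q6 unfolding H_def by algebra
  have "d * G = fps_X * dil 2 (h * g)"
    by (simp add: dh G_def)
  also have "\<dots> = fps_X * dil 2 (He * dil 2 g) + 2 * (fps_X * dil 2 (q5 * g\<^sup>2 + He * q6))"
    unfolding hg by (simp add: algebra_simps)
  finally have dG: "d * G = fps_X * dil 2 (He * dil 2 g) + 2 * (fps_X * dil 2 (q5 * g\<^sup>2 + He * q6))" .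
  have "res 2 0 (He * dil 2 g)"
    by (intro res0_intros res_dil) (simp_all add: He_def)
  then have "sect 4 3 (fps_X * dil 2 (He * dil 2 g)) = 0"
    by (rule sect_4_3_X_dil)
  then have dG43: "2 dvd sect 4 3 (d * G)"
    unfolding dG sect_add sect_numeral_mult by simp
  obtain q7 where "gd + d * G = 4 * q7"
    using gdG by (elim dvdE)
  then have q7: "gd = 2 * (2 * q7) - d * G"
    by algebra
  have gd43: "2 dvd sect 4 3 gd"
    unfolding q7 sect_diff sect_numeral_mult by (intro dvd_diff dG43 dvd_triv_left)
  then have g43: "2 dvd sect 4 3 g"
    unfolding gd_def sect_4_3_sect .
  have G2: "G\<^sup>2 = dil 2 (g\<^sup>2)"
    by (simp add: G_def)
  then have G4: "G\<^sup>2 = dil 4 g + 2 * dil 2 q6"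
    unfolding q6 by (simp add: dil_dil)
  obtain q8 where "ge - G\<^sup>2 = 4 * q8"
    using geG by (elim dvdE)
  then have ge4: "ge = dil 4 g + 2 * (dil 2 q6 + 2 * q8)"
    using G4 by algebra
  have "sect 4 3 (ge * gd) = dil 4 g * sect 4 3 gd + 2 * sect 4 3 ((dil 2 q6 + 2 * q8) * gd)"
  proof -
    have "ge * gd = dil 4 g * gd + 2 * ((dil 2 q6 + 2 * q8) * gd)"
      unfolding ge4 by algebra
    moreover have "sect 4 3 (dil 4 g * gd) = dil 4 g * sect 4 3 gd"
      by (intro sect_mult_res res_dil) simp_all
    ultimately show ?thesis
      by (simp only: sect_add sect_numeral_mult)
  qed
  then have "2 dvd sect 4 3 (ge * gd)"
    using gd43 by simp
  moreover have "sect 4 3 (g\<^sup>2) = 2 * sect 4 3 (ge * gd)"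
  proof -
    have "sect 2 1 (g\<^sup>2) = 2 * (ge * gd)"
      unfolding power2_eq_square sect_2_mult ge_def[symmetric] gd_def[symmetric] by algebra
    then show ?thesis
      by (metis sect_4_3_sect sect_numeral_mult)
  qed
  ultimately have g2: "4 dvd sect 4 3 (g\<^sup>2)"
    using mult_dvd_mono[of 2 2 2 "sect 4 3 (ge * gd)"] by simp
  have "fps_nth (R * S ^ 2) 0 = 1"
    by (simp add: R0 S0 power2_eq_square)
  then obtain K where K: "R * S ^ 2 * K = 1"
    using int_fps_inverse by blast
  define Ke where "Ke = sect 2 0 K"
  define Kd where "Kd = sect 2 1 K"
  have "k * K = fps_X"
    using K unfolding k_def by algebra
  then have "sect 2 0 (k * K) = 0" "sect 2 1 (k * K) = fps_X"
    by (simp_all add: sect_X)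
  then have K_parts: "e * Ke + d * Kd = 0" "e * Kd + d * Ke = fps_X"
    unfolding sect_2_mult e_def d_def Ke_def Kd_def .
  \<comment> \<open>From \<open>K_parts\<close>,
    \<open>(e\<^sup>2 - d\<^sup>2) * Kd = e * fps_X\<close>; the third root of the cubic is
    \<open>- 1 - 2 * e\<close>, so that
    \<open>(e\<^sup>2 - d\<^sup>2) * (1 + 2 * e) = - s\<close>.\<close>
  have "s * ((1 + 2 * e) * Kd - (1 + e) * fps_X) = 0"
    using K_parts n es by algebra
  moreover have "s \<noteq> 0"
  proof
    assume "s = 0"
    then have "S = 0" by (simp add: s_def)
    with S0 show False by simp
  qed
  ultimately have "(1 + 2 * e) * Kd = (1 + e) * fps_X"
    by simp
  then have "Kd - fps_X * (1 - e - 2 * e\<^sup>2) = 4 * (e\<^sup>2 * Kd)"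
    by algebra
  then have Kd: "4 dvd Kd - fps_X * (1 - e - 2 * e\<^sup>2)"
    by (rule dvdI)
  have "4 dvd sect 2 0 g - dil 2 (g\<^sup>2)"
    using geG unfolding G2 ge_def .
  with s1k e_def K eG g2 g43 Kd show thesis
    unfolding k_def S_def Kd_def G_def by (intro that[of e K g])
qed

text \<open>The index is halved twice, 16 n + 12 to 8 n + 6 to 4 n + 3, while the series passes from
  \<open>e\<close> to \<open>g\<close> to \<open>g\<^sup>2\<close>.\<close>

lemma even_section_coefficient_mod_4:
  assumes "e = sect 2 0 (fps_X * R * dil 2 R ^ 2)" "4 dvd e - (dil 2 g - 1)"
    "4 dvd sect 2 0 g - dil 2 (g\<^sup>2)" "4 dvd sect 4 3 (g\<^sup>2)"
  shows "4 dvd fps_nth e (16 * n + 12)"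
proof -
  have "4 dvd fps_nth (e - (dil 2 g - 1)) (2 * (8 * n + 6))"
    "4 dvd fps_nth (sect 2 0 g - dil 2 (g\<^sup>2)) (2 * (4 * n + 3))"
    "4 dvd fps_nth (sect 4 3 (g\<^sup>2)) (4 * n + 3)"
    using assms unfolding numeral_dvd_fps_iff by blast+
  then have "4 dvd fps_nth e (2 * (8 * n + 6)) - fps_nth g (8 * n + 6)"
    "4 dvd fps_nth g (2 * (4 * n + 3)) - fps_nth (g\<^sup>2) (4 * n + 3)" "4 dvd fps_nth (g\<^sup>2) (4 * n + 3)"
    unfolding fps_sub_nth by (simp_all only: dil_nth_mult zero_less_numeral) simp_all
  then show ?thesis by (simp add: algebra_simps) presburger
qed

theorem fifth_power_mod_4: "4 dvd fps_nth (R ^ 5) (16 * n + 11)"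
proof -
  obtain g e K where h: "4 dvd fps_X * R ^ 5 - (fps_X * R * dil 2 R ^ 2)"
    "e = sect 2 0 (fps_X * R * dil 2 R ^ 2)" "4 dvd e - (dil 2 g - 1)"
    "4 dvd sect 2 0 g - dil 2 (g\<^sup>2)" "4 dvd sect 4 3 (g\<^sup>2)"
    using mod_4_sections by metis
  have "4 dvd fps_nth (fps_X * R ^ 5 - fps_X * R * dil 2 R ^ 2) (16 * n + 12)"
    using h(1) unfolding numeral_dvd_fps_iff by blast
  moreover have "fps_nth (fps_X * R * dil 2 R ^ 2) (16 * n + 12) = fps_nth e (16 * n + 12)"
    by (simp add: h(2))
  moreover have "4 dvd fps_nth e (16 * n + 12)"
    by (rule even_section_coefficient_mod_4[OF h(2-5)])
  moreover have "fps_nth (fps_X * R ^ 5) (16 * n + 12) = fps_nth (R ^ 5) (16 * n + 11)"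
    by (simp add: add.commute)
  ultimately show ?thesis
    by (metis dvd_diffD1 fps_sub_nth dvd_diff diff_diff_eq2 dvd_add diff_add_cancel)
qed

theorem inverse_fifth_power_mod_4:
  assumes P: "P * R ^ 5 = 1"
  shows "4 dvd fps_nth P (16 * n + 13)"
proof -
  obtain g e K where h: "4 dvd fps_X * R ^ 5 - (fps_X * R * dil 2 R ^ 2)"
    "e = sect 2 0 (fps_X * R * dil 2 R ^ 2)" "4 dvd e - (dil 2 g - 1)"
    "4 dvd sect 2 0 g - dil 2 (g\<^sup>2)" "4 dvd sect 4 3 (g\<^sup>2)"
    and K: "R * dil 2 R ^ 2 * K = 1" and g: "2 dvd sect 4 3 g"
    and Kd: "4 dvd sect 2 1 K - fps_X * (1 - e - 2 * e\<^sup>2)"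
    by (rule mod_4_sections)
  have e4: "4 dvd fps_nth e (16 * n + 12)"
    by (rule even_section_coefficient_mod_4[OF h(2-5)])
  obtain w where "fps_X * R ^ 5 - fps_X * R * dil 2 R ^ 2 = 4 * w"
    using h(1) by (elim dvdE)
  then have "fps_X * (K - P) = 4 * (w * P * K)"
    using P K by algebra
  then have "4 dvd fps_X ^ 1 * (K - P)"
    by simp
  then have KP: "4 dvd K - P"
    by (rule dvd_X_power_mult_cancel)
  \<comment> \<open>Modulo 2, \<open>e\<close> is \<open>dil 2 g - 1\<close>, so its square is
    \<open>dil 4 g - 1\<close>; the index 16 n + 12 is 4 (4 n + 3), in the class where
    \<open>g\<close> is even.\<close>
  have e2: "2 dvd fps_nth (e\<^sup>2) (16 * n + 12)"
  proof -
    obtain w where "e - (dil 2 g - 1) = 4 * w"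
      using h(3) by (elim dvdE)
    moreover obtain u where "(g - 1)\<^sup>2 - dil 2 (g - 1) = 2 * u"
      using frobenius_2[of "g - 1"] by (elim dvdE)
    then have "dil 2 ((g - 1)\<^sup>2 - dil 2 (g - 1)) = dil 2 (2 * u)"
      by simp
    then have "(dil 2 g - 1)\<^sup>2 = dil 4 g - 1 + 2 * dil 2 u"
      by (simp add: dil_dil algebra_simps)
    ultimately have "e\<^sup>2 = dil 4 g - 1 + 2 * (dil 2 u + 4 * w * (dil 2 g - 1) + 8 * w\<^sup>2)"
      by algebra
    moreover have "2 dvd fps_nth (sect 4 3 g) (4 * n + 3)"
      using g unfolding numeral_dvd_fps_iff by blast
    then have "2 dvd fps_nth g (4 * n + 3)" by simp
    then have "2 dvd fps_nth (dil 4 g) (4 * (4 * n + 3))"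
      by (simp only: dil_nth_mult zero_less_numeral)
    then have "2 dvd fps_nth (dil 4 g) (16 * n + 12)"
      by (simp add: algebra_simps)
    ultimately show ?thesis by simp
  qed
  have "4 dvd fps_nth (sect 2 1 K - fps_X * (1 - e - 2 * e\<^sup>2)) (16 * n + 13)"
    using Kd unfolding numeral_dvd_fps_iff by blast
  moreover have "fps_nth (sect 2 1 K) (16 * n + 13) = fps_nth K (16 * n + 13)"
  proof -
    have "(16 * n + 13) mod 2 = 1" by presburger
    then show ?thesis by simp
  qed
  moreover have "fps_nth (fps_X * (1 - e - 2 * e\<^sup>2)) (16 * n + 13) = - fps_nth e (16 * n + 12) - 2 * fps_nth (e\<^sup>2) (16 * n + 12)"
    by (simp add: add.commute)
  ultimately have "4 dvd fps_nth K (16 * n + 13) - (- fps_nth e (16 * n + 12) - 2 * fps_nth (e\<^sup>2) (16 * n + 12))"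
    by simp
  moreover have "4 dvd fps_nth (K - P) (16 * n + 13)"
    using KP unfolding numeral_dvd_fps_iff by blast
  ultimately show ?thesis
    using e4 e2 unfolding fps_sub_nth by presburger
qed

text \<open>Here \<open>g\<close> is the reciprocal of 1 + x for x =
  \<open>fps_X\<^sup>2 * R * dil 3 R ^ 3\<close>. Modulo 3 the quartic yields a (1 + s^2) = - s for
  the section a of x in the class 0, and s^2 is x(q^3), so dividing by 1 + s^2 means multiplying by
  \<open>dil 3 g\<close>.\<close>

lemma mod_3_sections:
  obtains g where "3 dvd sect 3 1 g"
    "3 dvd sect 3 0 (fps_X * R ^ 5) - (1 - dil 3 g)"
    "\<And>P. P * R ^ 5 = 1 \<Longrightarrow> 3 dvd sect 3 1 P + fps_X * dil 3 g"
proof -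
  define T where "T = dil 3 R"
  define x where "x = fps_X\<^sup>2 * R * T ^ 3"
  define s1 where "s1 = fps_X * R ^ 5"
  define s where "s = fps_X ^ 3 * T ^ 5"
  define a where "a = sect 3 0 x"
  define b where "b = sect 3 1 x"
  define c where "c = sect 3 2 x"
  have s_dil: "s = dil 3 s1"
    by (simp add: s_def T_def s1_def)
  have rs: "res 3 0 s"
    unfolding s_dil by (rule res_dil) auto
  have T0: "fps_nth T 0 = 1"
    by (simp add: T_def R0)
  then obtain Ti where "T * Ti = 1"
    using int_fps_inverse by blast
  then have T5: "T ^ 5 * Ti ^ 5 = 1"
    by (simp flip: power_mult_distrib)
  have s_cancel: "3 dvd f" if "3 dvd s * f" for f
  proof (rule dvd_unit_mult_cancel[OF _ T5])
    show "3 dvd T ^ 5 * f"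
      by (rule dvd_X_power_mult_cancel[of _ 3]) (use that in \<open>simp add: s_def mult.assoc\<close>)
  qed
  obtain t where "R ^ 3 - T = 3 * t"
    using frobenius_3[of R] unfolding T_def by (elim dvdE)
  then have t: "R ^ 3 = T + 3 * t"
    by algebra
  \<comment> \<open>Multiplied by \<open>fps_X ^ 6 * T ^ 9\<close>, \<open>degree_3\<close> reads
    \<open>(s\<^sup>2 - x ^ 3) * (1 + x) = 3 * s * x\<^sup>2\<close>.\<close>
  have quartic: "x ^ 4 + x ^ 3 + 3 * s * x\<^sup>2 - s\<^sup>2 * x - s\<^sup>2 = 0"
    using degree_3 unfolding x_def s_def T_def[symmetric] by algebra
  have x_nth: "fps_nth x 0 = 0" "fps_nth x 1 = 0" "fps_nth x 2 = 1"
    unfolding x_def mult.assoc by (simp_all add: fps_X_power_mult_nth R0 T0 fps_nth_power_0)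
  have c2: "fps_nth c 2 = 1" and b2: "fps_nth b 2 = 0"
    by (simp_all add: b_def c_def x_nth)
  then have c0: "c \<noteq> 0" by auto
  have c3: "c ^ 3 \<noteq> b ^ 3"
  proof
    assume eq: "c ^ 3 = b ^ 3"
    with c0 have b0: "b \<noteq> 0" by auto
    have "subdegree c = 2"
    proof (rule subdegreeI)
      show "fps_nth c i = 0" if "i < 2" for i
        using that by (auto simp: c_def less_2_cases_iff)
    qed (simp add: c2)
    moreover have "3 * subdegree c = 3 * subdegree b"
      using eq by (metis subdegree_power)
    ultimately have "subdegree b = 2" by simp
    with b0 b2 show False by (metis nth_subdegree_nonzero)
  qed
  define m where "m = a\<^sup>2 - b * c"
  have m: "m = s + a + 3 * a\<^sup>2"
    and d: "a ^ 3 + b ^ 3 + c ^ 3 - 3 * a * b * c = s\<^sup>2 + 3 * m * (1 + 3 * a)"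
    and ms: "a * s\<^sup>2 + m * (1 + 3 * a)\<^sup>2 = 0"
    using cubic_part_relations[OF quartic rs] c3 c0 unfolding a_def b_def c_def m_def by blast+
  define z where "z = m * (2 * a + 3 * a\<^sup>2)"
  have m': "m = - a * s\<^sup>2 - 3 * z"
    using ms unfolding z_def by algebra
  define w1 where "w1 = - (a\<^sup>2 + z)"
  have w1: "a * (1 + s\<^sup>2) + s = 3 * w1"
    using m m' unfolding w1_def by algebra
  have "fps_nth (1 + x) 0 = 1"
    by (simp add: x_nth)
  then obtain g where g: "(1 + x) * g = 1" and g0: "fps_nth g 0 = 1"
    using int_fps_inverse by blast
  have "fps_nth g 2 = - 1"
  proof -
    have "g = 1 - fps_X\<^sup>2 * (R * T ^ 3 * g)"
      using g unfolding x_def by algebra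
    then have "fps_nth g 2 = fps_nth (1 - fps_X\<^sup>2 * (R * T ^ 3 * g)) 2"
      by simp
    then show ?thesis
      by (simp add: fps_X_power_mult_nth R0 T0 g0 fps_nth_power_0)
  qed
  then have g2_nth: "fps_nth (sect 3 2 g) 2 = - 1"
    by simp
  define h0 where "h0 = sect 3 0 g"
  define h1 where "h1 = sect 3 1 g"
  define h2 where "h2 = sect 3 2 g"
  define A where "A = 1 + a"
  have "sect 3 0 ((1 + x) * g) = 1" "sect 3 1 ((1 + x) * g) = 0" "sect 3 2 ((1 + x) * g) = 0"
    unfolding g by (simp_all add: sect_1)
  then have parts: "A * h0 + b * h2 + c * h1 = 1" "A * h1 + b * h0 + c * h2 = 0" "A * h2 + b * h1 + c * h0 = 0"
    unfolding sect_3_mult by (simp_all add: sect_1 A_def a_def b_def c_def h0_def h1_def h2_def)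
  define N where "N = A ^ 3 + b ^ 3 + c ^ 3 - 3 * A * b * c"
  have Nh: "N * h1 = c\<^sup>2 - A * b" "N * h2 = b\<^sup>2 - A * c"
    using parts unfolding N_def by algebra+
  define p where "p = b * c"
  have p: "p = a\<^sup>2 + a * s\<^sup>2 + 3 * z"
    using m' unfolding m_def p_def by algebra
  have bc: "b ^ 3 + c ^ 3 = s\<^sup>2 - a ^ 3 + 3 * (m * (1 + 3 * a) + a * p)"
    using d unfolding p_def by algebra
  \<comment> \<open>\<open>h1\<close> and \<open>h2\<close> lie in the classes 1 and 2, but their
    product lies in the class 0, where \<open>p\<close> and \<open>b ^ 3 + c ^ 3\<close> are known
    in terms of \<open>a\<close> and \<open>s\<close>.\<close>
  have "N\<^sup>2 * (h2 * h1) = p * (p + A\<^sup>2) - A * (b ^ 3 + c ^ 3)"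
    using Nh unfolding p_def by algebra
  also have "\<dots> = 3 * (a ^ 4 + a ^ 3 * s\<^sup>2 + a ^ 3 - 2 * s * w1 + 3 * w1\<^sup>2 + z * (2 * (a\<^sup>2 + a * s\<^sup>2) + A\<^sup>2)
      + 3 * z\<^sup>2 - A * (m * (1 + 3 * a) + a * p))"
  proof -
    have "(a * (1 + s\<^sup>2))\<^sup>2 = s\<^sup>2 - 6 * s * w1 + 9 * w1\<^sup>2"
      using w1 by algebra
    then show ?thesis
      using p bc unfolding A_def by algebra
  qed
  finally have "3 dvd N\<^sup>2 * (h2 * h1)"
    by (rule dvdI)
  moreover have "fps_nth N 0 = 1"
    by (simp add: N_def A_def a_def b_def c_def x_nth fps_nth_power_0 power3_eq_cube)
  then obtain Ni where "N * Ni = 1"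
    using int_fps_inverse by blast
  then have "N\<^sup>2 * Ni\<^sup>2 = 1"
    by (simp flip: power_mult_distrib)
  ultimately have "3 dvd h2 * h1"
    by (rule dvd_unit_mult_cancel)
  \<comment> \<open>\<open>h2\<close> starts with \<open>- fps_X\<^sup>2\<close>, so what is left
    after removing this monomial is a unit, and the divisibility passes to
    \<open>h1\<close>.\<close>
  moreover define u where "u = - fps_shift 2 h2"
  have "h2 = - (fps_X\<^sup>2 * u)"
  proof (rule fps_ext)
    fix n
    show "fps_nth h2 n = fps_nth (- (fps_X\<^sup>2 * u)) n"
    proof (cases "n < 2")
      case True
      then show ?thesis by (auto simp: h2_def fps_X_power_mult_nth less_2_cases_iff)
    next
      case False
      then obtain j where "n = j + 2"
        using le_add_diff_inverse2[of 2 n] by (metis not_less)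
      then show ?thesis by (simp add: u_def fps_X_power_mult_nth)
    qed
  qed
  ultimately have "3 dvd - (fps_X\<^sup>2 * (u * h1))"
    by (simp add: mult.assoc)
  then have "3 dvd u * h1"
    unfolding dvd_minus_iff by (rule dvd_X_power_mult_cancel)
  moreover have "fps_nth u 0 = 1"
    using g2_nth by (simp add: u_def h2_def numeral_2_eq_2)
  then obtain ui where "u * ui = 1"
    using int_fps_inverse by blast
  ultimately have g1: "3 dvd sect 3 1 g"
    unfolding h1_def[symmetric] by (rule dvd_unit_mult_cancel)
  define w3 where "w3 = fps_X ^ 3 * T ^ 3 * (2 * t * T + 3 * t\<^sup>2)"
  \<comment> \<open>Modulo 3 the product is q^3 R^6 T^3 = q^3 T^5, so \<open>s1\<close> is
    \<open>s / x\<close>.\<close>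
  have s1x: "s1 * x = s + 3 * w3"
    using t unfolding s1_def x_def s_def w3_def by algebra
  define y where "y = fps_X\<^sup>2 * R * (3 * t * T\<^sup>2 + 9 * t\<^sup>2 * T + 9 * t ^ 3)"
  have "x = s1\<^sup>2 - 3 * y"
    using t unfolding s1_def x_def y_def by algebra
  then have "dil 3 x = s\<^sup>2 - 3 * dil 3 y"
    by (simp add: s_dil)
  then have s2: "s\<^sup>2 = dil 3 x + 3 * dil 3 y"
    by algebra
  have "dil 3 ((1 + x) * g) = dil 3 1"
    by (simp only: g)
  then have DG: "(1 + dil 3 x) * dil 3 g = 1"
    by simp
  \<comment> \<open>The product of the conjugates of \<open>x\<close> under q \<mapsto> \<zeta> q
    with \<zeta> a primitive cube root of unity. Thus \<open>x * l\<close> is the norm, which is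
    \<open>s\<^sup>2\<close> modulo 3, and \<open>s / x\<close> becomes
    \<open>l / s\<close>.\<close>
  define l where "l = m + (c\<^sup>2 - a * b) + (b\<^sup>2 - a * c)"
  have "s * (s * s1 - l) = 3 * (w3 * l - s1 * m * (1 + 3 * a))"
  proof -
    have "x * l = s\<^sup>2 + 3 * m * (1 + 3 * a)"
      using d sect_3_decomp[of x] unfolding l_def m_def a_def[symmetric] b_def[symmetric] c_def[symmetric]
      by algebra
    then show ?thesis
      using s1x by algebra
  qed
  then have "3 dvd s * s1 - l"
    by (rule s_cancel[OF dvdI])
  then have "3 dvd sect 3 0 (s * s1 - l)"
    by (rule dvd_sect)
  moreover have "sect 3 0 l = m"
    unfolding l_def m_def a_def b_def c_def power2_eq_square
    by (simp add: sect_3_mult sect_sect)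
  ultimately have "3 dvd s * sect 3 0 s1 - m"
    by (simp add: sect_mult_res[OF rs])
  then obtain w4 where "s * sect 3 0 s1 - m = 3 * w4"
    by (elim dvdE)
  then have "s * (sect 3 0 s1 + a * s) = 3 * (w4 - z)"
    using m' by algebra
  then have "3 dvd sect 3 0 s1 + a * s"
    by (rule s_cancel[OF dvdI])
  then obtain w5 where "sect 3 0 s1 + a * s = 3 * w5"
    by (elim dvdE)
  then have "sect 3 0 s1 - (1 - dil 3 g) =
      3 * (dil 3 g * ((1 + s\<^sup>2) * w5 - s * w1 - dil 3 y * sect 3 0 s1 + dil 3 y))"
    using w1 s2 DG by algebra
  then have "3 dvd sect 3 0 s1 - (1 - dil 3 g)"
    by (rule dvdI)
  moreover have "3 dvd sect 3 1 P + fps_X * dil 3 g" if P: "P * R ^ 5 = 1" for P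
  proof -
    have "s * P = fps_X * x - 3 * (P * w3)"
      using P s1x unfolding s1_def by algebra
    then have "sect 3 1 (s * P) = sect 3 1 (fps_X * x - 3 * (P * w3))"
      by simp
    then have "s * sect 3 1 P = fps_X * a - 3 * sect 3 1 (P * w3)"
      unfolding sect_mult_res[OF rs] sect_diff sect_numeral_mult
      by (simp add: sect_3_mult(2)[of fps_X x, simplified] sect_X a_def)
    then have "s * ((1 + s\<^sup>2) * sect 3 1 P + fps_X) = 3 * (fps_X * w1 - (1 + s\<^sup>2) * sect 3 1 (P * w3))"
      using w1 by algebra
    then have "3 dvd (1 + s\<^sup>2) * sect 3 1 P + fps_X"
      by (rule s_cancel[OF dvdI])
    then obtain w6 where "(1 + s\<^sup>2) * sect 3 1 P + fps_X = 3 * w6"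
      by (elim dvdE)
    then have "sect 3 1 P + fps_X * dil 3 g = 3 * (dil 3 g * (w6 - dil 3 y * sect 3 1 P))"
      using s2 DG by algebra
    then show ?thesis by (rule dvdI)
  qed
  ultimately show thesis
    using g1 that unfolding s1_def by blast
qed

theorem fifth_power_mod_3: "3 dvd fps_nth (R ^ 5) (9 * n + 2)"
proof -
  obtain g where g: "3 dvd sect 3 1 g" "3 dvd sect 3 0 (fps_X * R ^ 5) - (1 - dil 3 g)"
    using mod_3_sections by metis
  have "3 dvd fps_nth (sect 3 1 g) (3 * n + 1)"
    "3 dvd fps_nth (sect 3 0 (fps_X * R ^ 5) - (1 - dil 3 g)) (3 * (3 * n + 1))"
    using g unfolding numeral_dvd_fps_iff by blast+
  then have "3 dvd fps_nth g (3 * n + 1)"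
    "3 dvd fps_nth (fps_X * R ^ 5) (3 * (3 * n + 1)) + fps_nth g (3 * n + 1)"
    unfolding fps_sub_nth by (simp_all only: dil_nth_mult zero_less_numeral) simp_all
  then have "3 dvd fps_nth (fps_X * R ^ 5) (3 * (3 * n + 1))"
    using dvd_add_left_iff by blast
  moreover have "3 * (3 * n + 1) = Suc (9 * n + 2)"
    by simp
  ultimately show ?thesis
    by (simp only: fps_X_mult_nth) simp
qed

theorem inverse_fifth_power_mod_3:
  assumes P: "P * R ^ 5 = 1"
  shows "3 dvd fps_nth P (9 * n + 4)"
proof -
  obtain g where g: "3 dvd sect 3 1 g" "3 dvd sect 3 1 P + fps_X * dil 3 g"
    using mod_3_sections P by metis
  have "3 dvd fps_nth (sect 3 1 g) (3 * n + 1)"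
    "3 dvd fps_nth (sect 3 1 P + fps_X * dil 3 g) (Suc (3 * (3 * n + 1)))"
    using g unfolding numeral_dvd_fps_iff by blast+
  moreover have "Suc (3 * (3 * n + 1)) mod 3 = 1" "(3 * n + 1) mod 3 = 1"
    by presburger+
  moreover have "fps_nth (fps_X * dil 3 g) (Suc (3 * (3 * n + 1))) = fps_nth g (3 * n + 1)"
    using dil_nth_mult[of 3 g "3 * n + 1"] by (simp only: fps_X_mult_nth) simp
  ultimately have "3 dvd fps_nth g (3 * n + 1)"
    "3 dvd fps_nth P (Suc (3 * (3 * n + 1))) + fps_nth g (3 * n + 1)"
    by (simp_all only: fps_add_nth sect_nth refl if_True)
  then have "3 dvd fps_nth P (Suc (3 * (3 * n + 1)))"
    using dvd_add_left_iff by blast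
  moreover have "Suc (3 * (3 * n + 1)) = 9 * n + 4"
    by simp
  ultimately show ?thesis by (simp only:)
qed

text \<open>Multiplying \<open>eta_quotient\<close> at q and at q^5 and inserting the sixth power of
  \<open>quintisection\<close> eliminates all Euler products. What remains is quadratic in
  \<open>U\<close> with coefficients in \<open>v\<close>, and it factors.\<close>

lemma degree_5:
  defines "v \<equiv> fps_X * dil 5 R"
  shows "fps_X * R ^ 5 * (1 + 3 * v + 4 * v\<^sup>2 + 2 * v ^ 3 + v ^ 4) = v * (1 - 2 * v + 4 * v\<^sup>2 - 3 * v ^ 3 + v ^ 4)"
proof -
  define U where "U = fps_X * R ^ 5"
  define S where "S = dil 5 R"
  define F5 where "F5 = dil 5 F"
  define F25 where "F25 = dil 25 F"
  define P where "P = 1 - 2 * v + 4 * v\<^sup>2 - 3 * v ^ 3 + v ^ 4"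
  define Q where "Q = 1 + 3 * v + 4 * v\<^sup>2 + 2 * v ^ 3 + v ^ 4"
  define W where "W = 1 - 11 * v ^ 5 - v ^ 10"
  define N where "N = 1 - v - v\<^sup>2"
  have W: "W = N * P * Q"
    unfolding W_def N_def P_def Q_def by algebra
  have nz: "F5 \<noteq> 0" "F25 \<noteq> 0"
    using F0 by (auto simp: F5_def F25_def fps_eq_iff intro!: exI[of _ 0])
  have v: "v = fps_X * S"
    by (simp add: v_def S_def)
  have E1: "(1 - 11 * U - U\<^sup>2) * F5 ^ 6 = R ^ 5 * F ^ 6"
    using eta_quotient unfolding U_def F5_def[symmetric] by algebra
  have E2: "N * F25 = S * F"
    using quintisection unfolding N_def v S_def F25_def by simp
  have "dil 5 ((1 - 11 * fps_X * R ^ 5 - fps_X\<^sup>2 * R ^ 10) * dil 5 F ^ 6) = dil 5 (R ^ 5 * F ^ 6)"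
    by (simp only: eta_quotient)
  then have "(1 - 11 * fps_X ^ 5 * S ^ 5 - (fps_X ^ 5)\<^sup>2 * S ^ 10) * F25 ^ 6 = S ^ 5 * F5 ^ 6"
    by (simp add: S_def F5_def F25_def dil_dil)
  then have E3: "W * F25 ^ 6 = S ^ 5 * F5 ^ 6"
    unfolding W_def v by algebra
  have "F5 ^ 6 * F25 ^ 6 * (v * (1 - 11 * U - U\<^sup>2) * W) = v * ((1 - 11 * U - U\<^sup>2) * F5 ^ 6) * (W * F25 ^ 6)"
    by algebra
  also have "\<dots> = F5 ^ 6 * (U * (S * F) ^ 6)"
    unfolding E1 E3 unfolding U_def v by algebra
  also have "\<dots> = F5 ^ 6 * F25 ^ 6 * (U * N ^ 6)"
    unfolding E2[symmetric] by algebra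
  finally have "v * (1 - 11 * U - U\<^sup>2) * W = U * N ^ 6"
    using nz by simp
  then have "N * (v * (1 - 11 * U - U\<^sup>2) * (P * Q)) = N * (U * N ^ 5)"
    unfolding W by algebra
  moreover have v0: "fps_nth v 0 = 0"
    by (simp add: v)
  then have "fps_nth N 0 = 1"
    by (simp add: N_def power2_eq_square)
  then have "N \<noteq> 0" by (rule fps_nonzeroI)
  ultimately have "v * (1 - 11 * U - U\<^sup>2) * (P * Q) = U * N ^ 5"
    by simp
  \<comment> \<open>The splitting rests on the polynomial identity
    \<open>Q\<^sup>2 - v\<^sup>2 * P\<^sup>2 = N ^ 5 + 11 * v * P * Q\<close>. The two roots are
    exchanged by U \<mapsto> - 1 / U; the constant term of the second factor decides between
    them.\<close>
  then have "(U * Q - v * P) * (U * v * P + Q) = 0"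
    unfolding N_def P_def Q_def by algebra
  moreover have "fps_nth (U * v * P + Q) 0 = 1"
    by (simp add: U_def Q_def v0 power2_eq_square fps_nth_power_0)
  then have "U * v * P + Q \<noteq> 0" by (rule fps_nonzeroI)
  ultimately have "U * Q - v * P = 0"
    by simp
  then show ?thesis
    unfolding U_def P_def Q_def by simp
qed

text \<open>From C = P / Q, D = Q / P and W = N P Q with N = 1 - v - v^2 one has C W = N P^2 and D W
  = N Q^2. As \<open>v\<close> lies in the class 1 modulo 5 and \<open>W\<close> in the class 0, the
  section \<open>r\<close> consists of the powers \<open>v ^ i\<close> with i = r modulo 5;
  \<open>W'\<close> is the inverse of \<open>W\<close>.\<close>

lemma fifth_power_quotient_sections:
  fixes C D :: "int fps"
  assumes C: "C * dil 5 R = R ^ 5" and D: "D * R ^ 5 = dil 5 R"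
  obtains W' where
    "sect 5 1 C = 5 * (fps_X * dil 5 R) * (3 * (fps_X * dil 5 R) ^ 5 - 1) * W'"
    "sect 5 2 C = 5 * (fps_X * dil 5 R)\<^sup>2 * (3 + (fps_X * dil 5 R) ^ 5) * W'"
    "sect 5 3 C = - 10 * (fps_X * dil 5 R) ^ 3 * (3 + (fps_X * dil 5 R) ^ 5) * W'"
    "sect 5 2 D = 10 * (fps_X * dil 5 R)\<^sup>2 * (1 - 3 * (fps_X * dil 5 R) ^ 5) * W'"
    "sect 5 3 D = 5 * (fps_X * dil 5 R) ^ 3 * (1 - 3 * (fps_X * dil 5 R) ^ 5) * W'"
    "sect 5 4 D = - 5 * (fps_X * dil 5 R) ^ 4 * (3 + (fps_X * dil 5 R) ^ 5) * W'"
    "W' * (1 - 11 * (fps_X * dil 5 R) ^ 5 - (fps_X * dil 5 R) ^ 10) = 1"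
proof -
  define v where "v = fps_X * dil 5 R"
  define P where "P = 1 - 2 * v + 4 * v\<^sup>2 - 3 * v ^ 3 + v ^ 4"
  define Q where "Q = 1 + 3 * v + 4 * v\<^sup>2 + 2 * v ^ 3 + v ^ 4"
  define W where "W = 1 - 11 * v ^ 5 - v ^ 10"
  have W: "W = (1 - v - v\<^sup>2) * P * Q"
    unfolding W_def P_def Q_def by algebra
  have v0: "fps_nth v 0 = 0" by (simp add: v_def)
  have "fps_nth W 0 = 1"
    by (simp add: W_def v0 fps_nth_power_0)
  then obtain W' where W': "W * W' = 1"
    using int_fps_inverse by blast
  have R5: "fps_nth (dil 5 R) 0 = 1"
    by (simp add: R0)
  then have R5_nz: "dil 5 R \<noteq> 0"
    by (rule fps_nonzeroI)
  then have v_nz: "v \<noteq> 0"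
    by (simp add: v_def)
  have deg: "fps_X * R ^ 5 * Q = v * P"
    using degree_5 unfolding P_def Q_def v_def .
  have "v * (C * Q) = v * P"
    using deg C unfolding v_def by algebra
  then have CQ: "C * Q = P"
    using v_nz by simp
  have "dil 5 R * (D * C) = dil 5 R * 1"
    using C D by algebra
  then have "D * C = 1"
    using R5_nz by simp
  then have DP: "D * P = Q"
    using CQ by algebra
  have CW: "C * W = 1 - 5 * v + 15 * v\<^sup>2 - 30 * v ^ 3 + 40 * v ^ 4 - 36 * v ^ 5 + 15 * v ^ 6 + 5 * v ^ 7 - 10 * v ^ 8 + 5 * v ^ 9 - v ^ 10"
    using CQ unfolding W P_def by algebra
  have DW: "D * W = 1 + 5 * v + 10 * v\<^sup>2 + 5 * v ^ 3 - 15 * v ^ 4 - 36 * v ^ 5 - 40 * v ^ 6 - 30 * v ^ 7 - 15 * v ^ 8 - 5 * v ^ 9 - v ^ 10"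
    using DP unfolding W Q_def by algebra
  have "res 5 1 fps_X"
    by (auto simp: res_def fps_X_nth)
  then have rv: "res 5 1 v"
    unfolding v_def by (rule res_mult[OF _ res_dil]) auto
  have sect_v: "sect 5 r (v ^ i) = (if i mod 5 = r then v ^ i else 0)" for r i
    using res_power[OF rv, of i] sect_res sect_res_other by auto
  have "res 5 0 (v ^ 5)" "res 5 0 (v ^ 10)"
    using res_power[OF rv, of 5] res_power[OF rv, of 10] by simp_all
  then have rW: "res 5 0 W"
    unfolding W_def by (intro res0_intros)
  have sect_W: "sect 5 r f = sect 5 r (f * W) * W'" for r f
    using sect_mult_res[OF rW, of r f] W' by (metis mult.assoc mult.commute mult_1)
  have v1: "sect 5 r v = (if r = 1 then v else 0)" for r
    using sect_v[of r 1] by auto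
  have c1: "sect 5 1 C = (- 5 * v + 15 * v ^ 6) * W'" and c2: "sect 5 2 C = (15 * v\<^sup>2 + 5 * v ^ 7) * W'"
    and c3: "sect 5 3 C = (- 30 * v ^ 3 - 10 * v ^ 8) * W'"
    unfolding sect_W[of _ C] CW
    by (simp_all add: sect_numeral_mult sect_v v1 sect_1)
  have d2: "sect 5 2 D = (10 * v\<^sup>2 - 30 * v ^ 7) * W'" and d3: "sect 5 3 D = (5 * v ^ 3 - 15 * v ^ 8) * W'"
    and d4: "sect 5 4 D = (- 15 * v ^ 4 - 5 * v ^ 9) * W'"
    unfolding sect_W[of _ D] DW
    by (simp_all add: sect_numeral_mult sect_v v1 sect_1)
  show thesis
  proof (rule that[of W'])
    show "W' * (1 - 11 * (fps_X * dil 5 R) ^ 5 - (fps_X * dil 5 R) ^ 10) = 1"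
      using W' unfolding W_def v_def by (simp add: mult.commute)
  qed (unfold c1 c2 c3 d2 d3 d4, unfold v_def, algebra+)
qed

text \<open>Modulo 3 the section is supported on the single class of \<open>j\<close> modulo 15, so
  divisibility by 3 is automatic on the other classes modulo 15 that make up \<open>r\<close> modulo
  5.\<close>

lemma section_coefficient:
  assumes "sect 5 r f = numeral k * h" "sect 5 r f = c * (fps_X ^ j * dil 15 M) + 3 * w" "res 15 0 c"
    and n: "n mod 5 = r" "n mod 15 \<noteq> j mod 15"
  shows "numeral k dvd fps_nth f n" "3 dvd fps_nth f n"
proof -
  have fn: "fps_nth f n = fps_nth (sect 5 r f) n"
    using n by simp
  show "numeral k dvd fps_nth f n"
    unfolding fn assms(1) by simp
  have "res 15 (j mod 15) (c * (fps_X ^ j * dil 15 M))"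
    by (rule res_mult[OF assms(3) res_X_power_dil]) auto
  then have "fps_nth (c * (fps_X ^ j * dil 15 M)) n = 0"
    using n by (simp add: res_def)
  then show "3 dvd fps_nth f n"
    unfolding fn assms(2) by simp
qed

text \<open>By \<open>eta_quotient\<close> at q^5, \<open>S ^ 5 * W'\<close> is the sixth power of
  F(q^25) / F(q^5). Hence \<open>S ^ 8 * W'\<close> and \<open>S\<^sup>2 * W'\<close> are cubes of
  series in q^5, and modulo 3 they are series in q^15. In each section used, one of the two powers
  of \<open>v\<close> has a coefficient divisible by 3, and the other is a power of q times such a
  cube.\<close>

lemma section_divisibility:
  assumes C: "C * dil 5 R = R ^ 5" and D: "D * R ^ 5 = dil 5 R" and P: "P * R ^ 5 = 1"
  shows "n mod 15 \<in> {4, 8, 13, 14} \<Longrightarrow> 5 dvd fps_nth P n \<and> 3 dvd fps_nth P n"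
    "n mod 15 \<in> {2, 6, 11, 12} \<Longrightarrow> 5 dvd fps_nth (R ^ 5) n \<and> 3 dvd fps_nth (R ^ 5) n"
    "n mod 15 \<in> {3, 13} \<Longrightarrow> 10 dvd fps_nth C n \<and> 3 dvd fps_nth C n"
    "n mod 15 \<in> {7, 12} \<Longrightarrow> 10 dvd fps_nth D n \<and> 3 dvd fps_nth D n"
proof -
  define S where "S = dil 5 R"
  define v where "v = fps_X * S"
  obtain W' where sections:
    "sect 5 1 C = 5 * v * (3 * v ^ 5 - 1) * W'"
    "sect 5 2 C = 5 * v\<^sup>2 * (3 + v ^ 5) * W'"
    "sect 5 3 C = - 10 * v ^ 3 * (3 + v ^ 5) * W'"
    "sect 5 2 D = 10 * v\<^sup>2 * (1 - 3 * v ^ 5) * W'"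
    "sect 5 3 D = 5 * v ^ 3 * (1 - 3 * v ^ 5) * W'"
    "sect 5 4 D = - 5 * v ^ 4 * (3 + v ^ 5) * W'"
    and W': "W' * (1 - 11 * v ^ 5 - v ^ 10) = 1"
    using fifth_power_quotient_sections[OF C D] unfolding v_def S_def by metis
  obtain Ri where Ri: "R * Ri = 1"
    using int_fps_inverse[OF R0] by blast
  obtain J where J: "F * J = 1"
    using int_fps_inverse[OF F0] by blast
  define Si where "Si = dil 5 Ri"
  have "dil 5 (R * Ri) = 1" "dil 5 (F * J) = 1"
    unfolding Ri J by simp_all
  then have Si: "S * Si = 1" and J5: "dil 5 F * dil 5 J = 1"
    by (simp_all add: S_def Si_def)
  have "dil 5 ((1 - 11 * fps_X * R ^ 5 - fps_X\<^sup>2 * R ^ 10) * dil 5 F ^ 6) = dil 5 (R ^ 5 * F ^ 6)"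
    by (simp only: eta_quotient)
  then have "(1 - 11 * fps_X ^ 5 * S ^ 5 - (fps_X ^ 5)\<^sup>2 * S ^ 10) * dil 25 F ^ 6 = S ^ 5 * dil 5 F ^ 6"
    by (simp add: S_def dil_dil)
  then have "S ^ 5 * W' = dil 25 F ^ 6 * dil 5 J ^ 6"
    using W' J5 unfolding v_def by algebra
  then have SW: "S ^ 5 * W' = dil 5 ((dil 5 F ^ 2 * J ^ 2) ^ 3)"
    by (simp add: dil_dil power_mult_distrib flip: power_mult)
  have cube: "3 dvd dil 5 (y ^ 3) - dil 15 y" for y
  proof -
    have "3 dvd dil 5 (y ^ 3 - dil 3 y)"
      using frobenius_3[of y] by (simp del: dil_simps)
    then show ?thesis by (simp add: dil_dil)
  qed
  define M1 where "M1 = R * (dil 5 F ^ 2 * J ^ 2)"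
  define M2 where "M2 = Ri * (dil 5 F ^ 2 * J ^ 2)"
  have "S ^ 8 * W' = dil 5 (M1 ^ 3)"
  proof -
    have "dil 5 (M1 ^ 3) = S ^ 3 * dil 5 ((dil 5 F ^ 2 * J ^ 2) ^ 3)"
      unfolding M1_def power_mult_distrib[of R] by (simp add: S_def)
    then show ?thesis using SW by algebra
  qed
  with cube[of M1] obtain w1 where "S ^ 8 * W' - dil 15 M1 = 3 * w1"
    by (metis dvdE)
  then have w1: "S ^ 8 * W' = dil 15 M1 + 3 * w1"
    by algebra
  have "S ^ 2 * W' = dil 5 (M2 ^ 3)"
  proof -
    have "dil 5 (M2 ^ 3) = Si ^ 3 * dil 5 ((dil 5 F ^ 2 * J ^ 2) ^ 3)"
      unfolding M2_def power_mult_distrib[of Ri] by (simp add: Si_def)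
    then show ?thesis using SW Si by algebra
  qed
  with cube[of M2] obtain w2 where "S ^ 2 * W' - dil 15 M2 = 3 * w2"
    by (metis dvdE)
  then have w2: "S ^ 2 * W' = dil 15 M2 + 3 * w2"
    by algebra
  have rS: "res 5 0 S" and rSi: "res 5 0 Si"
    by (simp_all add: S_def Si_def res_dil)
  have B_sect: "sect 5 r (R ^ 5) = S * sect 5 r C" for r
    using sect_mult_res[OF rS, of r C] C by (simp add: S_def mult.commute)
  have "P = Si * D"
    using P D Si unfolding S_def[symmetric] by algebra
  then have P_sect: "sect 5 r P = Si * sect 5 r D" for r
    using sect_mult_res[OF rSi, of r D] by simp
  have res_c: "res 15 0 (numeral k)" "res 15 0 (- numeral k)" for k
    by (intro res0_intros)+
  have "Si * v ^ 3 * W' = fps_X ^ 3 * (S\<^sup>2 * W')"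
    using Si unfolding v_def by algebra
  then have k1: "Si * v ^ 3 * W' = fps_X ^ 3 * (dil 15 M2 + 3 * w2)"
    unfolding w2 .
  have "Si * v ^ 9 * W' = fps_X ^ 9 * (S ^ 8 * W')"
    using Si unfolding v_def by algebra
  then have k2: "Si * v ^ 9 * W' = fps_X ^ 9 * (dil 15 M1 + 3 * w1)"
    unfolding w1 .
  have "S * v * W' = fps_X * (S\<^sup>2 * W')"
    unfolding v_def by algebra
  then have k3: "S * v * W' = fps_X * (dil 15 M2 + 3 * w2)"
    unfolding w2 .
  have "S * v ^ 7 * W' = fps_X ^ 7 * (S ^ 8 * W')"
    unfolding v_def by algebra
  then have k4: "S * v ^ 7 * W' = fps_X ^ 7 * (dil 15 M1 + 3 * w1)"
    unfolding w1 .
  have "v ^ 8 * W' = fps_X ^ 8 * (S ^ 8 * W')"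
    unfolding v_def by algebra
  then have k5: "v ^ 8 * W' = fps_X ^ 8 * (dil 15 M1 + 3 * w1)"
    unfolding w1 .
  have "v\<^sup>2 * W' = fps_X\<^sup>2 * (S\<^sup>2 * W')"
    unfolding v_def by algebra
  then have k6: "v\<^sup>2 * W' = fps_X\<^sup>2 * (dil 15 M2 + 3 * w2)"
    unfolding w2 .
  \<comment> \<open>Every section is written twice, once for the factor 5 or 10 and once modulo 3.
    The classes modulo 15 lost modulo 3 are 3 and 9 for \<open>P\<close>, 1 and 7 for
    \<open>R ^ 5\<close>, 8 for \<open>C\<close> and 2 for \<open>D\<close>; the claim lists the
    remaining ones.\<close>
  have P3: "sect 5 3 P = 5 * (Si * v ^ 3 * (1 - 3 * v ^ 5) * W')"
    unfolding P_sect sections by algebra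
  have P3': "sect 5 3 P = 5 * (fps_X ^ 3 * dil 15 M2) + 3 * (5 * fps_X ^ 3 * w2 - 5 * Si * v ^ 8 * W')"
    using k1 unfolding P_sect sections by algebra
  have P4: "sect 5 4 P = 5 * (- Si * v ^ 4 * (3 + v ^ 5) * W')"
    unfolding P_sect sections by algebra
  have P4': "sect 5 4 P = - 5 * (fps_X ^ 9 * dil 15 M1) + 3 * (- 5 * fps_X ^ 9 * w1 - 5 * Si * v ^ 4 * W')"
    using k2 unfolding P_sect sections by algebra
  have B1: "sect 5 1 (R ^ 5) = 5 * (S * v * (3 * v ^ 5 - 1) * W')"
    unfolding B_sect sections by algebra
  have B1': "sect 5 1 (R ^ 5) = - 5 * (fps_X ^ 1 * dil 15 M2) + 3 * (- 5 * fps_X * w2 + 5 * S * v ^ 6 * W')"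
    using k3 unfolding B_sect sections by algebra
  have B2: "sect 5 2 (R ^ 5) = 5 * (S * v\<^sup>2 * (3 + v ^ 5) * W')"
    unfolding B_sect sections by algebra
  have B2': "sect 5 2 (R ^ 5) = 5 * (fps_X ^ 7 * dil 15 M1) + 3 * (5 * fps_X ^ 7 * w1 + 5 * S * v\<^sup>2 * W')"
    using k4 unfolding B_sect sections by algebra
  have C3: "sect 5 3 C = 10 * (- (v ^ 3) * (3 + v ^ 5) * W')"
    unfolding sections by algebra
  have C3': "sect 5 3 C = - 10 * (fps_X ^ 8 * dil 15 M1) + 3 * (- 10 * fps_X ^ 8 * w1 - 10 * v ^ 3 * W')"
    using k5 unfolding sections by algebra
  have D2: "sect 5 2 D = 10 * (v\<^sup>2 * (1 - 3 * v ^ 5) * W')"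
    unfolding sections by algebra
  have D2': "sect 5 2 D = 10 * (fps_X ^ 2 * dil 15 M2) + 3 * (10 * fps_X ^ 2 * w2 - 10 * v ^ 7 * W')"
    using k6 unfolding sections by algebra
  have mod5: "n mod 5 = (n mod 15) mod 5"
    by (simp add: mod_mod_cancel)
  show "5 dvd fps_nth P n \<and> 3 dvd fps_nth P n" if "n mod 15 \<in> {4, 8, 13, 14}"
    using that mod5 section_coefficient[OF P3 P3' res_c(1), of n] section_coefficient[OF P4 P4' res_c(2), of n] by auto
  show "5 dvd fps_nth (R ^ 5) n \<and> 3 dvd fps_nth (R ^ 5) n" if "n mod 15 \<in> {2, 6, 11, 12}"
    using that mod5 section_coefficient[OF B1 B1' res_c(2), of n] section_coefficient[OF B2 B2' res_c(1), of n] by auto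
  show "10 dvd fps_nth C n \<and> 3 dvd fps_nth C n" if "n mod 15 \<in> {3, 13}"
    using that mod5 section_coefficient[OF C3 C3' res_c(2), of n] by auto
  show "10 dvd fps_nth D n \<and> 3 dvd fps_nth D n" if "n mod 15 \<in> {7, 12}"
    using that mod5 section_coefficient[OF D2 D2' res_c(1), of n] by auto
qed

end

section \<open>From the analytic identities to the formal ones, and back to the coefficients\<close>

lemma RR_nonzero:
  assumes "norm q < 1"
  shows "RR q \<noteq> 0"
proof (cases "q = 0")
  case False
  then show ?thesis
    using assms theta_power_nonzero[of q 1 5] theta_power_nonzero[of q 2 5]
    by (simp add: RR_eq_theta_quotient)
qed simp

lemma RR_series_exists:
  obtains R F where "RR_series R F" "int_expansion RR R"
proof -
  obtain R where R: "fps_nth R 0 = 1" "int_expansion RR R"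
    by (rule RR_int_expansion)
  obtain F where F: "fps_nth F 0 = 1" "int_expansion (\<lambda>q. qpoch_inf q q) F"
    by (rule euler_function_int_expansion)
  have Rm: "int_expansion (\<lambda>q. RR (q ^ m)) (dil m R)" "int_expansion (\<lambda>q. qpoch_inf (q ^ m) (q ^ m)) (dil m F)" if "m > 0" for m
    using int_expansion_dilate[OF R(2) that] int_expansion_dilate[OF F(2) that] by simp_all
  \<comment> \<open>The theta identities exclude \<open>q = 0\<close>; there all infinite products
    are 1 and the four identities hold by inspection.\<close>
  have E0: "qpoch_inf 0 0 = 1"
    by (simp add: qpoch_inf_def)
  note intros = int_expansion_intros int_expansion_power int_expansion_const R(2) F(2) Rm
  have "RR_series R F"
  proof
    show "dil 2 R - R ^ 2 = fps_X * R * dil 2 R ^ 2 * (dil 2 R + R ^ 2)"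
    proof (rule int_expansion_unique)
      show "int_expansion (\<lambda>q. RR (q ^ 2) - RR q ^ 2) (dil 2 R - R ^ 2)"
        "int_expansion (\<lambda>q. q * RR q * RR (q ^ 2) ^ 2 * (RR (q ^ 2) + RR q ^ 2)) (fps_X * R * dil 2 R ^ 2 * (dil 2 R + R ^ 2))"
        by (intro intros; simp)+
      show "RR (q ^ 2) - RR q ^ 2 = q * RR q * RR (q ^ 2) ^ 2 * (RR (q ^ 2) + RR q ^ 2)" if "norm q < 1" for q
        using RR_degree_2[of q] that by (cases "q = 0") auto
    qed
    show "(dil 3 R - R ^ 3) * (1 + fps_X\<^sup>2 * R * dil 3 R ^ 3) = 3 * fps_X * R ^ 2 * dil 3 R ^ 2"
    proof (rule int_expansion_unique)
      show "int_expansion (\<lambda>q. (RR (q ^ 3) - RR q ^ 3) * (1 + q\<^sup>2 * RR q * RR (q ^ 3) ^ 3))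
          ((dil 3 R - R ^ 3) * (1 + fps_X\<^sup>2 * R * dil 3 R ^ 3))"
        "int_expansion (\<lambda>q. 3 * q * RR q ^ 2 * RR (q ^ 3) ^ 2) (3 * fps_X * R ^ 2 * dil 3 R ^ 2)"
        by (intro intros; simp)+
      show "(RR (q ^ 3) - RR q ^ 3) * (1 + q\<^sup>2 * RR q * RR (q ^ 3) ^ 3) = 3 * q * RR q ^ 2 * RR (q ^ 3) ^ 2"
        if "norm q < 1" for q
        using RR_degree_3[of q] that by (cases "q = 0") auto
    qed
    show "(1 - fps_X * dil 5 R - (fps_X * dil 5 R)\<^sup>2) * dil 25 F = dil 5 R * F"
    proof (rule int_expansion_unique)
      show "int_expansion (\<lambda>q. (1 - q * RR (q ^ 5) - (q * RR (q ^ 5))\<^sup>2) * qpoch_inf (q ^ 25) (q ^ 25))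
          ((1 - fps_X * dil 5 R - (fps_X * dil 5 R)\<^sup>2) * dil 25 F)"
        "int_expansion (\<lambda>q. RR (q ^ 5) * qpoch_inf q q) (dil 5 R * F)"
        by (intro intros; simp)+
      show "(1 - q * RR (q ^ 5) - (q * RR (q ^ 5))\<^sup>2) * qpoch_inf (q ^ 25) (q ^ 25) = RR (q ^ 5) * qpoch_inf q q"
        if "norm q < 1" for q
        using RR_quintisection[of q] that E0 by (cases "q = 0") auto
    qed
    show "(1 - 11 * fps_X * R ^ 5 - fps_X\<^sup>2 * R ^ 10) * dil 5 F ^ 6 = R ^ 5 * F ^ 6"
    proof (rule int_expansion_unique)
      show "int_expansion (\<lambda>q. (1 - 11 * q * RR q ^ 5 - q\<^sup>2 * RR q ^ 10) * qpoch_inf (q ^ 5) (q ^ 5) ^ 6)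
          ((1 - 11 * fps_X * R ^ 5 - fps_X\<^sup>2 * R ^ 10) * dil 5 F ^ 6)"
        "int_expansion (\<lambda>q. RR q ^ 5 * qpoch_inf q q ^ 6) (R ^ 5 * F ^ 6)"
        by (intro intros; simp)+
      show "(1 - 11 * q * RR q ^ 5 - q\<^sup>2 * RR q ^ 10) * qpoch_inf (q ^ 5) (q ^ 5) ^ 6 = RR q ^ 5 * qpoch_inf q q ^ 6"
        if "norm q < 1" for q
        using RR_fifth_power_eta_quotient[of q] that E0 by (cases "q = 0") auto
    qed
  qed (fact R F)+
  then show thesis
    using R(2) by (rule that)
qed

theorem theorem1p6:
  fixes A B C D :: "nat \<Rightarrow> int"
  assumes "int_power_series (\<lambda>q. 1 / RR q ^ 5) A"
    and "int_power_series (\<lambda>q. RR q ^ 5) B"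
    and "int_power_series (\<lambda>q. RR q ^ 5 / RR (q ^ 5)) C"
    and "int_power_series (\<lambda>q. RR (q ^ 5) / RR q ^ 5) D"
  shows "\<forall>n::nat.
      [A (9 * n + 4) = 0] (mod 3) \<and>
      [B (9 * n + 2) = 0] (mod 3) \<and>
      [A (16 * n + 13) = 0] (mod 4) \<and>
      [B (16 * n + 11) = 0] (mod 4) \<and>
      (\<forall>r\<in>{4, 8, 13, 14}. [A (15 * n + r) = 0] (mod 15)) \<and>
      (\<forall>r\<in>{2, 6, 11, 12}. [B (15 * n + r) = 0] (mod 15)) \<and>
      (\<forall>r\<in>{3, 13}. [C (15 * n + r) = 0] (mod 30)) \<and>
      (\<forall>r\<in>{7, 12}. [D (15 * n + r) = 0] (mod 30))"
proof -
  obtain R F where "RR_series R F" and R: "int_expansion RR R"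
    by (rule RR_series_exists)
  then interpret RR_series R F by simp
  note A = int_expansion_int_power_series[OF assms(1)] and B = int_expansion_int_power_series[OF assms(2)]
    and C = int_expansion_int_power_series[OF assms(3)] and D = int_expansion_int_power_series[OF assms(4)]
  have R5: "int_expansion (\<lambda>q. RR (q ^ 5)) (dil 5 R)"
    by (rule int_expansion_dilate[OF R]) simp
  have nz: "RR (q ^ 5) \<noteq> 0" if "norm q < 1" for q
    using that by (intro RR_nonzero) (simp add: norm_power power_less_one_iff)
  \<comment> \<open>The quotients are characterised by clearing denominators, which is legitimate
    because \<open>RR\<close> has no zero in the disc.\<close>
  have A': "Abs_fps A * R ^ 5 = 1"
    by (rule int_expansion_unique[OF int_expansion_intros(3)[OF A int_expansion_power[OF R]] int_expansion_const(1)])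
      (simp add: RR_nonzero)
  have B': "Abs_fps B = R ^ 5"
    by (rule int_expansion_unique[OF B int_expansion_power[OF R]]) simp
  have C': "Abs_fps C * dil 5 R = R ^ 5"
    by (rule int_expansion_unique[OF int_expansion_intros(3)[OF C R5] int_expansion_power[OF R]]) (simp add: nz)
  have D': "Abs_fps D * R ^ 5 = dil 5 R"
    by (rule int_expansion_unique[OF int_expansion_intros(3)[OF D int_expansion_power[OF R]] R5]) (simp add: RR_nonzero)
  have nth: "fps_nth (Abs_fps A) n = A n" "fps_nth (R ^ 5) n = B n"
    "fps_nth (Abs_fps C) n = C n" "fps_nth (Abs_fps D) n = D n" for n
    by (simp_all flip: B')
  note sections = section_divisibility[OF C' D' A', unfolded nth]
  show ?thesis
  proof (intro allI conjI ballI)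
    fix n r
    show "[A (9 * n + 4) = 0] (mod 3)"
      using inverse_fifth_power_mod_3[OF A', of n] by (simp add: cong_0_iff)
    show "[B (9 * n + 2) = 0] (mod 3)"
      using fifth_power_mod_3[of n] by (simp add: nth cong_0_iff)
    show "[A (16 * n + 13) = 0] (mod 4)"
      using inverse_fifth_power_mod_4[OF A', of n] by (simp add: cong_0_iff)
    show "[B (16 * n + 11) = 0] (mod 4)"
      using fifth_power_mod_4[of n] by (simp add: nth cong_0_iff)
    show "[A (15 * n + r) = 0] (mod 15)" if r: "r \<in> {4, 8, 13, 14}"
    proof -
      have "(15 * n + r) mod 15 \<in> {4, 8, 13, 14}"
        using r by auto
      from sections(1)[OF this] show ?thesis
        unfolding cong_0_iff by presburger
    qed
    show "[B (15 * n + r) = 0] (mod 15)" if r: "r \<in> {2, 6, 11, 12}"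
    proof -
      have "(15 * n + r) mod 15 \<in> {2, 6, 11, 12}"
        using r by auto
      from sections(2)[OF this] show ?thesis
        unfolding cong_0_iff by presburger
    qed
    show "[C (15 * n + r) = 0] (mod 30)" if r: "r \<in> {3, 13}"
    proof -
      have "(15 * n + r) mod 15 \<in> {3, 13}"
        using r by auto
      from sections(3)[OF this] show ?thesis
        unfolding cong_0_iff by presburger
    qed
    show "[D (15 * n + r) = 0] (mod 30)" if r: "r \<in> {7, 12}"
    proof -
      have "(15 * n + r) mod 15 \<in> {7, 12}"
        using r by auto
      from sections(4)[OF this] show ?thesis
        unfolding cong_0_iff by presburger
    qed
  qed
qed

end
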